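(* Let $k$ be a field, let $X=\{x_1,\dots,x_r\}$ be a nonempty finite set, fix a monomial order on $\mathrm{NF}(X)$, and let $\mathcal{B}=\mathrm{BC}(X|S)=\mathrm{BC}(X)/\mathrm{Id}(S)$, where $S$ is a finite Gröbner–Shirshov basis for $\mathrm{BC}(X|S)$. Then $$\mathrm{GKdim}(\mathcal B)=\mathrm{Sdeg}\big(\{\mu\mid \mu=[x_1^{n_1}\cdots x_r^{n_r};x_1^{m_1}\cdots x_r^{m_r}]\in\mathrm{Irr}(S)\setminus X,\ n_i,m_j\in\{0,1,N_S+1\},\ i,j\in\{1,\dots,r\}\}\big).$$ In particular, the Gelfand-Kirillov dimension of a finitely generated bicommutative algebra is a nonnegative integer.
   Context: A (nonassociative, not necessarily unital) algebra over a field $k$ is bicommutative if $x(yz)=y(xz)$ and $(xy)z=(xz)y$ hold identically. $\mathrm{BC}(X)$ is the free bicommutative algebra generated by $X$. $\mathbb N$ is the set of nonnegative integers. $[X]$ is the free commutative monoid on $X$, $[X]^+$ the free commutative semigroup ($[X]$ without its unit). Notation: $[a_1,\dots,a_n]_L=(\cdots((a_1a_2)a_3)\cdots a_n)$ and $[a_1,\dots,a_n]_R=(a_1(a_2\cdots(a_{n-1}a_n)\cdots))$, with $[a_1]_L=[a_1]_R=a_1$. For $u=z_1\cdots z_p$, $v=y_1\cdots y_q\in[X]^+$ ($z_i,y_j\in X$, $p,q\ge1$), $[u;v]=[z_1,\dots,z_{p-1},[z_p,y_1,\dots,y_q]_L]_R\in \mathrm{BC}(X)$; this does not depend on the ordering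 of the $z_i$ or of the $y_j$. $\mathrm{NF}(X)=X\cup\{[u;v]\mid u,v\in[X]^+\}$ is a linear basis of $\mathrm{BC}(X)$ with multiplication $(zy)=[z;y]$, $(z[u;v])=[zu;v]$, $([u;v]z)=[u;vz]$, $([u;v][u';v'])=[uu';vv']$ for $z,y\in X$. The length is $\ell(x)=1$ for $x\in X$ and $\ell([u;v])=\ell(u)+\ell(v)$, where $\ell(u)$ is the number of letters of $u$ with repetition. For $\mu,\nu\in\mathrm{NF}(X)$, $\mu\mid\nu$ means: either $\mu=x\in X$ and the letter $x$ occurs in $\nu$, or $\mu=[u;v]$, $\nu=[u';v']$ with $u\mid u'$ and $v\mid v'$ as commutative words. A monomial order on $\mathrm{NF}(X)$ is a well order $<$ such that $\mu<\nu$ implies $(\mu\nu')<(\nu\nu')$ and $(\nu'\mu)<(\nu'\nu)$ for all $\mu,\nu,\nu'\in\mathrm{NF}(X)$. For nonzero $f\in\mathrm{BC}(X)$, $\bar f$ is the largest element of $\mathrm{NF}(X)$ occurring in $f$; $f$ is monic if the coefficient of $\bar f$ is $1$. A set is monic if all its elements are nonzero and monic (the empty set is monic). Normal $S$-polynomials, for a monic set $S$: every $s\in S$ is one; and if $s\in S$ with $\ell(\bar s)\ge2$, then $[z_1,\dots,z_p,[s,y_1,\dots,y_q]_L]_R$ is one for all $p,q\in\mathbb N$, $z_i,y_j\in X$. $\mathrm{Irr}(S)=\mathrm{NF}(X)\setminus\{\bar h\mid h\text{ a normal }S\text{-polynomial}\}$. $\mathrm{Id}(S)$ is the ideal generated by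 $S$. A monic set $S$ is a Gröbner–Shirshov basis for $\mathrm{BC}(X)/\mathrm{Id}(S)$ if every nonzero $f\in \mathrm{Id}(S)$ satisfies $\bar f=\bar h$ for some normal $S$-polynomial $h$. For a finite Gröbner–Shirshov basis $S$: $N_S=1$ if $S=\emptyset$; otherwise $N_S$ is the least positive integer $n$ such that $\bar s\mid[x_1^n\cdots x_r^n;x_1^n\cdots x_r^n]$ for all $s\in S$. Put $\mathrm{Sdeg}(x)=0$ for $x\in X$ and, for $\mu=[x_1^{n_1}\cdots x_r^{n_r};x_1^{m_1}\cdots x_r^{m_r}]$, $\mathrm{Sdeg}(\mu)=\#\{i\mid n_i>N_S\}+\#\{i\mid m_i>N_S\}$. For nonempty $B\subseteq\mathrm{Irr}(S)$, $\mathrm{Sdeg}(B)=\max\{\mathrm{Sdeg}(\mu)\mid\mu\in B\}$; $\mathrm{Sdeg}(\emptyset)=0$. For a bicommutative algebra $\mathcal B$, $\mathrm{GKdim}(\mathcal B)=\sup_V\limsup_{n\to\infty}\log_n\dim(V^{\le n})$, the supremum over finite-dimensional subspaces $V$, where $V^1=V$, $V^n=\sum_{1\le i\le n-1}(V^iV^{n-i})$ for $n\ge2$ (with $(V_1V_2)$ the span of all products $(xy)$, $x\in V_1,y\in V_2$) and $V^{\le n}=V^1+\cdots+V^n$. The Gelfand-Kirillov dimension of the zero algebra is taken to be $0$. *)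

theory Defs
  imports
    "HOL-Algebra.Module"
    "HOL-Algebra.QuotRing"
    "HOL-Algebra.Algebraic_Closure_Type"
    "HOL-Library.Poly_Mapping"
    "HOL-Library.Multiset"
    "HOL-Library.Extended_Real"
    "HOL-Library.Liminf_Limsup"
begin

section \<open>Nonassociative algebras over a field\<close>

text \<open>
  An algebra over the field of type \<open>'k\<close> is a module record over that field, together with
  a bilinear multiplication \<open>\<otimes>\<close>. The record component \<open>one\<close> is never used:
  algebras are neither associative nor unital in general.
\<close>

abbreviation scalars :: "'k::field ring" where
  "scalars \<equiv> ring_of_type_algebra"

locale nonassoc_algebra = module "scalars :: 'k::field ring" A
  for A :: "('k::field, 'a) module" (structure) +
  assumes mult_closed: "\<lbrakk>x \<in> carrier A; y \<in> carrier A\<rbrakk> \<Longrightarrow> x \<otimes> y \<in> carrier A"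
    and mult_add_left: "\<lbrakk>x \<in> carrier A; y \<in> carrier A; z \<in> carrier A\<rbrakk> \<Longrightarrow>
      (x \<oplus> y) \<otimes> z = x \<otimes> z \<oplus> y \<otimes> z"
    and mult_add_right: "\<lbrakk>x \<in> carrier A; y \<in> carrier A; z \<in> carrier A\<rbrakk> \<Longrightarrow>
      x \<otimes> (y \<oplus> z) = x \<otimes> y \<oplus> x \<otimes> z"
    and mult_smult_left: "\<lbrakk>x \<in> carrier A; y \<in> carrier A\<rbrakk> \<Longrightarrow>
      (c \<odot> x) \<otimes> y = c \<odot> (x \<otimes> y)"
    and mult_smult_right: "\<lbrakk>x \<in> carrier A; y \<in> carrier A\<rbrakk> \<Longrightarrow>
      x \<otimes> (c \<odot> y) = c \<odot> (x \<otimes> y)"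

locale bicommutative_algebra = nonassoc_algebra A
  for A :: "('k::field, 'a) module" (structure) +
  assumes left_comm: "\<lbrakk>x \<in> carrier A; y \<in> carrier A; z \<in> carrier A\<rbrakk> \<Longrightarrow>
      x \<otimes> (y \<otimes> z) = y \<otimes> (x \<otimes> z)"
    and right_comm: "\<lbrakk>x \<in> carrier A; y \<in> carrier A; z \<in> carrier A\<rbrakk> \<Longrightarrow>
      (x \<otimes> y) \<otimes> z = (x \<otimes> z) \<otimes> y"

definition alg_hom :: "('k::field, 'a) module \<Rightarrow> ('k, 'b) module \<Rightarrow> ('a \<Rightarrow> 'b) \<Rightarrow> bool" where
  "alg_hom A B \<phi> \<longleftrightarrow> \<phi> \<in> carrier A \<rightarrow> carrier B \<and>
     (\<forall>x\<in>carrier A. \<forall>y\<in>carrier A. \<phi> (x \<oplus>\<^bsub>A\<^esub> y) = \<phi> x \<oplus>\<^bsub>B\<^esub> \<phi> y) \<and>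
     (\<forall>c. \<forall>x\<in>carrier A. \<phi> (c \<odot>\<^bsub>A\<^esub> x) = c \<odot>\<^bsub>B\<^esub> \<phi> x) \<and>
     (\<forall>x\<in>carrier A. \<forall>y\<in>carrier A. \<phi> (x \<otimes>\<^bsub>A\<^esub> y) = \<phi> x \<otimes>\<^bsub>B\<^esub> \<phi> y)"

definition alg_ideal :: "('k::field, 'a) module \<Rightarrow> 'a set \<Rightarrow> bool" where
  "alg_ideal A I \<longleftrightarrow> submodule I scalars A \<and>
     (\<forall>a\<in>I. \<forall>x\<in>carrier A. x \<otimes>\<^bsub>A\<^esub> a \<in> I \<and> a \<otimes>\<^bsub>A\<^esub> x \<in> I)"

definition gen_ideal :: "('k::field, 'a) module \<Rightarrow> 'a set \<Rightarrow> 'a set" where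
  "gen_ideal A S = \<Inter>{I. alg_ideal A I \<and> S \<subseteq> I}"

text \<open>The algebra of cosets; the library's factor ring does not carry a scalar multiplication.\<close>

definition quot_alg :: "('k::field, 'a) module \<Rightarrow> 'a set \<Rightarrow> ('k, 'a set) module" where
  "quot_alg A I = ring.extend (A Quot I) (module.fields (\<lambda>c C. \<Union>a\<in>C. I +>\<^bsub>A\<^esub> (c \<odot>\<^bsub>A\<^esub> a)))"

definition finitely_generated_alg :: "('k::field, 'a) module \<Rightarrow> bool" where
  "finitely_generated_alg A \<longleftrightarrow> (\<exists>G. finite G \<and> G \<subseteq> carrier A \<and>
     \<Inter>{W. submodule W scalars A \<and> (\<forall>x\<in>W. \<forall>y\<in>W. x \<otimes>\<^bsub>A\<^esub> y \<in> W) \<and> G \<subseteq> W} = carrier A)"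


section \<open>Dimension and Gelfand-Kirillov dimension\<close>

definition lin_span :: "('k::field, 'a) module \<Rightarrow> 'a set \<Rightarrow> 'a set" where
  "lin_span A G = \<Inter>{W. submodule W scalars A \<and> G \<subseteq> W}"

definition lin_basis :: "('k::field, 'a) module \<Rightarrow> 'a set \<Rightarrow> 'a set \<Rightarrow> bool" where
  "lin_basis A B W \<longleftrightarrow> B \<subseteq> carrier A \<and> (\<forall>b\<in>B. b \<notin> lin_span A (B - {b})) \<and> lin_span A B = W"

definition fin_dim_subspace :: "('k::field, 'a) module \<Rightarrow> 'a set \<Rightarrow> bool" where
  "fin_dim_subspace A W \<longleftrightarrow> submodule W scalars A \<and> (\<exists>B. finite B \<and> lin_basis A B W)"

definition lin_dim :: "('k::field, 'a) module \<Rightarrow> 'a set \<Rightarrow> nat" where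
  "lin_dim A W = card (SOME B. lin_basis A B W)"

definition prod_space :: "('k::field, 'a) module \<Rightarrow> 'a set \<Rightarrow> 'a set \<Rightarrow> 'a set" where
  "prod_space A V W = lin_span A {x \<otimes>\<^bsub>A\<^esub> y | x y. x \<in> V \<and> y \<in> W}"

text \<open>
  \<open>pow_space A V n\<close> is $V^n$. A sum of subspaces is the span of their union. The
  value at \<open>0\<close> is a dummy.
\<close>

function pow_space :: "('k::field, 'a) module \<Rightarrow> 'a set \<Rightarrow> nat \<Rightarrow> 'a set" where
  "pow_space A V n =
     (if n = 0 then {\<zero>\<^bsub>A\<^esub>} else if n = 1 then V
      else lin_span A (\<Union>i\<in>{1..n - 1}. prod_space A (pow_space A V i) (pow_space A V (n - i))))"
  by pat_completeness auto
termination
  by (relation "Wellfounded.measure (\<lambda>(A, V, n). n)") auto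

declare pow_space.simps [simp del]

definition pow_space_upto :: "('k::field, 'a) module \<Rightarrow> 'a set \<Rightarrow> nat \<Rightarrow> 'a set" where
  "pow_space_upto A V n = lin_span A (\<Union>i\<in>{1..n}. pow_space A V i)"

text \<open>
  Since \<open>ln 0 = 0\<close> in HOL, the subspace \<open>V = {\<zero>}\<close> contributes \<open>0\<close> instead of
  \<open>-\<infinity>\<close>. In a nonzero algebra this does not affect the supremum, because every nonzero
  \<open>V\<close> contributes a nonnegative value.
\<close>

definition GKdim :: "('k::field, 'a) module \<Rightarrow> ereal" where
  "GKdim A = (if carrier A = {\<zero>\<^bsub>A\<^esub>} then 0
     else SUP V\<in>{V. fin_dim_subspace A V}.
       limsup (\<lambda>n. ereal (log (real n) (real (lin_dim A (pow_space_upto A V n))))))"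


section \<open>Normal forms and the free bicommutative algebra\<close>

text \<open>
  \<open>Gen x\<close> stands for the generator \<open>x\<close> and \<open>Mon u v\<close> for $[u;v]$; words in the free
  commutative monoid are multisets.
\<close>

datatype 'x nf = Gen 'x | Mon "'x multiset" "'x multiset"

definition NF :: "'x set \<Rightarrow> 'x nf set" where
  "NF Xs = Gen ` Xs \<union>
     {Mon u v | u v. u \<noteq> {#} \<and> v \<noteq> {#} \<and> set_mset u \<subseteq> Xs \<and> set_mset v \<subseteq> Xs}"

fun nf_mult :: "'x nf \<Rightarrow> 'x nf \<Rightarrow> 'x nf" where
  "nf_mult (Gen z) (Gen y) = Mon {#z#} {#y#}"
| "nf_mult (Gen z) (Mon u v) = Mon (add_mset z u) v"
| "nf_mult (Mon u v) (Gen z) = Mon u (add_mset z v)"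
| "nf_mult (Mon u v) (Mon u' v') = Mon (u + u') (v + v')"

fun nf_length :: "'x nf \<Rightarrow> nat" where
  "nf_length (Gen x) = 1"
| "nf_length (Mon u v) = size u + size v"

fun nf_dvd :: "'x nf \<Rightarrow> 'x nf \<Rightarrow> bool" where
  "nf_dvd (Gen x) (Gen y) \<longleftrightarrow> x = y"
| "nf_dvd (Gen x) (Mon u v) \<longleftrightarrow> x \<in># u \<or> x \<in># v"
| "nf_dvd (Mon u v) (Gen y) \<longleftrightarrow> False"
| "nf_dvd (Mon u v) (Mon u' v') \<longleftrightarrow> u \<subseteq># u' \<and> v \<subseteq># v'"

definition bc_mult :: "('x nf \<Rightarrow>\<^sub>0 'k::field) \<Rightarrow> ('x nf \<Rightarrow>\<^sub>0 'k) \<Rightarrow> ('x nf \<Rightarrow>\<^sub>0 'k)" where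
  "bc_mult f g = (\<Sum>\<mu>\<in>Poly_Mapping.keys f. \<Sum>\<nu>\<in>Poly_Mapping.keys g.
     Poly_Mapping.single (nf_mult \<mu> \<nu>) (Poly_Mapping.lookup f \<mu> * Poly_Mapping.lookup g \<nu>))"

text \<open>
  The free bicommutative algebra on \<open>Xs\<close>, given by its linear basis of normal forms and the
  multiplication table on it. Freeness is proved below in \<open>BC_bicommutative\<close>,
  \<open>BC_universal\<close> and \<open>BC_hom_unique\<close>, and \<open>bracket_eq\<close> identifies the basis
  element \<open>Mon u v\<close> with the iterated product that defines $[u;v]$.
\<close>

definition BC :: "'x set \<Rightarrow> ('k::field, 'x nf \<Rightarrow>\<^sub>0 'k) module" where
  "BC Xs = \<lparr>carrier = {f. Poly_Mapping.keys f \<subseteq> NF Xs}, monoid.mult = bc_mult, one = undefined,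
     ring.zero = 0, add = (+), module.smult = (\<lambda>c. Poly_Mapping.map ((*) c))\<rparr>"

definition gen :: "'x \<Rightarrow> ('x nf \<Rightarrow>\<^sub>0 'k::field)" where
  "gen x = Poly_Mapping.single (Gen x) 1"

text \<open>
  \<open>left_normed A a [y\<^sub>1, \<dots>, y\<^sub>q]\<close> is $[a, y_1, \dots, y_q]_L$ and
  \<open>right_normed A [z\<^sub>1, \<dots>, z\<^sub>p] a\<close> is $[z_1, \dots, z_p, a]_R$.
\<close>

definition left_normed :: "('k::field, 'a) module \<Rightarrow> 'a \<Rightarrow> 'a list \<Rightarrow> 'a" where
  "left_normed A a ys = foldl (monoid.mult A) a ys"

definition right_normed :: "('k::field, 'a) module \<Rightarrow> 'a list \<Rightarrow> 'a \<Rightarrow> 'a" where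
  "right_normed A zs a = foldr (monoid.mult A) zs a"


section \<open>Monomial orders and Groebner-Shirshov bases\<close>

text \<open>
  \<open>R\<close> is the reflexive order on \<open>NF Xs\<close>; the strict order is \<open>R - Id\<close>.
\<close>

definition monomial_order :: "'x set \<Rightarrow> 'x nf rel \<Rightarrow> bool" where
  "monomial_order Xs R \<longleftrightarrow> well_order_on (NF Xs) R \<and>
     (\<forall>\<mu>\<in>NF Xs. \<forall>\<nu>\<in>NF Xs. \<forall>\<nu>'\<in>NF Xs. (\<mu>, \<nu>) \<in> R - Id \<longrightarrow>
        (nf_mult \<mu> \<nu>', nf_mult \<nu> \<nu>') \<in> R - Id \<and> (nf_mult \<nu>' \<mu>, nf_mult \<nu>' \<nu>) \<in> R - Id)"

text \<open>Only meaningful for nonzero \<open>f\<close>.\<close>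

definition lead :: "'x nf rel \<Rightarrow> ('x nf \<Rightarrow>\<^sub>0 'k::field) \<Rightarrow> 'x nf" where
  "lead R f = (THE \<mu>. \<mu> \<in> Poly_Mapping.keys f \<and> (\<forall>\<nu>\<in>Poly_Mapping.keys f. (\<nu>, \<mu>) \<in> R))"

definition monic_set :: "'x nf rel \<Rightarrow> ('x nf \<Rightarrow>\<^sub>0 'k::field) set \<Rightarrow> bool" where
  "monic_set R S \<longleftrightarrow> (\<forall>s\<in>S. s \<noteq> 0 \<and> Poly_Mapping.lookup s (lead R s) = 1)"

definition normal_S_polys ::
  "'x set \<Rightarrow> 'x nf rel \<Rightarrow> ('x nf \<Rightarrow>\<^sub>0 'k::field) set \<Rightarrow> ('x nf \<Rightarrow>\<^sub>0 'k) set" where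
  "normal_S_polys Xs R S = S \<union>
     {right_normed (BC Xs) (map gen zs) (left_normed (BC Xs) s (map gen ys)) | s zs ys.
        s \<in> S \<and> nf_length (lead R s) \<ge> 2 \<and> set zs \<subseteq> Xs \<and> set ys \<subseteq> Xs}"

definition Irr :: "'x set \<Rightarrow> 'x nf rel \<Rightarrow> ('x nf \<Rightarrow>\<^sub>0 'k::field) set \<Rightarrow> 'x nf set" where
  "Irr Xs R S = NF Xs - lead R ` normal_S_polys Xs R S"

definition GS_basis :: "'x set \<Rightarrow> 'x nf rel \<Rightarrow> ('x nf \<Rightarrow>\<^sub>0 'k::field) set \<Rightarrow> bool" where
  "GS_basis Xs R S \<longleftrightarrow> S \<subseteq> carrier (BC Xs) \<and> monic_set R S \<and>
     (\<forall>f\<in>gen_ideal (BC Xs) S. f \<noteq> 0 \<longrightarrow> (\<exists>h\<in>normal_S_polys Xs R S. lead R f = lead R h))"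

text \<open>For finite \<open>Xs\<close>, the multiset \<open>repeat_mset n (mset_set Xs)\<close> is $x_1^n \cdots x_r^n$.\<close>

definition N_of :: "'x set \<Rightarrow> 'x nf rel \<Rightarrow> ('x nf \<Rightarrow>\<^sub>0 'k::field) set \<Rightarrow> nat" where
  "N_of Xs R S = (if S = {} then 1
     else LEAST n. n > 0 \<and> (\<forall>s\<in>S. nf_dvd (lead R s)
       (Mon (repeat_mset n (mset_set Xs)) (repeat_mset n (mset_set Xs)))))"

fun Sdeg_mon :: "'x set \<Rightarrow> nat \<Rightarrow> 'x nf \<Rightarrow> nat" where
  "Sdeg_mon Xs N (Gen x) = 0"
| "Sdeg_mon Xs N (Mon u v) = card {x\<in>Xs. count u x > N} + card {x\<in>Xs. count v x > N}"

definition Sdeg :: "'x set \<Rightarrow> 'x nf rel \<Rightarrow> ('x nf \<Rightarrow>\<^sub>0 'k::field) set \<Rightarrow> 'x nf set \<Rightarrow> nat" where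
  "Sdeg Xs R S B = (if B = {} then 0 else Max (Sdeg_mon Xs (N_of Xs R S) ` B))"


section \<open>Freeness of the algebra on normal forms\<close>

lemma scalars_simps [simp]:
  "carrier scalars = UNIV" "x \<otimes>\<^bsub>scalars\<^esub> y = x * y" "\<one>\<^bsub>scalars\<^esub> = 1"
  "\<zero>\<^bsub>scalars\<^esub> = 0" "x \<oplus>\<^bsub>scalars\<^esub> y = x + y"
  by (simp_all add: ring_of_type_algebra_def)

lemma BC_simps [simp]:
  "carrier (BC Xs) = {f. Poly_Mapping.keys f \<subseteq> NF Xs}" "x \<otimes>\<^bsub>BC Xs\<^esub> y = bc_mult x y"
  "\<zero>\<^bsub>BC Xs\<^esub> = 0" "x \<oplus>\<^bsub>BC Xs\<^esub> y = x + y"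
  "c \<odot>\<^bsub>BC Xs\<^esub> x = Poly_Mapping.map ((*) c) x"
  by (simp_all add: BC_def)

lemma lookup_scale [simp]:
  "Poly_Mapping.lookup (Poly_Mapping.map ((*) (c::'k::field)) f) \<mu> = c * Poly_Mapping.lookup f \<mu>"
  by (simp add: Poly_Mapping.map.rep_eq when_def)

lemma keys_scale: "Poly_Mapping.keys (Poly_Mapping.map ((*) (c::'k::field)) f) \<subseteq> Poly_Mapping.keys f"
  by (auto simp: in_keys_iff)

lemma bc_mult_superset:
  assumes "finite F" "Poly_Mapping.keys f \<subseteq> F" "finite G" "Poly_Mapping.keys g \<subseteq> G"
  shows "bc_mult f g = (\<Sum>\<mu>\<in>F. \<Sum>\<nu>\<in>G.
     Poly_Mapping.single (nf_mult \<mu> \<nu>) (Poly_Mapping.lookup f \<mu> * Poly_Mapping.lookup g \<nu>))"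
proof -
  have "bc_mult f g = (\<Sum>\<mu>\<in>Poly_Mapping.keys f. \<Sum>\<nu>\<in>G.
     Poly_Mapping.single (nf_mult \<mu> \<nu>) (Poly_Mapping.lookup f \<mu> * Poly_Mapping.lookup g \<nu>))"
    unfolding bc_mult_def
    by (intro sum.cong refl sum.mono_neutral_left) (use assms in \<open>auto simp: in_keys_iff\<close>)
  also have "\<dots> = (\<Sum>\<mu>\<in>F. \<Sum>\<nu>\<in>G.
     Poly_Mapping.single (nf_mult \<mu> \<nu>) (Poly_Mapping.lookup f \<mu> * Poly_Mapping.lookup g \<nu>))"
    by (intro sum.mono_neutral_left) (use assms in \<open>auto simp: in_keys_iff\<close>)
  finally show ?thesis .
qed

lemma bc_mult_add_left: "bc_mult (f + g) h = bc_mult f h + bc_mult g h"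
proof -
  let ?F = "Poly_Mapping.keys f \<union> Poly_Mapping.keys g" and ?H = "Poly_Mapping.keys h"
  have k: "Poly_Mapping.keys (f + g) \<subseteq> ?F" by (rule Poly_Mapping.keys_add)
  show ?thesis
    by (subst (1 2 3) bc_mult_superset[of ?F _ ?H])
       (use k in \<open>auto simp: lookup_add distrib_right single_add sum.distrib\<close>)
qed

lemma bc_mult_add_right: "bc_mult h (f + g) = bc_mult h f + bc_mult h g"
proof -
  let ?F = "Poly_Mapping.keys f \<union> Poly_Mapping.keys g" and ?H = "Poly_Mapping.keys h"
  have k: "Poly_Mapping.keys (f + g) \<subseteq> ?F" by (rule Poly_Mapping.keys_add)
  show ?thesis
    by (subst (1 2 3) bc_mult_superset[of ?H _ ?F])
       (use k in \<open>auto simp: lookup_add distrib_left single_add sum.distrib\<close>)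
qed

lemma map_scale_add:
  "Poly_Mapping.map ((*) (c::'k::field)) (f + g) = Poly_Mapping.map ((*) c) f + Poly_Mapping.map ((*) c) g"
  by (rule poly_mapping_eqI) (simp add: lookup_add distrib_left)

lemma map_scale_sum:
  "Poly_Mapping.map ((*) (c::'k::field)) (\<Sum>i\<in>I. f i) = (\<Sum>i\<in>I. Poly_Mapping.map ((*) c) (f i))"
  by (rule poly_mapping_eqI) (simp add: lookup_sum sum_distrib_left)

lemma map_scale_single:
  "Poly_Mapping.map ((*) (c::'k::field)) (Poly_Mapping.single \<mu> a) = Poly_Mapping.single \<mu> (c * a)"
  by (rule poly_mapping_eqI) (simp add: lookup_single when_def)

lemma bc_mult_scale_left: "bc_mult (Poly_Mapping.map ((*) c) f) g = Poly_Mapping.map ((*) c) (bc_mult f g)"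
  by (subst (1 2) bc_mult_superset[of "Poly_Mapping.keys f" _ "Poly_Mapping.keys g"])
     (simp_all add: keys_scale map_scale_sum map_scale_single mult_ac)

lemma bc_mult_scale_right: "bc_mult f (Poly_Mapping.map ((*) c) g) = Poly_Mapping.map ((*) c) (bc_mult f g)"
  by (subst (1 2) bc_mult_superset[of "Poly_Mapping.keys f" _ "Poly_Mapping.keys g"])
     (simp_all add: keys_scale map_scale_sum map_scale_single mult_ac)

lemma bc_mult_zero [simp]: "bc_mult 0 g = 0" "bc_mult g 0 = 0"
  by (simp_all add: bc_mult_def)

lemma bc_mult_single [simp]:
  "bc_mult (Poly_Mapping.single \<mu> a) (Poly_Mapping.single \<nu> b) =
     Poly_Mapping.single (nf_mult \<mu> \<nu>) (a * b)"
  by (subst bc_mult_superset[of "{\<mu>}" _ "{\<nu>}"]) (auto simp: lookup_single)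

lemma bc_mult_sum_left: "bc_mult (\<Sum>i\<in>I. f i) g = (\<Sum>i\<in>I. bc_mult (f i) g)"
  by (induction I rule: infinite_finite_induct) (simp_all add: bc_mult_add_left)

lemma bc_mult_sum_right: "bc_mult g (\<Sum>i\<in>I. f i) = (\<Sum>i\<in>I. bc_mult g (f i))"
  by (induction I rule: infinite_finite_induct) (simp_all add: bc_mult_add_right)

lemma pm_decomp: "f = (\<Sum>\<mu>\<in>Poly_Mapping.keys f. Poly_Mapping.single \<mu> (Poly_Mapping.lookup f \<mu>))"
proof (rule poly_mapping_eqI)
  fix k
  show "Poly_Mapping.lookup f k = Poly_Mapping.lookup
          (\<Sum>\<mu>\<in>Poly_Mapping.keys f. Poly_Mapping.single \<mu> (Poly_Mapping.lookup f \<mu>)) k"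
    by (auto simp: lookup_sum lookup_single when_def in_keys_iff)
qed

lemma nf_left_comm: "nf_mult \<mu> (nf_mult \<nu> \<xi>) = nf_mult \<nu> (nf_mult \<mu> \<xi>)"
  by (cases \<mu>; cases \<nu>; cases \<xi>) (simp_all add: add_ac add_mset_commute)

lemma nf_right_comm: "nf_mult (nf_mult \<mu> \<nu>) \<xi> = nf_mult (nf_mult \<mu> \<xi>) \<nu>"
  by (cases \<mu>; cases \<nu>; cases \<xi>) (simp_all add: add_ac add_mset_commute)

lemma bc_left_comm: "bc_mult f (bc_mult g h) = bc_mult g (bc_mult f h)"
proof -
  let ?d = "\<lambda>f. \<Sum>\<mu>\<in>Poly_Mapping.keys f. Poly_Mapping.single \<mu> (Poly_Mapping.lookup f \<mu>)"
  have "bc_mult (?d f) (bc_mult (?d g) (?d h)) = bc_mult (?d g) (bc_mult (?d f) (?d h))"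
    unfolding bc_mult_sum_left bc_mult_sum_right bc_mult_single
    by (subst sum.swap) (simp add: nf_left_comm mult_ac)
  then show ?thesis by (simp flip: pm_decomp)
qed

lemma bc_right_comm: "bc_mult (bc_mult f g) h = bc_mult (bc_mult f h) g"
proof -
  let ?d = "\<lambda>f. \<Sum>\<mu>\<in>Poly_Mapping.keys f. Poly_Mapping.single \<mu> (Poly_Mapping.lookup f \<mu>)"
  have "bc_mult (bc_mult (?d f) (?d g)) (?d h) = bc_mult (bc_mult (?d f) (?d h)) (?d g)"
    unfolding bc_mult_sum_left bc_mult_sum_right bc_mult_single
    by (subst sum.swap) (simp add: nf_right_comm mult_ac)
  then show ?thesis by (simp flip: pm_decomp)
qed

lemma nf_mult_NF: "\<mu> \<in> NF Xs \<Longrightarrow> \<nu> \<in> NF Xs \<Longrightarrow> nf_mult \<mu> \<nu> \<in> NF Xs"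
  by (cases \<mu>; cases \<nu>) (auto simp: NF_def)

lemma keys_bc_mult:
  assumes "Poly_Mapping.keys f \<subseteq> NF Xs" "Poly_Mapping.keys g \<subseteq> NF Xs"
  shows "Poly_Mapping.keys (bc_mult f g) \<subseteq> NF Xs"
proof
  fix k assume "k \<in> Poly_Mapping.keys (bc_mult f g)"
  then have "(\<Sum>\<mu>\<in>Poly_Mapping.keys f. \<Sum>\<nu>\<in>Poly_Mapping.keys g. Poly_Mapping.lookup
     (Poly_Mapping.single (nf_mult \<mu> \<nu>) (Poly_Mapping.lookup f \<mu> * Poly_Mapping.lookup g \<nu>)) k) \<noteq> 0"
    by (simp add: bc_mult_def in_keys_iff lookup_sum)
  then obtain \<mu> where m: "\<mu> \<in> Poly_Mapping.keys f" "(\<Sum>\<nu>\<in>Poly_Mapping.keys g. Poly_Mapping.lookup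
     (Poly_Mapping.single (nf_mult \<mu> \<nu>) (Poly_Mapping.lookup f \<mu> * Poly_Mapping.lookup g \<nu>)) k) \<noteq> 0"
    by (rule sum.not_neutral_contains_not_neutral)
  from m(2) obtain \<nu> where "\<nu> \<in> Poly_Mapping.keys g" "Poly_Mapping.lookup
     (Poly_Mapping.single (nf_mult \<mu> \<nu>) (Poly_Mapping.lookup f \<mu> * Poly_Mapping.lookup g \<nu>)) k \<noteq> 0"
    by (rule sum.not_neutral_contains_not_neutral)
  then have "k = nf_mult \<mu> \<nu>" "\<nu> \<in> NF Xs" "\<mu> \<in> NF Xs"
    using m(1) assms by (auto simp: lookup_single when_def split: if_splits)
  then show "k \<in> NF Xs" by (simp add: nf_mult_NF)
qed

lemma scalars_cring: "cring (scalars :: 'k::field ring)"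
  by (rule cring_from_type_algebra)

theorem BC_bicommutative: "bicommutative_algebra (BC Xs :: ('k::field, 'x nf \<Rightarrow>\<^sub>0 'k) module)"
proof -
  have ab: "abelian_group (BC Xs :: ('k, 'x nf \<Rightarrow>\<^sub>0 'k) module)"
  proof (rule abelian_groupI, goal_cases)
    case 1 then show ?case using keys_add by fastforce
  next
    case (6 x)
    then show ?case by (intro bexI[of _ "- x"]) (auto simp: in_keys_iff)
  qed (auto simp: add_ac)
  have m: "module (scalars :: 'k ring) (BC Xs :: ('k, 'x nf \<Rightarrow>\<^sub>0 'k) module)"
    by (rule moduleI[OF scalars_cring ab])
       (use keys_scale in \<open>fastforce simp: lookup_add distrib_left distrib_right mult_ac intro!: poly_mapping_eqI\<close>)+
  show ?thesis
    by (intro bicommutative_algebra.intro nonassoc_algebra.intro m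
          nonassoc_algebra_axioms.intro bicommutative_algebra_axioms.intro)
       (auto simp: bc_mult_add_left bc_mult_add_right bc_mult_scale_left bc_mult_scale_right
          bc_left_comm intro: bc_right_comm dest: keys_bc_mult)
qed

context bicommutative_algebra
begin

lemma LR_comm:
  assumes "a \<in> carrier A" "b \<in> carrier A" "c \<in> carrier A" "d \<in> carrier A"
  shows "a \<otimes> ((b \<otimes> c) \<otimes> d) = (a \<otimes> (b \<otimes> c)) \<otimes> d"
proof -
  have "a \<otimes> ((b \<otimes> c) \<otimes> d) = (b \<otimes> c) \<otimes> (a \<otimes> d)" 
    using assms mult_closed left_comm by metis
  also have "\<dots> = (b \<otimes> (a \<otimes> d)) \<otimes> c" using assms mult_closed right_comm by metis
  also have "\<dots> = (a \<otimes> (b \<otimes> d)) \<otimes> c" using assms mult_closed left_comm by metis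
  also have "\<dots> = (a \<otimes> c) \<otimes> (b \<otimes> d)" using assms mult_closed right_comm by metis
  also have "\<dots> = b \<otimes> ((a \<otimes> c) \<otimes> d)" using assms mult_closed left_comm by metis
  also have "\<dots> = b \<otimes> ((a \<otimes> d) \<otimes> c)" using assms mult_closed right_comm by metis
  finally have 1: "a \<otimes> ((b \<otimes> c) \<otimes> d) = b \<otimes> ((a \<otimes> d) \<otimes> c)" .
  have "(a \<otimes> (b \<otimes> c)) \<otimes> d = (a \<otimes> d) \<otimes> (b \<otimes> c)" using assms mult_closed right_comm by metis
  also have "\<dots> = b \<otimes> ((a \<otimes> d) \<otimes> c)" using assms mult_closed left_comm by metis
  finally show ?thesis using 1 by simp
qed

definition sq :: "'a set" where "sq = {b \<otimes> c | b c. b \<in> carrier A \<and> c \<in> carrier A}"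

lemma sq_carrier: "p \<in> sq \<Longrightarrow> p \<in> carrier A"
  by (auto simp: sq_def mult_closed)

lemma sq_I: "b \<in> carrier A \<Longrightarrow> c \<in> carrier A \<Longrightarrow> b \<otimes> c \<in> sq"
  by (auto simp: sq_def)

lemma sq_LR: "a \<in> carrier A \<Longrightarrow> p \<in> sq \<Longrightarrow> d \<in> carrier A \<Longrightarrow> a \<otimes> (p \<otimes> d) = (a \<otimes> p) \<otimes> d"
  by (auto simp: sq_def LR_comm)

lemma sq_L_left:
  assumes "a \<in> carrier A" "p \<in> sq" "q \<in> sq"
  shows "(a \<otimes> p) \<otimes> q = a \<otimes> (p \<otimes> q)"
  using sq_LR[OF assms(1,2) sq_carrier[OF assms(3)]] by simp

lemma sq_R_right:
  assumes "d \<in> carrier A" "p \<in> sq" "q \<in> sq"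
  shows "p \<otimes> (q \<otimes> d) = (p \<otimes> q) \<otimes> d"
  using sq_LR[OF sq_carrier[OF assms(2)] assms(3,1)] by simp

abbreviation Ls :: "'a list \<Rightarrow> 'a \<Rightarrow> 'a" where "Ls zs \<equiv> fold (\<otimes>) zs"
abbreviation Rs :: "'a list \<Rightarrow> 'a \<Rightarrow> 'a" where "Rs ys \<equiv> fold (\<lambda>y a. a \<otimes> y) ys"

lemma Ls_closed: "set zs \<subseteq> carrier A \<Longrightarrow> a \<in> carrier A \<Longrightarrow> Ls zs a \<in> carrier A"
  by (induction zs arbitrary: a) (auto simp: mult_closed)

lemma Rs_closed: "set zs \<subseteq> carrier A \<Longrightarrow> a \<in> carrier A \<Longrightarrow> Rs zs a \<in> carrier A"
  by (induction zs arbitrary: a) (auto simp: mult_closed)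

lemma Ls_sq: "set zs \<subseteq> carrier A \<Longrightarrow> a \<in> sq \<Longrightarrow> Ls zs a \<in> sq"
  by (induction zs arbitrary: a) (auto simp: sq_I sq_carrier)

lemma Rs_sq: "set zs \<subseteq> carrier A \<Longrightarrow> a \<in> sq \<Longrightarrow> Rs zs a \<in> sq"
  by (induction zs arbitrary: a) (auto simp: sq_I sq_carrier)

lemma L_Rs: "set ys \<subseteq> carrier A \<Longrightarrow> p \<in> sq \<Longrightarrow> z \<in> carrier A \<Longrightarrow> Rs ys (z \<otimes> p) = z \<otimes> Rs ys p"
proof (induction ys arbitrary: p)
  case (Cons y ys)
  then have "Rs ys ((z \<otimes> p) \<otimes> y) = Rs ys (z \<otimes> (p \<otimes> y))" by (simp add: sq_LR)
  also have "\<dots> = z \<otimes> Rs ys (p \<otimes> y)" using Cons by (simp add: sq_I sq_carrier)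
  finally show ?case by simp
qed simp

lemma Ls_Rs: "set ys \<subseteq> carrier A \<Longrightarrow> set zs \<subseteq> carrier A \<Longrightarrow> p \<in> sq \<Longrightarrow> Ls zs (Rs ys p) = Rs ys (Ls zs p)"
proof (induction zs arbitrary: p)
  case (Cons z zs)
  then have "Ls zs (z \<otimes> Rs ys p) = Ls zs (Rs ys (z \<otimes> p))" by (simp add: L_Rs)
  also have "\<dots> = Rs ys (Ls zs (z \<otimes> p))" using Cons by (simp add: sq_I sq_carrier)
  finally show ?case by simp
qed simp

lemma Ls_perm:
  assumes "mset zs = mset zs'" "set zs \<subseteq> carrier A" "a \<in> carrier A"
  shows "Ls zs a = Ls zs' a"
  by (rule fold_permuted_eq[where P = "\<lambda>a. a \<in> carrier A"])
     (use assms in \<open>auto simp: mult_closed intro: left_comm\<close>)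

lemma Rs_perm:
  assumes "mset zs = mset zs'" "set zs \<subseteq> carrier A" "a \<in> carrier A"
  shows "Rs zs a = Rs zs' a"
  by (rule fold_permuted_eq[where P = "\<lambda>a. a \<in> carrier A"])
     (use assms in \<open>auto simp: mult_closed intro: right_comm\<close>)

definition br :: "'a list \<Rightarrow> 'a list \<Rightarrow> 'a" where
  "br zs ys = Ls (tl zs) (Rs ys (hd zs))"

lemma br_alt:
  assumes "set zs \<subseteq> carrier A" "set ys \<subseteq> carrier A" "zs \<noteq> []" "ys \<noteq> []"
  shows "br zs ys = Rs (tl ys) (Ls zs (hd ys))"
  using assms by (cases zs; cases ys) (simp_all add: br_def Ls_Rs sq_I)

lemma br_Cons: "br (z # zs) (y # ys) = Ls zs (Rs ys (z \<otimes> y))"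
  by (simp add: br_def)

lemma br_perm:
  assumes "mset zs = mset zs'" "mset ys = mset ys'"
    "set zs \<subseteq> carrier A" "set ys \<subseteq> carrier A" "zs \<noteq> []" "ys \<noteq> []"
  shows "br zs ys = br zs' ys'"
proof -
  have s: "set zs' = set zs" "set ys' = set ys" using assms(1,2) by (metis mset_eq_setD)+
  have n: "zs' \<noteq> []" using assms(1,5) by auto
  have "br zs ys = br zs' ys"
    using assms s n by (simp add: br_alt Ls_perm[OF assms(1)] subset_iff)
  also have "\<dots> = br zs' ys'"
    unfolding br_def using assms s n by (subst Rs_perm[OF assms(2)]) (auto simp: subset_iff)
  finally show ?thesis .
qed

lemma br_sq:
  assumes "set zs \<subseteq> carrier A" "set ys \<subseteq> carrier A" "zs \<noteq> []" "ys \<noteq> []"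
  shows "br zs ys \<in> sq"
  using assms by (cases zs; cases ys) (simp_all add: br_Cons Ls_sq Rs_sq sq_I)

lemma L_br:
  assumes "set zs \<subseteq> carrier A" "set ys \<subseteq> carrier A" "zs \<noteq> []" "ys \<noteq> []" "z \<in> carrier A"
  shows "z \<otimes> br zs ys = br (zs @ [z]) ys"
  using assms by (cases zs; cases ys) (simp_all add: br_Cons)

lemma R_br:
  assumes "set zs \<subseteq> carrier A" "set ys \<subseteq> carrier A" "zs \<noteq> []" "ys \<noteq> []" "z \<in> carrier A"
  shows "br zs ys \<otimes> z = br zs (ys @ [z])"
  using assms by (simp add: br_alt)

lemma Ls_mult:
  "set zs \<subseteq> carrier A \<Longrightarrow> p \<in> sq \<Longrightarrow> q \<in> sq \<Longrightarrow> Ls zs p \<otimes> q = Ls zs (p \<otimes> q)"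
  by (induction zs arbitrary: p) (auto simp: sq_L_left sq_I sq_carrier)

lemma Rs_mult:
  "set zs \<subseteq> carrier A \<Longrightarrow> p \<in> sq \<Longrightarrow> q \<in> sq \<Longrightarrow> Rs zs p \<otimes> q = Rs zs (p \<otimes> q)"
proof (induction zs arbitrary: p)
  case (Cons y ys)
  then have "(p \<otimes> y) \<otimes> q = (p \<otimes> q) \<otimes> y"
    by (intro right_comm) (auto simp: sq_carrier)
  with Cons show ?case by (simp add: sq_I sq_carrier)
qed simp

lemma mult_Ls:
  "set zs \<subseteq> carrier A \<Longrightarrow> p \<in> sq \<Longrightarrow> q \<in> sq \<Longrightarrow> p \<otimes> Ls zs q = Ls zs (p \<otimes> q)"
proof (induction zs arbitrary: q)
  case (Cons y ys)
  then have "p \<otimes> (y \<otimes> q) = y \<otimes> (p \<otimes> q)"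
    by (intro left_comm) (auto simp: sq_carrier)
  with Cons show ?case by (simp add: sq_I sq_carrier)
qed simp

lemma mult_Rs:
  "set zs \<subseteq> carrier A \<Longrightarrow> p \<in> sq \<Longrightarrow> q \<in> sq \<Longrightarrow> p \<otimes> Rs zs q = Rs zs (p \<otimes> q)"
  by (induction zs arbitrary: q) (auto simp: sq_R_right sq_I sq_carrier)

lemma br_br:
  assumes "set zs \<subseteq> carrier A" "set ys \<subseteq> carrier A" "zs \<noteq> []" "ys \<noteq> []"
    "set zs' \<subseteq> carrier A" "set ys' \<subseteq> carrier A" "zs' \<noteq> []" "ys' \<noteq> []"
  shows "br zs ys \<otimes> br zs' ys' = br (zs @ zs') (ys @ ys')"
proof -
  obtain z zt y yt where 1: "zs = z # zt" "ys = y # yt"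
    using assms by (metis list.exhaust)
  obtain z' zt' y' yt' where 2: "zs' = z' # zt'" "ys' = y' # yt'"
    using assms by (metis list.exhaust)
  note c = assms[unfolded 1 2, simplified]
  have sq: "z \<otimes> y \<in> sq" "z' \<otimes> y' \<in> sq" using c by (auto intro: sq_I)
  have *: "(z \<otimes> y) \<otimes> (z' \<otimes> y') = z' \<otimes> ((z \<otimes> y) \<otimes> y')"
    using c by (intro left_comm) (auto simp: mult_closed)
  have sq2: "(z \<otimes> y) \<otimes> (z' \<otimes> y') \<in> sq" using sq sq_carrier sq_I by blast
  have sq3: "(z \<otimes> y) \<otimes> y' \<in> sq" using c sq sq_carrier sq_I by blast
  have "br zs ys \<otimes> br zs' ys' = Ls zt (Rs yt ((z \<otimes> y) \<otimes> Ls zt' (Rs yt' (z' \<otimes> y'))))"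
    using c sq by (simp add: 1 2 br_Cons Ls_mult Rs_mult Ls_sq Rs_sq)
  also have "\<dots> = Ls zt (Rs yt (Ls zt' (Rs yt' ((z \<otimes> y) \<otimes> (z' \<otimes> y')))))"
    using c sq by (simp add: mult_Ls mult_Rs Ls_sq Rs_sq)
  also have "\<dots> = Ls zt (Ls zt' (Rs yt (Rs yt' ((z \<otimes> y) \<otimes> (z' \<otimes> y')))))"
    using c sq2 by (subst Ls_Rs) (auto simp: Rs_sq)
  also have "(z \<otimes> y) \<otimes> (z' \<otimes> y') = z' \<otimes> ((z \<otimes> y) \<otimes> y')" by (rule *)
  also have "Rs yt (Rs yt' (z' \<otimes> ((z \<otimes> y) \<otimes> y'))) = z' \<otimes> Rs yt (Rs yt' ((z \<otimes> y) \<otimes> y'))"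
    using c sq3 by (simp add: L_Rs Rs_sq)
  also have "Ls zt (Ls zt' (z' \<otimes> Rs yt (Rs yt' ((z \<otimes> y) \<otimes> y')))) =
     Ls (z' # zt' @ zt) (Rs (y' # yt' @ yt) (z \<otimes> y))" by simp
  also have "\<dots> = br (z # z' # zt' @ zt) (y # y' # yt' @ yt)" by (simp add: br_Cons)
  also have "\<dots> = br (zs @ zs') (ys @ ys')"
    using c by (intro br_perm) (auto simp: 1 2)
  finally show ?thesis .
qed

definition lst :: "'x multiset \<Rightarrow> 'x list" where "lst u = (SOME xs. mset xs = u)"

lemma mset_lst [simp]: "mset (lst u) = u"
  unfolding lst_def by (rule someI_ex) (rule ex_mset)

lemma set_lst [simp]: "set (lst u) = set_mset u"
  by (metis mset_lst set_mset_mset)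

fun ev :: "('x \<Rightarrow> 'a) \<Rightarrow> 'x nf \<Rightarrow> 'a" where
  "ev h (Gen x) = h x"
| "ev h (Mon u v) = br (map h (lst u)) (map h (lst v))"

lemma ev_Mon:
  assumes "h \<in> Xs \<rightarrow> carrier A" "set zs \<subseteq> Xs" "set ys \<subseteq> Xs" "zs \<noteq> []" "ys \<noteq> []"
  shows "ev h (Mon (mset zs) (mset ys)) = br (map h zs) (map h ys)"
proof -
  have "lst (mset zs) \<noteq> []" "lst (mset ys) \<noteq> []" using assms(4,5) by (metis mset_lst mset_zero_iff)+
  then show ?thesis unfolding ev.simps
    by (intro br_perm) (use assms in \<open>auto simp: Pi_iff subset_iff\<close>)
qed

lemma NF_E:
  assumes "\<mu> \<in> NF Xs"
  obtains (Gen) x where "\<mu> = Gen x" "x \<in> Xs"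
  | (Mon) zs ys where "\<mu> = Mon (mset zs) (mset ys)" "zs \<noteq> []" "ys \<noteq> []" "set zs \<subseteq> Xs" "set ys \<subseteq> Xs"
  using assms unfolding NF_def
  by (auto) (metis ex_mset mset_zero_iff set_mset_mset)

lemma ev_closed:
  assumes "h \<in> Xs \<rightarrow> carrier A" "\<mu> \<in> NF Xs"
  shows "ev h \<mu> \<in> carrier A"
  using assms(2)
proof (cases rule: NF_E)
  case Gen then show ?thesis using assms(1) by (auto simp: Pi_iff)
next
  case (Mon zs ys)
  then show ?thesis unfolding Mon(1) ev_Mon[OF assms(1) Mon(4,5,2,3)] using assms(1)
    by (intro sq_carrier br_sq) (auto simp: Pi_iff subset_iff)
qed

lemma ev_mult:
  assumes h: "h \<in> Xs \<rightarrow> carrier A" and m: "\<mu> \<in> NF Xs" and n: "\<nu> \<in> NF Xs"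
  shows "ev h (nf_mult \<mu> \<nu>) = ev h \<mu> \<otimes> ev h \<nu>"
  using m
proof (cases rule: NF_E)
  case (Gen x) note 1 = this
  from n show ?thesis
  proof (cases rule: NF_E)
    case (Gen y)
    then show ?thesis using ev_Mon[OF h, of "[x]" "[y]"] 1 by (simp del: ev.simps(2) add: br_def)
  next
    case (Mon zs ys)
    then show ?thesis using ev_Mon[OF h, of "zs @ [x]" ys] ev_Mon[OF h, of zs ys] h 1
      by (simp del: ev.simps(2), subst L_br) (auto simp: Pi_iff subset_iff)
  qed
next
  case (Mon zs ys) note 1 = this
  from n show ?thesis
  proof (cases rule: NF_E)
    case (Gen y)
    then show ?thesis using ev_Mon[OF h, of zs "ys @ [y]"] ev_Mon[OF h, of zs ys] h 1
      by (simp del: ev.simps(2), subst R_br) (auto simp: Pi_iff subset_iff)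
  next
    case (Mon zs' ys')
    then show ?thesis using ev_Mon[OF h, of "zs @ zs'" "ys @ ys'"] ev_Mon[OF h, of zs ys]
        ev_Mon[OF h, of zs' ys'] h 1
      by (simp del: ev.simps(2), subst br_br) (auto simp: Pi_iff subset_iff)
  qed
qed

definition lin_ext :: "('x \<Rightarrow> 'a) \<Rightarrow> ('x nf \<Rightarrow>\<^sub>0 'k) \<Rightarrow> 'a" where
  "lin_ext h f = (\<Oplus>\<mu>\<in>Poly_Mapping.keys f. Poly_Mapping.lookup f \<mu> \<odot> ev h \<mu>)"

lemma lin_ext_superset:
  assumes "h \<in> Xs \<rightarrow> carrier A" "finite F" "Poly_Mapping.keys f \<subseteq> F" "F \<subseteq> NF Xs"
  shows "lin_ext h f = (\<Oplus>\<mu>\<in>F. Poly_Mapping.lookup f \<mu> \<odot> ev h \<mu>)"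
  unfolding lin_ext_def
proof (rule M.add.finprod_mono_neutral_cong_left)
  have e: "\<mu> \<in> F \<Longrightarrow> ev h \<mu> \<in> carrier A" for \<mu> using assms ev_closed by blast
  show "(\<lambda>\<mu>. Poly_Mapping.lookup f \<mu> \<odot> ev h \<mu>) \<in> F \<rightarrow> carrier A"
    using e by (auto intro!: smult_closed)
  show "Poly_Mapping.lookup f \<mu> \<odot> ev h \<mu> = \<zero>" if "\<mu> \<in> F - Poly_Mapping.keys f" for \<mu>
    using that e smult_l_null[of "ev h \<mu>"] by (simp add: in_keys_iff)
qed (use assms in auto)

lemma lin_ext_closed:
  assumes "h \<in> Xs \<rightarrow> carrier A" "Poly_Mapping.keys f \<subseteq> NF Xs"
  shows "lin_ext h f \<in> carrier A"
  unfolding lin_ext_def using assms ev_closed[OF assms(1)]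
  by (intro M.finsum_closed) (auto intro!: smult_closed)

lemma lin_ext_add:
  assumes "h \<in> Xs \<rightarrow> carrier A" "Poly_Mapping.keys f \<subseteq> NF Xs" "Poly_Mapping.keys g \<subseteq> NF Xs"
  shows "lin_ext h (f + g) = lin_ext h f \<oplus> lin_ext h g"
proof -
  let ?F = "Poly_Mapping.keys f \<union> Poly_Mapping.keys g"
  have k: "Poly_Mapping.keys (f + g) \<subseteq> ?F" by (rule Poly_Mapping.keys_add)
  have fin: "finite ?F" and sub: "?F \<subseteq> NF Xs" using assms by auto
  have e: "\<mu> \<in> ?F \<Longrightarrow> ev h \<mu> \<in> carrier A" for \<mu> using assms ev_closed by blast
  have "lin_ext h (f + g) =
      (\<Oplus>\<mu>\<in>?F. Poly_Mapping.lookup f \<mu> \<odot> ev h \<mu> \<oplus> Poly_Mapping.lookup g \<mu> \<odot> ev h \<mu>)"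
    unfolding lin_ext_superset[OF assms(1) fin k sub]
    using e smult_l_distr by (intro M.finsum_cong') (auto simp: lookup_add intro!: smult_closed M.a_closed)
  also have "\<dots> = lin_ext h f \<oplus> lin_ext h g"
    using assms e
    by (subst (1 2) lin_ext_superset[OF assms(1), of ?F])
       (auto intro!: M.finsum_addf smult_closed)
  finally show ?thesis .
qed

lemma lin_ext_smult:
  assumes "h \<in> Xs \<rightarrow> carrier A" "Poly_Mapping.keys f \<subseteq> NF Xs"
  shows "lin_ext h (Poly_Mapping.map ((*) c) f) = c \<odot> lin_ext h f"
proof -
  have e: "\<mu> \<in> Poly_Mapping.keys f \<Longrightarrow> ev h \<mu> \<in> carrier A" for \<mu> using assms ev_closed by blast
  have "lin_ext h (Poly_Mapping.map ((*) c) f) =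
      (\<Oplus>\<mu>\<in>Poly_Mapping.keys f. c \<odot> (Poly_Mapping.lookup f \<mu> \<odot> ev h \<mu>))"
    unfolding lin_ext_superset[OF assms(1) finite_keys keys_scale assms(2)]
    using e smult_assoc1 by (intro M.finsum_cong') (auto intro!: smult_closed)
  also have "\<dots> = c \<odot> lin_ext h f"
    unfolding lin_ext_def using e by (subst finsum_smult_ldistr) (auto intro!: smult_closed)
  finally show ?thesis .
qed

lemma lin_ext_single:
  assumes "h \<in> Xs \<rightarrow> carrier A" "\<mu> \<in> NF Xs"
  shows "lin_ext h (Poly_Mapping.single \<mu> c) = c \<odot> ev h \<mu>"
  using assms ev_closed[OF assms]
  by (subst lin_ext_superset[of _ Xs "{\<mu>}"]) (auto intro!: smult_closed)

lemma lin_ext_zero: "lin_ext h 0 = \<zero>"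
  by (simp add: lin_ext_def)

lemma mult_zero_left: "x \<in> carrier A \<Longrightarrow> \<zero> \<otimes> x = \<zero>"
  using mult_smult_left[of "\<zero>" x 0] smult_l_null[of "\<zero>"] smult_l_null[of "\<zero> \<otimes> x"]
  by (simp add: mult_closed)

lemma mult_zero_right: "x \<in> carrier A \<Longrightarrow> x \<otimes> \<zero> = \<zero>"
  using mult_smult_right[of x "\<zero>" 0] smult_l_null[of "\<zero>"] smult_l_null[of "x \<otimes> \<zero>"]
  by (simp add: mult_closed)

lemma pm_induct_NF [consumes 1, case_names zero add]:
  fixes f :: "'x nf \<Rightarrow>\<^sub>0 'k"
  assumes "Poly_Mapping.keys f \<subseteq> NF Xs" and "P 0"
    and "\<And>f \<mu> c. Poly_Mapping.keys f \<subseteq> NF Xs \<Longrightarrow> \<mu> \<in> NF Xs \<Longrightarrow> P f \<Longrightarrow> P (Poly_Mapping.single \<mu> c + f)"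
  shows "P f"
proof -
  have "Poly_Mapping.keys (\<Sum>\<mu>\<in>F. Poly_Mapping.single \<mu> (Poly_Mapping.lookup f \<mu>)) \<subseteq> NF Xs \<and>
      P (\<Sum>\<mu>\<in>F. Poly_Mapping.single \<mu> (Poly_Mapping.lookup f \<mu>))"
    if "finite F" "F \<subseteq> NF Xs" for F
    using that
  proof (induction F)
    case empty then show ?case using assms(2) by simp
  next
    case (insert x F)
    have "Poly_Mapping.keys (Poly_Mapping.single x (Poly_Mapping.lookup f x) +
        (\<Sum>\<mu>\<in>F. Poly_Mapping.single \<mu> (Poly_Mapping.lookup f \<mu>))) \<subseteq> NF Xs"
      using insert by (intro order.trans[OF Poly_Mapping.keys_add]) auto
    then show ?case using insert assms(3) by auto
  qed
  from this[of "Poly_Mapping.keys f"] assms(1) show ?thesis by (simp flip: pm_decomp)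
qed

lemma lin_ext_mult:
  assumes h: "h \<in> Xs \<rightarrow> carrier A"
    and f: "Poly_Mapping.keys f \<subseteq> NF Xs" and g: "Poly_Mapping.keys g \<subseteq> NF Xs"
  shows "lin_ext h (bc_mult f g) = lin_ext h f \<otimes> lin_ext h g"
  using f
proof (induction f rule: pm_induct_NF)
  case zero then show ?case by (simp add: lin_ext_zero lin_ext_closed[OF h g] mult_zero_left)
next
  case (add f \<mu> c)
  have s: "Poly_Mapping.keys (Poly_Mapping.single \<mu> c) \<subseteq> NF Xs" using add(2) by simp
  have "lin_ext h (bc_mult (Poly_Mapping.single \<mu> c) g) = lin_ext h (Poly_Mapping.single \<mu> c) \<otimes> lin_ext h g"
    using g
  proof (induction g rule: pm_induct_NF)
    case zero then show ?case by (simp add: lin_ext_zero lin_ext_closed[OF h s] mult_zero_right)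
  next
    case (add g \<nu> d)
    have t: "Poly_Mapping.keys (Poly_Mapping.single \<nu> d) \<subseteq> NF Xs" using add(2) by simp
    have m: "nf_mult \<mu> \<nu> \<in> NF Xs" using \<open>\<mu> \<in> NF Xs\<close> add(2) by (rule nf_mult_NF)
    have e: "ev h \<mu> \<in> carrier A" "ev h \<nu> \<in> carrier A" using ev_closed[OF h] add(2) \<open>\<mu> \<in> NF Xs\<close> by auto
    have "lin_ext h (bc_mult (Poly_Mapping.single \<mu> c) (Poly_Mapping.single \<nu> d)) =
       lin_ext h (Poly_Mapping.single \<mu> c) \<otimes> lin_ext h (Poly_Mapping.single \<nu> d)"
      using e m add(2) \<open>\<mu> \<in> NF Xs\<close> smult_assoc1[of c d "ev h \<mu> \<otimes> ev h \<nu>"] smult_assoc1[of d c "ev h \<mu> \<otimes> ev h \<nu>"]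
      by (simp add: lin_ext_single[OF h] ev_mult[OF h] mult_smult_left mult_smult_right
            smult_closed mult_closed mult.commute)
    then show ?case
      using add t s by (simp add: bc_mult_add_right lin_ext_add[OF h] keys_bc_mult lin_ext_closed[OF h]
          mult_add_right del: bc_mult_single)
  qed
  then show ?case
    using add s g by (simp add: bc_mult_add_left lin_ext_add[OF h] keys_bc_mult lin_ext_closed[OF h]
        mult_add_left)
qed

end

theorem BC_universal:
  fixes A :: "('k::field, 'a) module"
  assumes "bicommutative_algebra A" and h: "h \<in> Xs \<rightarrow> carrier A"
  shows "\<exists>\<phi>. alg_hom (BC Xs) A \<phi> \<and> (\<forall>x\<in>Xs. \<phi> (gen x) = h x)"
proof -
  interpret bicommutative_algebra A by fact
  have "alg_hom (BC Xs) A (lin_ext h)"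
    unfolding alg_hom_def
    by (auto simp: lin_ext_add[OF h] lin_ext_smult[OF h] lin_ext_mult[OF h] lin_ext_closed[OF h])
  moreover have "lin_ext h (gen x) = h x" if "x \<in> Xs" for x
    using that h by (auto simp: gen_def lin_ext_single[OF h] NF_def Pi_iff smult_one[simplified])
  ultimately show ?thesis by blast
qed

theorem BC_hom_unique:
  fixes A :: "('k::field, 'a) module"
  assumes A: "bicommutative_algebra A"
    and hom: "alg_hom (BC Xs) A \<phi>" "alg_hom (BC Xs) A \<psi>"
    and eq: "\<forall>x\<in>Xs. \<phi> (gen x) = \<psi> (gen x)"
    and f: "f \<in> carrier (BC Xs)"
  shows "\<phi> f = \<psi> f"
proof -
  interpret bicommutative_algebra A by fact
  have s: "\<phi> (Poly_Mapping.single \<mu> 1) = \<psi> (Poly_Mapping.single \<mu> 1)" if "\<mu> \<in> NF Xs" for \<mu>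
    using that
  proof (induction "nf_length \<mu>" arbitrary: \<mu> rule: less_induct)
    case less
    have *: ?case if "\<mu> = nf_mult \<nu> \<xi>" "\<nu> \<in> NF Xs" "\<xi> \<in> NF Xs"
        "nf_length \<nu> < nf_length \<mu>" "nf_length \<xi> < nf_length \<mu>" for \<nu> \<xi>
    proof -
      have "Poly_Mapping.single \<mu> 1 =
          bc_mult (Poly_Mapping.single \<nu> 1) (Poly_Mapping.single \<xi> (1::'k))"
        using that(1) by simp
      then show ?thesis
        using hom that(2,3) less(1)[OF that(4,2)] less(1)[OF that(5,3)]
        unfolding alg_hom_def by (simp del: bc_mult_single)
    qed
    show ?case
    proof (cases \<mu>)
      case (Gen x)
      then show ?thesis using eq less.prems by (auto simp: gen_def NF_def)
    next
      case (Mon u v)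
      with less.prems obtain z u' y v' where uv: "u = add_mset z u'" "v = add_mset y v'"
        by (auto simp: NF_def) (metis multiset_cases)
      show ?thesis
      proof (cases "u' = {#}")
        case False
        then show ?thesis using Mon less.prems uv
          by (intro *[of "Gen z" "Mon u' v"]) (auto simp: NF_def nonempty_has_size)
      next
        case u: True
        show ?thesis
        proof (cases "v' = {#}")
          case False
          then show ?thesis using Mon less.prems uv
            by (intro *[of "Mon u v'" "Gen y"]) (auto simp: NF_def nonempty_has_size)
        next
          case True
          then show ?thesis using Mon less.prems uv u
            by (intro *[of "Gen z" "Gen y"]) (auto simp: NF_def)
        qed
      qed
    qed
  qed
  have sc: "\<phi> (Poly_Mapping.single \<mu> c) = \<psi> (Poly_Mapping.single \<mu> c)" if "\<mu> \<in> NF Xs" for \<mu> c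
  proof -
    have "Poly_Mapping.single \<mu> c = Poly_Mapping.map ((*) c) (Poly_Mapping.single \<mu> 1)"
      by (simp add: map_scale_single)
    moreover have "Poly_Mapping.keys (Poly_Mapping.single \<mu> (1::'k)) \<subseteq> NF Xs" using that by simp
    ultimately show ?thesis using hom s[OF that] unfolding alg_hom_def BC_simps by (metis mem_Collect_eq)
  qed
  have "Poly_Mapping.keys f \<subseteq> NF Xs" using f by simp
  then show ?thesis
  proof (induction f rule: pm_induct_NF)
    case zero
    have "\<phi> (Poly_Mapping.map ((*) 0) 0) = \<psi> (Poly_Mapping.map ((*) 0) 0)"
      using hom smult_l_null[simplified] unfolding alg_hom_def by (simp add: Pi_iff)
    moreover have "Poly_Mapping.map ((*) (0::'k)) 0 = (0 :: 'b nf \<Rightarrow>\<^sub>0 'k)"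
      by (rule poly_mapping_eqI) simp
    ultimately show ?case by metis
  next
    case (add f \<mu> c)
    then show ?case using hom sc unfolding alg_hom_def by simp
  qed
qed

theorem bracket_eq:
  assumes "ys \<noteq> []"
  shows "right_normed (BC Xs) (map gen zs) (left_normed (BC Xs) (gen z) (map gen ys)) =
     (Poly_Mapping.single (Mon (mset (zs @ [z])) (mset ys)) 1 :: 'x nf \<Rightarrow>\<^sub>0 'k::field)"
proof -
  have m: "monoid.mult (BC Xs :: ('k, 'x nf \<Rightarrow>\<^sub>0 'k) module) = bc_mult" by (simp add: BC_def)
  have l: "foldl bc_mult (Poly_Mapping.single (Mon u v) 1) (map gen ys) =
      (Poly_Mapping.single (Mon u (v + mset ys)) 1 :: 'x nf \<Rightarrow>\<^sub>0 'k)" for u v ys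
    by (induction ys arbitrary: v) (simp_all add: gen_def)
  have r: "foldr bc_mult (map gen zs) (Poly_Mapping.single (Mon u v) 1) =
      (Poly_Mapping.single (Mon (u + mset zs) v) 1 :: 'x nf \<Rightarrow>\<^sub>0 'k)" for u v
    by (induction zs) (simp_all add: gen_def)
  obtain y yt where "ys = y # yt" using assms by (cases ys) auto
  then show ?thesis
    using l[of "{#z#}" "{#y#}" yt] by (simp add: right_normed_def left_normed_def m r gen_def)
qed


section \<open>The quotient construction\<close>

lemma quot_alg_simps:
  "carrier (quot_alg A I) = a_rcosets\<^bsub>A\<^esub> I" "C \<otimes>\<^bsub>quot_alg A I\<^esub> D = [mod I:] C \<Otimes>\<^bsub>A\<^esub> D"
  "\<zero>\<^bsub>quot_alg A I\<^esub> = I" "C \<oplus>\<^bsub>quot_alg A I\<^esub> D = C <+>\<^bsub>A\<^esub> D"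
  "c \<odot>\<^bsub>quot_alg A I\<^esub> C = (\<Union>a\<in>C. I +>\<^bsub>A\<^esub> (c \<odot>\<^bsub>A\<^esub> a))"
  by (simp_all add: quot_alg_def FactRing_def ring.defs module.defs)

theorem quot_alg_proj:
  fixes A :: "('k::field, 'a) module" (structure)
  assumes A: "nonassoc_algebra A" and I: "alg_ideal A I"
  shows "alg_hom A (quot_alg A I) (\<lambda>a. I +> a)"
    and "(\<lambda>a. I +> a) ` carrier A = carrier (quot_alg A I)"
    and "\<forall>a\<in>carrier A. I +> a = \<zero>\<^bsub>quot_alg A I\<^esub> \<longleftrightarrow> a \<in> I"
proof -
  interpret nonassoc_algebra A by fact
  have sm: "submodule I scalars A" using I by (simp add: alg_ideal_def)
  interpret S: abelian_subgroup I A
    by (rule abelian_subgroupI3) (use sm M.abelian_group_axioms in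
      \<open>auto simp: submodule_def additive_subgroup_def\<close>)
  have el: "\<exists>i\<in>I. x = i \<oplus> a" if "x \<in> I +> a" for x a
    using that by (auto simp: a_r_coset_def')
  have eq: "I +> x = I +> y" if "x \<in> carrier A" "y \<in> carrier A" "i \<in> I" "x = i \<oplus> y" for x y i
    using that by (intro S.a_repr_independence'[symmetric]) (auto simp: a_r_coset_def')
  have self: "a \<in> I +> a" if "a \<in> carrier A" for a using that by (rule S.a_rcos_self)
  have rc: "x \<in> carrier A" if "x \<in> I +> a" "a \<in> carrier A" for x a
    using that el S.a_subset by blast
  have mul: "I +> (x \<otimes> y) = I +> (a \<otimes> b)"
    if "x \<in> I +> a" "y \<in> I +> b" "a \<in> carrier A" "b \<in> carrier A" for x y a b
  proof -
    from that el obtain i j where ij: "i \<in> I" "x = i \<oplus> a" "j \<in> I" "y = j \<oplus> b" by blast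
    have c: "i \<in> carrier A" "j \<in> carrier A" using ij S.a_subset by auto
    have "x \<otimes> y = ((i \<otimes> y) \<oplus> (a \<otimes> j)) \<oplus> (a \<otimes> b)"
    proof -
      have y: "y \<in> carrier A" using c that by (simp add: ij)
      have "x \<otimes> y = i \<otimes> y \<oplus> a \<otimes> y" using c that y by (simp add: ij(2) mult_add_left)
      also have "a \<otimes> y = a \<otimes> j \<oplus> a \<otimes> b" using c that by (simp add: ij(4) mult_add_right)
      also have "i \<otimes> y \<oplus> (a \<otimes> j \<oplus> a \<otimes> b) = (i \<otimes> y \<oplus> a \<otimes> j) \<oplus> a \<otimes> b"
        using c that y by (intro M.a_assoc[symmetric] mult_closed) auto
      finally show ?thesis .
    qed
    moreover have "(i \<otimes> y) \<oplus> (a \<otimes> j) \<in> I"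
      using I ij that rc[OF that(2,4)] by (auto simp: alg_ideal_def intro!: S.a_closed)
    ultimately show ?thesis using that rc by (intro eq) (auto intro: mult_closed)
  qed
  have scl: "I +> (c \<odot> x) = I +> (c \<odot> a)" if "x \<in> I +> a" "a \<in> carrier A" for x a c
  proof -
    from that el obtain i where i: "i \<in> I" "x = i \<oplus> a" by blast
    have c: "i \<in> carrier A" using i S.a_subset by auto
    have "c \<odot> x = c \<odot> i \<oplus> c \<odot> a" using c that by (simp add: i smult_r_distr)
    moreover have "c \<odot> i \<in> I" using sm i by (auto simp: submodule_def submodule_axioms_def)
    ultimately show ?thesis using that rc by (intro eq) auto
  qed
  show "alg_hom A (quot_alg A I) (\<lambda>a. I +> a)"
    unfolding alg_hom_def quot_alg_simps
  proof (intro conjI ballI allI)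
    show "(+>) I \<in> carrier A \<rightarrow> a_rcosets I" using S.a_subset by (auto simp: A_RCOSETS_def')
    show "I +> (x \<oplus> y) = (I +> x) <+> (I +> y)" if "x \<in> carrier A" "y \<in> carrier A" for x y
      using that by (simp add: S.a_rcos_sum)
    show "I +> (c \<odot> x) = (\<Union>a\<in>I +> x. I +> (c \<odot> a))" if "x \<in> carrier A" for c x
      using that scl self by blast
    show "I +> (x \<otimes> y) = [mod I:] (I +> x) \<Otimes> (I +> y)" if "x \<in> carrier A" "y \<in> carrier A" for x y
    proof -
      have "[mod I:] (I +> x) \<Otimes> (I +> y) = (\<Union>a\<in>I +> x. \<Union>b\<in>I +> y. I +> (x \<otimes> y))"
        unfolding rcoset_mult_def by (intro SUP_cong refl mul that)
      also have "\<dots> = I +> (x \<otimes> y)" using self[OF that(1)] self[OF that(2)] by (simp add: UN_constant) auto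
      finally show ?thesis by simp
    qed
  qed
  show "(\<lambda>a. I +> a) ` carrier A = carrier (quot_alg A I)"
    by (auto simp: quot_alg_simps A_RCOSETS_def')
  show "\<forall>a\<in>carrier A. I +> a = \<zero>\<^bsub>quot_alg A I\<^esub> \<longleftrightarrow> a \<in> I"
    unfolding quot_alg_simps
  proof (intro ballI iffI)
    show "a \<in> I" if "a \<in> carrier A" "I +> a = I" for a using self[OF that(1)] that(2) by simp
    show "I +> a = I" if "a \<in> carrier A" "a \<in> I" for a
    proof -
      have "I +> a = I +> \<zero>" using that by (intro eq[of a \<zero> a]) auto
      also have "\<dots> = I" using S.a_subset by (simp add: M.a_coset_add_zero)
      finally show ?thesis .
    qed
  qed
qed

lemma gen_ideal_ideal:
  fixes A :: "('k::field, 'a) module"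
  assumes A: "nonassoc_algebra A" and S: "S \<subseteq> carrier A"
  shows "alg_ideal A (gen_ideal A S)" "S \<subseteq> gen_ideal A S"
proof -
  interpret nonassoc_algebra A by fact
  have c: "alg_ideal A (carrier A)"
    using carrier_is_submodule by (auto simp: alg_ideal_def mult_closed)
  have sub: "gen_ideal A S \<subseteq> carrier A" using c S by (auto simp: gen_ideal_def)
  have J: "J \<subseteq> carrier A" "\<zero>\<^bsub>A\<^esub> \<in> J" "\<And>a. a \<in> J \<Longrightarrow> \<ominus>\<^bsub>A\<^esub> a \<in> J"
      "\<And>a b. a \<in> J \<Longrightarrow> b \<in> J \<Longrightarrow> a \<oplus>\<^bsub>A\<^esub> b \<in> J" "\<And>c a. a \<in> J \<Longrightarrow> c \<odot>\<^bsub>A\<^esub> a \<in> J"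
    if "alg_ideal A J" for J
  proof -
    have s: "submodule J scalars A" using that by (simp add: alg_ideal_def)
    show "J \<subseteq> carrier A" "\<And>a. a \<in> J \<Longrightarrow> \<ominus>\<^bsub>A\<^esub> a \<in> J"
      "\<And>a b. a \<in> J \<Longrightarrow> b \<in> J \<Longrightarrow> a \<oplus>\<^bsub>A\<^esub> b \<in> J" "\<And>c a. a \<in> J \<Longrightarrow> c \<odot>\<^bsub>A\<^esub> a \<in> J"
      using submoduleE[OF s] by auto
    show "\<zero>\<^bsub>A\<^esub> \<in> J"
      using subgroup.one_closed[of J "add_monoid A"] s by (simp add: submodule_def)
  qed
  have "submodule (gen_ideal A S) scalars A"
  proof (rule submoduleI[OF sub])
    show "\<zero>\<^bsub>A\<^esub> \<in> gen_ideal A S" using J(2) by (simp add: gen_ideal_def)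
  qed (simp_all add: gen_ideal_def J(3-5))
  then show "alg_ideal A (gen_ideal A S)"
    by (auto simp: alg_ideal_def) (auto simp: gen_ideal_def alg_ideal_def)
  show "S \<subseteq> gen_ideal A S" by (auto simp: gen_ideal_def)
qed

end

(*
Pushing Irr(S) forward gives a linear basis of the quotient, so GKdim counts irreducible normal forms.
For the lower bound, the irreducible normal forms of length at most n are independent and lie in V^{<=n}
when V is spanned by the generators. The monomial order need not respect the length, so for the upper
bound one needs that reduction increases the length at most linearly: the differences q - p of exponent
vectors with [p] < [q] form an additively closed set without 0, hence (Gordan's alternative) some
positive weight makes the leading monomial of each of the finitely many s at least as heavy as its tail.
Finally, exponents above N_S are indistinguishable to the leading monomials, so the number of
irreducible normal forms of length at most n has order of growth n^d, where d is the largest number of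
exponents exceeding N_S; truncating exponents to {0, 1, N_S + 1} shows d = Sdeg.
For a finitely generated algebra, Dickson's lemma supplies a finite basis of the ideal of relations.
*)
theory Submission
  imports Defs "HOL-Library.Multiset_Order" "HOL-Real_Asymp.Real_Asymp"
begin

section \<open>Linear algebra in coordinates\<close>

text \<open>Letters are the obstacle to the weight argument. Multiplying brackets adds exponent
  vectors, but a letter enters the left or the right word depending on its side of the product, so
  it has no exponent vector of its own. It is given weight 0, and tails are compared with leading
  monomials only after a factor has turned both into brackets. An element of \<open>S\<close> led by
  a letter is never multiplied in a normal S-polynomial; its tail, which the weight does not
  control, enters as an additive constant \<open>T0\<close>. Unit vectors join the finite set of
  differences so that all weights are positive; weight and length of a bracket then bound each other
  up to constant factors, which is the origin of the linear factor \<open>C\<close>.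

  The growth is computed for any algebra that receives a surjection from \<open>BC Xs\<close> with
  kernel \<open>Id(S)\<close>, and both statements of the theorem are instances of this one
  computation. Dimensions are read off in the space of finitely supported functions on irreducible
  normal forms.\<close>

abbreviation pm_scale :: "'k::field \<Rightarrow> ('b \<Rightarrow>\<^sub>0 'k) \<Rightarrow> ('b \<Rightarrow>\<^sub>0 'k)" where
  "pm_scale c \<equiv> Poly_Mapping.map ((*) c)"

interpretation pm: vector_space "pm_scale :: 'k::field \<Rightarrow> ('b \<Rightarrow>\<^sub>0 'k) \<Rightarrow> _"
  by unfold_locales (rule poly_mapping_eqI, simp add: lookup_add algebra_simps)+

lemma keys_subspace: "pm.subspace {f :: 'b \<Rightarrow>\<^sub>0 'k::field. Poly_Mapping.keys f \<subseteq> M}"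
  unfolding pm.subspace_def
proof safe
  fix f g :: "'b \<Rightarrow>\<^sub>0 'k" and c \<mu>
  show "\<mu> \<in> M" if "Poly_Mapping.keys f \<subseteq> M" "Poly_Mapping.keys g \<subseteq> M" "\<mu> \<in> Poly_Mapping.keys (f + g)"
    using that Poly_Mapping.keys_add[of f g] by blast
  show "\<mu> \<in> M" if "Poly_Mapping.keys f \<subseteq> M" "\<mu> \<in> Poly_Mapping.keys (pm_scale c f)"
    using that keys_scale[of c f] by blast
qed simp

lemma in_span_singles:
  fixes f :: "'b \<Rightarrow>\<^sub>0 'k::field"
  assumes "Poly_Mapping.keys f \<subseteq> M"
  shows "f \<in> pm.span ((\<lambda>\<mu>. Poly_Mapping.single \<mu> 1) ` M)"
proof -
  have "(\<Sum>\<mu>\<in>Poly_Mapping.keys f. pm_scale (Poly_Mapping.lookup f \<mu>) (Poly_Mapping.single \<mu> 1))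
      \<in> pm.span ((\<lambda>\<mu>. Poly_Mapping.single \<mu> 1) ` M)"
    using assms by (intro pm.span_sum pm.span_scale pm.span_base) auto
  then show ?thesis by (simp add: map_scale_single flip: pm_decomp)
qed

text \<open>Without \<open>\<mu>\<close>, the remaining basis vectors only span functions whose
  support avoids \<open>\<mu>\<close>.\<close>

lemma independent_singles:
  "pm.independent ((\<lambda>\<mu>. Poly_Mapping.single \<mu> (1::'k::field)) ` M)"
proof
  assume "pm.dependent ((\<lambda>\<mu>. Poly_Mapping.single \<mu> (1::'k)) ` M)"
  then obtain \<mu> where m: "\<mu> \<in> M" "Poly_Mapping.single \<mu> (1::'k) \<in> pm.span
      ((\<lambda>\<mu>. Poly_Mapping.single \<mu> (1::'k)) ` M - {Poly_Mapping.single \<mu> 1})"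
    unfolding pm.dependent_def by auto
  have "pm.span ((\<lambda>\<mu>. Poly_Mapping.single \<mu> (1::'k)) ` M - {Poly_Mapping.single \<mu> 1}) \<subseteq>
      {f. Poly_Mapping.keys f \<subseteq> M - {\<mu>}}"
    by (rule pm.span_minimal[OF _ keys_subspace]) auto
  with m have "Poly_Mapping.single \<mu> (1::'k) \<in> {f. Poly_Mapping.keys f \<subseteq> M - {\<mu>}}" by blast
  then show False by simp
qed

lemma inj_on_singles: "inj_on (\<lambda>\<mu>. Poly_Mapping.single \<mu> (1::'k::field)) M"
  by (rule inj_onI) (metis keys_single one_neq_zero singleton_inject)

section \<open>Spans, products and powers of subspaces\<close>

lemma submodule_lin_span:
  assumes "nonassoc_algebra A" "G \<subseteq> carrier A"
  shows "submodule (lin_span A G) scalars A" "G \<subseteq> lin_span A G"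
proof -
  interpret nonassoc_algebra A by fact
  have J: "J \<subseteq> carrier A" "\<zero>\<^bsub>A\<^esub> \<in> J" "\<And>a. a \<in> J \<Longrightarrow> \<ominus>\<^bsub>A\<^esub> a \<in> J"
      "\<And>a b. a \<in> J \<Longrightarrow> b \<in> J \<Longrightarrow> a \<oplus>\<^bsub>A\<^esub> b \<in> J" "\<And>c a. a \<in> J \<Longrightarrow> c \<odot>\<^bsub>A\<^esub> a \<in> J"
    if "submodule J scalars A" for J
  proof -
    show "J \<subseteq> carrier A" "\<And>a. a \<in> J \<Longrightarrow> \<ominus>\<^bsub>A\<^esub> a \<in> J"
      "\<And>a b. a \<in> J \<Longrightarrow> b \<in> J \<Longrightarrow> a \<oplus>\<^bsub>A\<^esub> b \<in> J" "\<And>c a. a \<in> J \<Longrightarrow> c \<odot>\<^bsub>A\<^esub> a \<in> J"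
      using submoduleE[OF that] by auto
    show "\<zero>\<^bsub>A\<^esub> \<in> J"
      using subgroup.one_closed[of J "add_monoid A"] that by (simp add: submodule_def)
  qed
  show "submodule (lin_span A G) scalars A"
  proof (rule submoduleI)
    show "lin_span A G \<subseteq> carrier A"
      using carrier_is_submodule assms(2) by (auto simp: lin_span_def)
    show "\<zero>\<^bsub>A\<^esub> \<in> lin_span A G" using J(2) by (simp add: lin_span_def)
  qed (simp_all add: lin_span_def J(3-5))
  show "G \<subseteq> lin_span A G" by (auto simp: lin_span_def)
qed

lemma lin_span_minimal: "submodule W scalars A \<Longrightarrow> G \<subseteq> W \<Longrightarrow> lin_span A G \<subseteq> W"
  by (auto simp: lin_span_def)

lemma submodule_prod_space:
  assumes "nonassoc_algebra A" "V \<subseteq> carrier A" "W \<subseteq> carrier A"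
  shows "submodule (prod_space A V W) scalars A"
    and "\<And>x y. x \<in> V \<Longrightarrow> y \<in> W \<Longrightarrow> x \<otimes>\<^bsub>A\<^esub> y \<in> prod_space A V W"
proof -
  interpret nonassoc_algebra A by fact
  have sub: "{x \<otimes>\<^bsub>A\<^esub> y | x y. x \<in> V \<and> y \<in> W} \<subseteq> carrier A" using assms mult_closed by blast
  show "submodule (prod_space A V W) scalars A"
    unfolding prod_space_def by (rule submodule_lin_span(1)[OF assms(1) sub])
  show "\<And>x y. x \<in> V \<Longrightarrow> y \<in> W \<Longrightarrow> x \<otimes>\<^bsub>A\<^esub> y \<in> prod_space A V W"
    unfolding prod_space_def using submodule_lin_span(2)[OF assms(1) sub] by blast
qed

lemma submodule_carrier: "submodule W R A \<Longrightarrow> W \<subseteq> carrier A"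
  by (auto simp: submodule_def subgroup_def)

lemma submodule_pow_space:
  assumes A: "nonassoc_algebra A" and V: "submodule V scalars A"
  shows "submodule (pow_space A V n) scalars A"
proof (induction n rule: less_induct)
  case (less n)
  interpret nonassoc_algebra A by fact
  have z: "submodule {\<zero>\<^bsub>A\<^esub>} scalars A" by (rule submoduleI) auto
  have "prod_space A (pow_space A V i) (pow_space A V (n - i)) \<subseteq> carrier A" if "i \<in> {1..n-1}" for i
    using that by (intro submodule_carrier[OF submodule_prod_space(1)[OF A]]
        submodule_carrier[OF less.IH]) auto
  then have "(\<Union>i\<in>{1..n-1}. prod_space A (pow_space A V i) (pow_space A V (n - i))) \<subseteq> carrier A"
    by (rule UN_least)
  from submodule_lin_span(1)[OF A this] show ?case using z V by (subst pow_space.simps) auto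
qed

lemma pow_space_mult:
  assumes A: "nonassoc_algebra A" and V: "submodule V scalars A"
    and "a \<in> pow_space A V i" "b \<in> pow_space A V j" "i \<ge> 1" "j \<ge> 1"
  shows "a \<otimes>\<^bsub>A\<^esub> b \<in> pow_space A V (i + j)"
proof -
  note car = submodule_carrier[OF submodule_pow_space[OF A V]]
  let ?U = "\<Union>k\<in>{1..i+j-1}. prod_space A (pow_space A V k) (pow_space A V (i+j-k))"
  have "?U \<subseteq> carrier A"
    using submodule_carrier[OF submodule_prod_space(1)[OF A car car]] by blast
  then have "?U \<subseteq> lin_span A ?U" by (rule submodule_lin_span(2)[OF A])
  moreover have "a \<otimes>\<^bsub>A\<^esub> b \<in> prod_space A (pow_space A V i) (pow_space A V (i+j-i))"
    using assms by (intro submodule_prod_space(2)[OF A car car]) auto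
  moreover have "i \<in> {1..i+j-1}" using assms by auto
  ultimately have "a \<otimes>\<^bsub>A\<^esub> b \<in> lin_span A ?U" by blast
  then show ?thesis using assms(5,6) by (subst pow_space.simps) auto
qed

lemma pow_space_upto_superset:
  assumes A: "nonassoc_algebra A" and V: "submodule V scalars A" and "1 \<le> i" "i \<le> n"
  shows "pow_space A V i \<subseteq> pow_space_upto A V n"
proof -
  let ?U = "\<Union>i\<in>{1..n}. pow_space A V i"
  have "?U \<subseteq> carrier A" using submodule_carrier[OF submodule_pow_space[OF A V]] by blast
  then have "?U \<subseteq> lin_span A ?U" by (rule submodule_lin_span(2)[OF A])
  then show ?thesis using assms(3,4) unfolding pow_space_upto_def by fastforce
qed

lemma submodule_pow_space_upto:
  assumes A: "nonassoc_algebra A" and V: "submodule V scalars A"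
  shows "submodule (pow_space_upto A V n) scalars A"
  unfolding pow_space_upto_def
  using submodule_carrier[OF submodule_pow_space[OF A V]] by (intro submodule_lin_span(1)[OF A]) blast

text \<open>Replaces the powers of an arbitrary \<open>V\<close> by a multiplicative filtration that
  is easier to count: factors in \<open>F (m * i)\<close> and \<open>F (m * (n - i))\<close>
  multiply into \<open>F (m * n)\<close>.\<close>

lemma pow_space_subset_filtration:
  assumes A: "nonassoc_algebra A"
    and F: "\<And>n. submodule (F n) scalars A" "\<And>m n. m \<le> n \<Longrightarrow> F m \<subseteq> F n"
      "\<And>m n x y. x \<in> F m \<Longrightarrow> y \<in> F n \<Longrightarrow> x \<otimes>\<^bsub>A\<^esub> y \<in> F (m + n)"
    and V: "V \<subseteq> F m" and n: "n \<ge> 1"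
  shows "pow_space A V n \<subseteq> F (m * n)"
  using n
proof (induction n rule: less_induct)
  case (less n)
  show ?case
  proof (cases "n = 1")
    case False
    have "prod_space A (pow_space A V i) (pow_space A V (n - i)) \<subseteq> F (m * n)" if "i \<in> {1..n-1}" for i
      unfolding prod_space_def
    proof (rule lin_span_minimal[OF F(1)], safe)
      fix x y assume "x \<in> pow_space A V i" "y \<in> pow_space A V (n - i)"
      moreover have "pow_space A V i \<subseteq> F (m * i)" "pow_space A V (n - i) \<subseteq> F (m * (n - i))"
        using that less.prems by (auto intro!: less.IH[THEN subsetD])
      ultimately have "x \<otimes>\<^bsub>A\<^esub> y \<in> F (m * i + m * (n - i))" by (intro F(3)) auto
      moreover have "m * i + m * (n - i) = m * n" using that
        by (metis add_mult_distrib2 atLeastAtMost_iff diff_le_self le_add_diff_inverse order.trans)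
      ultimately show "x \<otimes>\<^bsub>A\<^esub> y \<in> F (m * n)" by simp
    qed
    then have "(\<Union>i\<in>{1..n-1}. prod_space A (pow_space A V i) (pow_space A V (n - i))) \<subseteq> F (m * n)"
      by (rule UN_least)
    from lin_span_minimal[OF F(1) this] less.prems False show ?thesis by (subst pow_space.simps) auto
  qed (use V in \<open>simp add: pow_space.simps\<close>)
qed

lemma pow_space_upto_subset_filtration:
  assumes A: "nonassoc_algebra A"
    and F: "\<And>n. submodule (F n) scalars A" "\<And>m n. m \<le> n \<Longrightarrow> F m \<subseteq> F n"
      "\<And>m n x y. x \<in> F m \<Longrightarrow> y \<in> F n \<Longrightarrow> x \<otimes>\<^bsub>A\<^esub> y \<in> F (m + n)"
    and V: "V \<subseteq> F m"
  shows "pow_space_upto A V n \<subseteq> F (m * n)"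
  unfolding pow_space_upto_def
proof (rule lin_span_minimal[OF F(1)], rule UN_least)
  fix i assume "i \<in> {1..n}"
  then have "pow_space A V i \<subseteq> F (m * i)" "F (m * i) \<subseteq> F (m * n)"
    using pow_space_subset_filtration[OF A F V, of i] F(2)[of "m * i" "m * n"] by auto
  then show "pow_space A V i \<subseteq> F (m * n)" by blast
qed

text \<open>An injective linear map carries spans, independence and finite dimension of
  carrier-based subspaces over to the vector space \<open>pm\<close>, where the exchange argument is
  at hand. The image may be a proper subspace, such as the functions supported on irreducible normal
  forms.\<close>

locale coordinates = nonassoc_algebra A
  for A :: "('k::field, 'a) module" (structure) +
  fixes \<psi> :: "'a \<Rightarrow> ('b \<Rightarrow>\<^sub>0 'k)"
  assumes inj: "inj_on \<psi> (carrier A)"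
    and add: "\<lbrakk>x \<in> carrier A; y \<in> carrier A\<rbrakk> \<Longrightarrow> \<psi> (x \<oplus> y) = \<psi> x + \<psi> y"
    and scale: "x \<in> carrier A \<Longrightarrow> \<psi> (c \<odot> x) = pm_scale c (\<psi> x)"
begin

lemma zero: "\<psi> \<zero> = 0"
  using add[of "\<zero>" "\<zero>"] by simp

lemma subspace_image: "submodule W scalars A \<Longrightarrow> pm.subspace (\<psi> ` W)"
  unfolding pm.subspace_def
proof safe
  assume W: "submodule W scalars A"
  note c = submodule_carrier[OF W]
  show "0 \<in> \<psi> ` W"
    using subgroup.one_closed[of W "add_monoid A"] W zero by (force simp: submodule_def)
  show "\<psi> x + \<psi> y \<in> \<psi> ` W" if "x \<in> W" "y \<in> W" for x y
    using that c submoduleE(5)[OF W, of x y] add[of x y] by (metis image_eqI subsetD)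
  show "pm_scale k (\<psi> x) \<in> \<psi> ` W" if "x \<in> W" for x k
    using that c submoduleE(4)[OF W, of k x] scale[of x k] by (metis UNIV_I image_eqI scalars_simps(1) subsetD)
qed

lemma submodule_vimage:
  assumes "pm.subspace U"
  shows "submodule {x \<in> carrier A. \<psi> x \<in> U} scalars A"
proof (rule submoduleI)
  show "\<ominus> a \<in> {x \<in> carrier A. \<psi> x \<in> U}" if "a \<in> {x \<in> carrier A. \<psi> x \<in> U}" for a
  proof -
    have "\<psi> (\<ominus> a \<oplus> a) = \<psi> (\<ominus> a) + \<psi> a" using that by (intro add) auto
    then have "\<psi> (\<ominus> a) = - \<psi> a" using that zero by (simp add: M.l_neg eq_neg_iff_add_eq_0)
    then show ?thesis using that assms by (auto intro: pm.subspace_neg)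
  qed
qed (use assms in \<open>auto simp: zero add scale pm.subspace_0 pm.subspace_add pm.subspace_scale\<close>)

lemma span_image:
  assumes "G \<subseteq> carrier A"
  shows "\<psi> ` lin_span A G = pm.span (\<psi> ` G)"
proof
  have "lin_span A G \<subseteq> {x \<in> carrier A. \<psi> x \<in> pm.span (\<psi> ` G)}"
    using assms by (intro lin_span_minimal submodule_vimage) (auto intro: pm.span_base)
  then show "\<psi> ` lin_span A G \<subseteq> pm.span (\<psi> ` G)" by blast
  show "pm.span (\<psi> ` G) \<subseteq> \<psi> ` lin_span A G"
    using submodule_lin_span[OF nonassoc_algebra_axioms assms]
    by (intro pm.span_minimal subspace_image) auto
qed

text \<open>By injectivity, removing \<open>b\<close> from \<open>B\<close> and removing its image
  from the image of \<open>B\<close> correspond, so the elementwise independence in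
  \<open>lin_basis\<close> matches \<open>pm.independent\<close>.\<close>

lemma lin_basis_iff:
  assumes "B \<subseteq> carrier A" "submodule W scalars A"
  shows "lin_basis A B W \<longleftrightarrow> pm.independent (\<psi> ` B) \<and> pm.span (\<psi> ` B) = \<psi> ` W"
proof -
  have c: "lin_span A G \<subseteq> carrier A" if "G \<subseteq> carrier A" for G
    using submodule_carrier[OF submodule_lin_span(1)[OF nonassoc_algebra_axioms that]] .
  have "b \<in> lin_span A (B - {b}) \<longleftrightarrow> \<psi> b \<in> pm.span (\<psi> ` B - {\<psi> b})" if "b \<in> B" for b
  proof -
    have d: "B - {b} \<subseteq> carrier A" "b \<in> carrier A" using assms that by auto
    have "b \<in> lin_span A (B - {b}) \<longleftrightarrow> \<psi> b \<in> \<psi> ` lin_span A (B - {b})"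
      using inj c[OF d(1)] d by (auto simp: inj_on_def)
    moreover have "\<psi> ` (B - {b}) = \<psi> ` B - {\<psi> b}"
      using inj_on_image_set_diff[OF inj, of B "{b}"] assms d by auto
    ultimately show ?thesis using span_image[OF d(1)] by simp
  qed
  moreover have "lin_span A B = W \<longleftrightarrow> pm.span (\<psi> ` B) = \<psi> ` W"
    using span_image[OF assms(1)] inj_on_image_eq_iff[OF inj c[OF assms(1)] submodule_carrier[OF assms(2)]]
    by metis
  ultimately show ?thesis using assms unfolding lin_basis_def pm.dependent_def by blast
qed

lemma fin_dim_subspaceI:
  assumes "submodule W scalars A" "finite F" "\<psi> ` W \<subseteq> pm.span F"
  shows "fin_dim_subspace A W"
proof -
  obtain C where C: "C \<subseteq> \<psi> ` W" "pm.independent C" "\<psi> ` W \<subseteq> pm.span C"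
    by (rule pm.maximal_independent_subset)
  then obtain B where B: "B \<subseteq> W" "\<psi> ` B = C" by (metis subset_imageE)
  note c = submodule_carrier[OF assms(1)]
  have "finite C" using pm.independent_span_bound[of F C] C assms by blast
  then have "finite B" using B finite_image_iff[of \<psi> B] inj_on_subset[OF inj] c by blast
  moreover have "lin_basis A B W"
    using B C c assms pm.span_minimal[OF C(1) subspace_image[OF assms(1)]] by (subst lin_basis_iff) auto
  ultimately show ?thesis using assms(1) by (auto simp: fin_dim_subspace_def)
qed

text \<open>\<open>lin_dim\<close> counts a basis picked by choice. The finite set \<open>F\<close>
  shows that there is one to pick; the exchange bound then compares its size with \<open>F\<close>
  from above and with any independent family from below.\<close>

lemma lin_dim_bounds:
  assumes W: "submodule W scalars A" and F: "finite F" "\<psi> ` W \<subseteq> pm.span F"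
  shows "lin_dim A W \<le> card F"
    and "\<And>C. pm.independent C \<Longrightarrow> C \<subseteq> \<psi> ` W \<Longrightarrow> finite C \<and> card C \<le> lin_dim A W"
proof -
  define B where "B = (SOME B. lin_basis A B W)"
  have "\<exists>B. lin_basis A B W" using fin_dim_subspaceI[OF W F] by (auto simp: fin_dim_subspace_def)
  then have 1: "lin_basis A B W" unfolding B_def by (rule someI_ex)
  have c: "B \<subseteq> carrier A" using 1 by (simp add: lin_basis_def)
  then have 2: "pm.independent (\<psi> ` B)" "pm.span (\<psi> ` B) = \<psi> ` W" using 1 lin_basis_iff[OF c W] by auto
  have card: "card (\<psi> ` B) = lin_dim A W"
    using card_image[OF inj_on_subset[OF inj c]] by (simp add: lin_dim_def B_def)
  have fin: "finite (\<psi> ` B) \<and> card (\<psi> ` B) \<le> card F"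
    using F 2 pm.span_superset[of "\<psi> ` B"] by (intro pm.independent_span_bound) auto
  then show "lin_dim A W \<le> card F" using card by simp
  show "finite C \<and> card C \<le> lin_dim A W" if "pm.independent C" "C \<subseteq> \<psi> ` W" for C
    using pm.independent_span_bound[of "\<psi> ` B" C] that fin 2 card by auto
qed

end

text \<open>The axioms are identities and closure conditions, so they pass to a surjective image.
  The zero is a separate assumption because \<open>B\<close> is not yet known to be a group.\<close>

lemma nonassoc_algebra_hom_image:
  fixes A :: "('k::field, 'a) module" and B :: "('k, 'b) module"
  assumes A: "nonassoc_algebra A" and h: "alg_hom A B \<phi>" "\<phi> ` carrier A = carrier B"
    and z: "\<phi> \<zero>\<^bsub>A\<^esub> = \<zero>\<^bsub>B\<^esub>"
  shows "nonassoc_algebra B"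
proof -
  interpret nonassoc_algebra A by fact
  note hom = h(1)[unfolded alg_hom_def]
  have cl: "\<phi> x \<in> carrier B" if "x \<in> carrier A" for x using hom that by auto
  have pull: "\<exists>x\<in>carrier A. y = \<phi> x" if "y \<in> carrier B" for y using h(2) that by blast
  have ad: "\<phi> x \<oplus>\<^bsub>B\<^esub> \<phi> y = \<phi> (x \<oplus>\<^bsub>A\<^esub> y)" if "x \<in> carrier A" "y \<in> carrier A" for x y
    using hom that by simp
  have mu: "\<phi> x \<otimes>\<^bsub>B\<^esub> \<phi> y = \<phi> (x \<otimes>\<^bsub>A\<^esub> y)" if "x \<in> carrier A" "y \<in> carrier A" for x y
    using hom that by simp
  have sc: "c \<odot>\<^bsub>B\<^esub> \<phi> x = \<phi> (c \<odot>\<^bsub>A\<^esub> x)" if "x \<in> carrier A" for c x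
    using hom that by simp
  have smc: "c \<odot>\<^bsub>A\<^esub> x \<in> carrier A" if "x \<in> carrier A" for c x using that by simp
  have ab: "abelian_group B"
  proof (rule abelian_groupI)
    fix x assume "x \<in> carrier B"
    then obtain a where a: "a \<in> carrier A" "x = \<phi> a" using pull by blast
    then show "\<exists>y\<in>carrier B. y \<oplus>\<^bsub>B\<^esub> x = \<zero>\<^bsub>B\<^esub>"
      by (intro bexI[of _ "\<phi> (\<ominus>\<^bsub>A\<^esub> a)"]) (simp_all add: ad M.l_neg z cl)
  next
    fix x y w assume "x \<in> carrier B" "y \<in> carrier B" "w \<in> carrier B"
    then show "(x \<oplus>\<^bsub>B\<^esub> y) \<oplus>\<^bsub>B\<^esub> w = x \<oplus>\<^bsub>B\<^esub> (y \<oplus>\<^bsub>B\<^esub> w)"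
      by (auto dest!: pull simp: ad M.a_assoc)
  qed (auto dest!: pull simp: ad cl M.a_comm simp flip: z)
  have "module (scalars :: 'k ring) B"
  proof (rule moduleI[OF scalars_cring ab], simp_all only: scalars_simps)
    fix a x y assume "x \<in> carrier B" "y \<in> carrier B"
    then show "a \<odot>\<^bsub>B\<^esub> (x \<oplus>\<^bsub>B\<^esub> y) = a \<odot>\<^bsub>B\<^esub> x \<oplus>\<^bsub>B\<^esub> a \<odot>\<^bsub>B\<^esub> y"
      by (auto dest!: pull simp: ad sc smc smult_r_distr)
  next
    fix a b x assume "x \<in> carrier B"
    then show "(a + b) \<odot>\<^bsub>B\<^esub> x = a \<odot>\<^bsub>B\<^esub> x \<oplus>\<^bsub>B\<^esub> b \<odot>\<^bsub>B\<^esub> x" 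
      using smult_l_distr[of a b] by (auto dest!: pull simp: ad sc smc)
  next
    fix a b x assume "x \<in> carrier B"
    then show "(a * b) \<odot>\<^bsub>B\<^esub> x = a \<odot>\<^bsub>B\<^esub> (b \<odot>\<^bsub>B\<^esub> x)" 
      using smult_assoc1[of a b] by (auto dest!: pull simp: ad sc smc)
  next
    fix x assume "x \<in> carrier B"
    then show "1 \<odot>\<^bsub>B\<^esub> x = x" using smult_one by (auto dest!: pull simp: sc)
  next
    fix a x assume "x \<in> carrier B"
    then show "a \<odot>\<^bsub>B\<^esub> x \<in> carrier B" by (auto dest!: pull simp: sc cl)
  qed
  then show ?thesis
  proof (intro nonassoc_algebra.intro nonassoc_algebra_axioms.intro)
    fix x y assume "x \<in> carrier B" "y \<in> carrier B"
    then show "x \<otimes>\<^bsub>B\<^esub> y \<in> carrier B" by (auto dest!: pull simp: mu cl mult_closed)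
  next
    fix x y w assume "x \<in> carrier B" "y \<in> carrier B" "w \<in> carrier B"
    then show "(x \<oplus>\<^bsub>B\<^esub> y) \<otimes>\<^bsub>B\<^esub> w = x \<otimes>\<^bsub>B\<^esub> w \<oplus>\<^bsub>B\<^esub> y \<otimes>\<^bsub>B\<^esub> w"
      "x \<otimes>\<^bsub>B\<^esub> (y \<oplus>\<^bsub>B\<^esub> w) = x \<otimes>\<^bsub>B\<^esub> y \<oplus>\<^bsub>B\<^esub> x \<otimes>\<^bsub>B\<^esub> w"
      by (auto dest!: pull simp: ad mu mult_closed mult_add_left mult_add_right)
  next
    fix x y c assume "x \<in> carrier B" "y \<in> carrier B"
    then show "(c \<odot>\<^bsub>B\<^esub> x) \<otimes>\<^bsub>B\<^esub> y = c \<odot>\<^bsub>B\<^esub> (x \<otimes>\<^bsub>B\<^esub> y)"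
      "x \<otimes>\<^bsub>B\<^esub> (c \<odot>\<^bsub>B\<^esub> y) = c \<odot>\<^bsub>B\<^esub> (x \<otimes>\<^bsub>B\<^esub> y)"
      by (auto dest!: pull simp: sc mu mult_closed smc mult_smult_left mult_smult_right)
  qed
qed

section \<open>Positive functionals and Dickson's lemma\<close>

lemma finite_sets_separated:
  fixes A B :: "real set"
  assumes "finite A" "finite B" "\<And>a b. a \<in> A \<Longrightarrow> b \<in> B \<Longrightarrow> a < b"
  shows "\<exists>t. (\<forall>a\<in>A. a < t) \<and> (\<forall>b\<in>B. t < b)"
proof (cases "A = {}")
  case True
  then show ?thesis
    using assms(2) by (intro exI[of _ "Min (insert 0 B) - 1"]) (auto simp: diff_less_eq intro: le_less_trans[OF Min_le])
next
  case A: False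
  show ?thesis
  proof (cases "B = {}")
    case True
    then show ?thesis
      using assms(1) by (intro exI[of _ "Max A + 1"]) (auto intro!: le_less_trans[OF Max_ge less_add_one])
  next
    case False
    then have "Max A < Min B" using A assms by (intro assms(3) Max_in Min_in) auto
    then obtain t where "Max A < t" "t < Min B" using dense by blast
    then show ?thesis using A False assms(1,2) by (auto intro!: exI[of _ t])
  qed
qed

lemma add_closed_scale:
  fixes a :: "'i \<Rightarrow> int"
  assumes "\<And>a b. a \<in> P \<Longrightarrow> b \<in> P \<Longrightarrow> (\<lambda>i. a i + b i) \<in> P" "a \<in> P" "0 < n"
  shows "(\<lambda>i. n * a i) \<in> P"
proof -
  have "(\<lambda>i. int (Suc k) * a i) \<in> P" for k
  proof (induction k)
    case (Suc k)
    have "(\<lambda>i. int (Suc k) * a i + a i) \<in> P" by (rule assms(1)[OF Suc assms(2)])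
    then show ?case by (simp add: algebra_simps)
  qed (use assms(2) in simp)
  from this[of "nat n - 1"] assms(3) show ?thesis by simp
qed

text \<open>Gordan's alternative; one coordinate at a time is removed by Fourier-Motzkin elimination.\<close>

lemma positive_functional_exists:
  fixes D P :: "('i \<Rightarrow> int) set"
  assumes "finite I" "finite D" "D \<subseteq> P" "\<And>d i. d \<in> D \<Longrightarrow> i \<notin> I \<Longrightarrow> d i = 0"
    and P: "\<And>a b. a \<in> P \<Longrightarrow> b \<in> P \<Longrightarrow> (\<lambda>i. a i + b i) \<in> P" "(\<lambda>i. 0) \<notin> P"
  shows "\<exists>w::'i \<Rightarrow> real. \<forall>d\<in>D. 0 < (\<Sum>i\<in>I. w i * of_int (d i))"
  using assms(1-4)
proof (induction I arbitrary: D)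
  case empty
  \<comment> \<open>With no coordinate left, an element of \<open>D\<close> would be the zero
    vector, which \<open>P\<close> excludes.\<close>
  have "D = {}"
  proof (rule ccontr)
    assume "D \<noteq> {}"
    then obtain d where "d \<in> D" by blast
    with empty have "d = (\<lambda>i. 0)" "d \<in> P" by auto
    with P(2) show False by simp
  qed
  then show ?case by simp
next
  case (insert j I)
  \<comment> \<open>The multipliers \<open>- e j\<close> and \<open>d j\<close> are positive for
    \<open>d\<close> in \<open>Dp\<close> and \<open>e\<close> in \<open>Dn\<close>, so the
    combination stays in \<open>P\<close>, and they are chosen so that coordinate \<open>j\<close>
    cancels.\<close>
  define comb where "comb = (\<lambda>(d, e). \<lambda>i. - e j * d i + d j * e i :: int)"
  define D0 where "D0 = {d \<in> D. d j = 0}"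
  define Dp where "Dp = {d \<in> D. d j > 0}"
  define Dn where "Dn = {d \<in> D. d j < 0}"
  note sets = D0_def Dp_def Dn_def
  have "comb (d, e) \<in> P" if "d \<in> Dp" "e \<in> Dn" for d e
  proof -
    have "(\<lambda>i. - e j * d i) \<in> P" "(\<lambda>i. d j * e i) \<in> P"
      by (rule add_closed_scale[OF P(1)]; use that insert.prems(2) in \<open>auto simp: sets\<close>)+
    then show ?thesis using P(1) by (fastforce simp: comb_def)
  qed
  then have "D0 \<union> comb ` (Dp \<times> Dn) \<subseteq> P" using insert.prems(2) by (auto simp: sets)
  moreover have "finite (D0 \<union> comb ` (Dp \<times> Dn))" using insert.prems(1) by (simp add: sets)
  moreover have "d i = 0" if "d \<in> D0 \<union> comb ` (Dp \<times> Dn)" "i \<notin> I" for d i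
  proof (cases "i = j")
    case True
    with that show ?thesis by (auto simp: sets comb_def)
  next
    case False
    with that(2) have "\<And>d. d \<in> D \<Longrightarrow> d i = 0" using insert.prems(3) by simp
    then have "comb (d, e) i = 0" if "d \<in> D" "e \<in> D" for d e
      using that by (metis (no_types, lifting) add_0 case_prod_conv comb_def mult_zero_right)
    with that(1) \<open>\<And>d. d \<in> D \<Longrightarrow> d i = 0\<close> show ?thesis by (elim UnE imageE) (auto simp: sets)
  qed
  ultimately have "\<exists>w::'i \<Rightarrow> real. \<forall>d\<in>D0 \<union> comb ` (Dp \<times> Dn). 0 < (\<Sum>i\<in>I. w i * of_int (d i))"
    by (intro insert.IH)
  then obtain w :: "'i \<Rightarrow> real" where
    w: "\<forall>d\<in>D0 \<union> comb ` (Dp \<times> Dn). 0 < (\<Sum>i\<in>I. w i * of_int (d i))" ..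
  define L where "L d = (\<Sum>i\<in>I. w i * real_of_int (d i))" for d
  \<comment> \<open>Positivity of \<open>L\<close> on the combinations says that each lower bound
    from \<open>Dp\<close> on the new weight \<open>t\<close> lies below each upper bound from
    \<open>Dn\<close>.\<close>
  have "- L d / of_int (d j) < - L e / of_int (e j)" if "d \<in> Dp" "e \<in> Dn" for d e
  proof -
    have "0 < L (comb (d, e))" using w that unfolding L_def by blast
    also have "L (comb (d, e)) = - of_int (e j) * L d + of_int (d j) * L e"
      unfolding L_def comb_def
      by (simp add: sum_distrib_left sum_subtractf[symmetric] sum.distrib[symmetric] algebra_simps)
    finally show ?thesis using that by (auto simp: sets field_simps)
  qed
  then have "\<exists>t. (\<forall>a\<in>(\<lambda>d. - L d / of_int (d j)) ` Dp. a < t) \<and> (\<forall>b\<in>(\<lambda>e. - L e / of_int (e j)) ` Dn. t < b)"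
    using insert.prems(1) by (intro finite_sets_separated) (auto simp: sets)
  then obtain t where t: "\<And>d. d \<in> Dp \<Longrightarrow> - L d / of_int (d j) < t" "\<And>e. e \<in> Dn \<Longrightarrow> t < - L e / of_int (e j)"
    by auto
  have "0 < (\<Sum>i\<in>insert j I. (w(j := t)) i * of_int (d i))" if d: "d \<in> D" for d
  proof -
    have "(\<Sum>i\<in>insert j I. (w(j := t)) i * of_int (d i)) = t * of_int (d j) + (\<Sum>i\<in>I. (w(j := t)) i * of_int (d i))"
      using insert.hyps by simp
    also have "(\<Sum>i\<in>I. (w(j := t)) i * of_int (d i)) = L d"
      unfolding L_def using insert.hyps by (intro sum.cong) auto
    finally have eq: "(\<Sum>i\<in>insert j I. (w(j := t)) i * of_int (d i)) = t * of_int (d j) + L d" .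
    consider "d \<in> D0" | "d \<in> Dp" | "d \<in> Dn"
      using d linorder_less_linear[of "d j" 0] by (auto simp: sets)
    then show ?thesis
    proof cases
      case 1 then show ?thesis unfolding eq using w by (simp add: L_def sets)
    next
      case 2 then show ?thesis unfolding eq using t(1)[of d] by (auto simp: sets field_simps)
    next
      case 3 then show ?thesis unfolding eq using t(2)[of d] by (auto simp: sets field_simps)
    qed
  qed
  then show ?case by blast
qed

section \<open>Dickson's lemma through monotone subsequences\<close>

lemma monotone_subsequence:
  fixes f :: "nat \<Rightarrow> 'i \<Rightarrow> nat"
  assumes "finite I"
  shows "\<exists>g::nat \<Rightarrow> nat. strict_mono g \<and> (\<forall>i\<in>I. \<forall>m n. m \<le> n \<longrightarrow> f (g m) i \<le> f (g n) i)"
  using assms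
proof (induction I)
  case empty
  then show ?case by (intro exI[of _ id]) (simp add: strict_mono_def)
next
  case (insert j I)
  from insert.IH obtain g :: "nat \<Rightarrow> nat" where g: "strict_mono g \<and> (\<forall>i\<in>I. \<forall>m n. m \<le> n \<longrightarrow> f (g m) i \<le> f (g n) i)" ..
  \<comment> \<open>An index beyond \<open>n\<close> at which coordinate \<open>j\<close> is least
    is never undercut later; a chain of such indices yields a subsequence that is monotone in
    \<open>j\<close> as well.\<close>
  have inf: "\<exists>m\<ge>n. \<forall>k\<ge>m. f (g m) j \<le> f (g k) j" for n
  proof -
    obtain m where "m \<ge> n" "\<And>k. k \<ge> n \<Longrightarrow> f (g m) j \<le> f (g k) j"
      using ex_has_least_nat[of "\<lambda>m. m \<ge> n" n "\<lambda>m. f (g m) j"] by auto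
    then show ?thesis by (intro exI[of _ m]) auto
  qed
  obtain h :: "nat \<Rightarrow> nat" where h: "\<And>n. \<forall>k\<ge>h n. f (g (h n)) j \<le> f (g k) j" "\<And>n. h n < h (Suc n)"
  proof -
    have "\<exists>h. \<forall>n. (\<forall>k\<ge>h n. f (g (h n)) j \<le> f (g k) j) \<and> h n < h (Suc n)"
    proof (rule dependent_nat_choice)
      show "\<exists>m. \<forall>k\<ge>m. f (g m) j \<le> f (g k) j" using inf[of 0] by blast
      show "\<exists>y. (\<forall>k\<ge>y. f (g y) j \<le> f (g k) j) \<and> x < y" for x using inf[of "Suc x"] by (auto simp: Suc_le_eq)
    qed
    then show ?thesis using that by blast
  qed
  have mono: "strict_mono h" using h(2) by (simp add: strict_mono_Suc_iff)
  then have "f (g (h m)) j \<le> f (g (h n)) j" if "m \<le> n" for m n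
    using that h(1) by (simp add: strict_mono_less_eq)
  moreover have "strict_mono (\<lambda>n. g (h n))" using g mono by (simp add: strict_mono_def)
  moreover have "f (g (h m)) i \<le> f (g (h n)) i" if "m \<le> n" "i \<in> I" for m n i
    using that mono g by (simp add: strict_mono_less_eq)
  ultimately show ?case by (intro exI[of _ "\<lambda>n. g (h n)"]) auto
qed

text \<open>Infinitely many minimal elements would contain a monotone sequence of distinct ones,
  hence two comparable ones. \<open>ext\<close> lets functions on a whole type stand for vectors
  indexed by \<open>I\<close>.\<close>

lemma dickson:
  fixes U :: "('i \<Rightarrow> nat) set"
  assumes "finite I" and ext: "\<And>a b. a \<in> U \<Longrightarrow> b \<in> U \<Longrightarrow> \<forall>i\<in>I. a i = b i \<Longrightarrow> a = b"
  shows "\<exists>M\<subseteq>U. finite M \<and> (\<forall>a\<in>U. \<exists>b\<in>M. \<forall>i\<in>I. b i \<le> a i)"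
proof -
  define M where "M = {a \<in> U. \<forall>b\<in>U. (\<forall>i\<in>I. b i \<le> a i) \<longrightarrow> b = a}"
  have "finite M"
  proof (rule ccontr)
    assume "infinite M"
    then obtain f :: "nat \<Rightarrow> 'i \<Rightarrow> nat" where f: "inj f" "range f \<subseteq> M"
      using infinite_countable_subset by metis
    from monotone_subsequence[OF assms(1), of f] obtain g :: "nat \<Rightarrow> nat" where
      g: "strict_mono g \<and> (\<forall>i\<in>I. \<forall>m n. m \<le> n \<longrightarrow> f (g m) i \<le> f (g n) i)" ..
    have "f (g 0) \<in> M" "f (g 1) \<in> M" using f(2) by auto
    then have "f (g 0) = f (g 1)" using g by (simp add: M_def)
    then have "g 0 = g 1" using f(1) by (simp add: inj_eq)
    then show False using g by (simp add: strict_mono_eq)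
  qed
  moreover have "\<exists>b\<in>M. \<forall>i\<in>I. b i \<le> a i" if "a \<in> U" for a
  proof -
    \<comment> \<open>An element below \<open>a\<close> with least coordinate sum is
      minimal.\<close>
    have "\<exists>b. (b \<in> U \<and> (\<forall>i\<in>I. b i \<le> a i)) \<and>
        (\<forall>c. c \<in> U \<and> (\<forall>i\<in>I. c i \<le> a i) \<longrightarrow> sum b I \<le> sum c I)"
      by (rule ex_has_least_nat[of _ a]) (use that in simp)
    then obtain b where b': "b \<in> U \<and> (\<forall>i\<in>I. b i \<le> a i)"
      "\<forall>c. c \<in> U \<and> (\<forall>i\<in>I. c i \<le> a i) \<longrightarrow> sum b I \<le> sum c I" by (elim exE conjE) simp
    then have b: "b \<in> U" "\<forall>i\<in>I. b i \<le> a i" by auto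
    have "c = b" if c: "c \<in> U" "\<forall>i\<in>I. c i \<le> b i" for c
    proof (rule ext[OF c(1) b(1)], rule ccontr)
      assume "\<not> (\<forall>i\<in>I. c i = b i)"
      then have "sum c I < sum b I" using c(2) assms(1) by (intro sum_strict_mono_ex1) (auto simp: order.strict_iff_order)
      moreover have "\<forall>i\<in>I. c i \<le> a i" using b(2) c(2) order.trans by blast
      then have "sum b I \<le> sum c I" using b'(2) c(1) by blast
      ultimately show False by simp
    qed
    then show ?thesis using b by (auto simp: M_def)
  qed
  ultimately show ?thesis by (intro exI[of _ M]) (auto simp: M_def)
qed

section \<open>Monomial orders on normal forms\<close>

text \<open>The two words of a bracket form one vector indexed by letters and sides
  (\<open>False\<close> left, \<open>True\<close> right), on which bracket multiplication is
  addition. The zero vector of a letter is a default value: multiplication by letters is not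
  additive in it.\<close>

fun expo :: "'x nf \<Rightarrow> 'x \<times> bool \<Rightarrow> nat" where
  "expo (Gen x) = (\<lambda>i. 0)"
| "expo (Mon u v) = (\<lambda>(x, b). if b then count v x else count u x)"

text \<open>The operation that forms normal S-polynomials, on the level of basis elements;
  \<open>poly_shift_eq\<close> shows that \<open>poly_shift\<close> is its linear extension.\<close>

definition nf_shift :: "'x list \<Rightarrow> 'x list \<Rightarrow> 'x nf \<Rightarrow> 'x nf" where
  "nf_shift zs ys \<mu> = foldr (\<lambda>z. nf_mult (Gen z)) zs (foldl (\<lambda>\<nu> y. nf_mult \<nu> (Gen y)) \<mu> ys)"

lemma nf_shift_Mon: "nf_shift zs ys (Mon u v) = Mon (u + mset zs) (v + mset ys)"
proof -
  have "foldl (\<lambda>\<nu> y. nf_mult \<nu> (Gen y)) (Mon u v) ys = Mon u (v + mset ys)"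
    by (induction ys arbitrary: v) simp_all
  moreover have "foldr (\<lambda>z. nf_mult (Gen z)) zs (Mon u w) = Mon (u + mset zs) w" for w
    by (induction zs) simp_all
  ultimately show ?thesis by (simp add: nf_shift_def)
qed

lemma nf_shift_Nil [simp]: "nf_shift [] [] \<mu> = \<mu>"
  by (simp add: nf_shift_def)

lemma nf_shift_Cons_right: "nf_shift zs (y # ys) \<mu> = nf_shift zs ys (nf_mult \<mu> (Gen y))"
  by (simp add: nf_shift_def)

lemma nf_shift_snoc_left: "nf_shift (zs @ [z]) [] \<mu> = nf_shift zs [] (nf_mult (Gen z) \<mu>)"
  by (simp add: nf_shift_def)

lemma nf_mult_is_Mon: "\<exists>u v. nf_mult \<mu> \<nu> = Mon u v"
  by (cases \<mu>; cases \<nu>) auto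

lemma nf_length_mult: "nf_length (nf_mult \<mu> \<nu>) = nf_length \<mu> + nf_length \<nu>"
  by (cases \<mu>; cases \<nu>) simp_all

definition poly_shift :: "'x set \<Rightarrow> 'x list \<Rightarrow> 'x list \<Rightarrow> ('x nf \<Rightarrow>\<^sub>0 'k::field) \<Rightarrow> ('x nf \<Rightarrow>\<^sub>0 'k)" where
  "poly_shift Xs zs ys f = right_normed (BC Xs) (map gen zs) (left_normed (BC Xs) f (map gen ys))"

lemma poly_shift_eq:
  fixes f :: "'x nf \<Rightarrow>\<^sub>0 'k::field"
  shows "poly_shift Xs zs ys f = (\<Sum>\<nu>\<in>Poly_Mapping.keys f.
     Poly_Mapping.single (nf_shift zs ys \<nu>) (Poly_Mapping.lookup f \<nu>))"
proof -
  have m: "monoid.mult (BC Xs :: ('k, 'x nf \<Rightarrow>\<^sub>0 'k) module) = bc_mult" for Xs :: "'x set"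
    by (simp add: BC_def)
  have l: "foldl bc_mult (\<Sum>\<nu>\<in>F. Poly_Mapping.single (a \<nu>) (c \<nu>)) (map gen ys) =
     (\<Sum>\<nu>\<in>F. Poly_Mapping.single (foldl (\<lambda>\<nu> y. nf_mult \<nu> (Gen y)) (a \<nu>) ys) (c \<nu> :: 'k))"
    for a :: "'x nf \<Rightarrow> 'x nf" and c F
    by (induction ys arbitrary: a) (simp_all add: bc_mult_sum_left gen_def)
  have r: "foldr bc_mult (map gen zs) (\<Sum>\<nu>\<in>F. Poly_Mapping.single (a \<nu>) (c \<nu>)) =
     (\<Sum>\<nu>\<in>F. Poly_Mapping.single (foldr (\<lambda>z. nf_mult (Gen z)) zs (a \<nu>)) (c \<nu> :: 'k))"
    for a :: "'x nf \<Rightarrow> 'x nf" and c F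
    by (induction zs) (simp_all add: bc_mult_sum_right gen_def)
  show ?thesis
    using l[of id "Poly_Mapping.lookup f" "Poly_Mapping.keys f"]
    by (simp add: poly_shift_def right_normed_def left_normed_def m r nf_shift_def flip: pm_decomp)
qed

lemma keys_poly_shift: "Poly_Mapping.keys (poly_shift Xs zs ys f) \<subseteq> nf_shift zs ys ` Poly_Mapping.keys f"
proof
  fix \<mu> assume "\<mu> \<in> Poly_Mapping.keys (poly_shift Xs zs ys f)"
  then have "(\<Sum>\<nu>\<in>Poly_Mapping.keys f. Poly_Mapping.lookup
      (Poly_Mapping.single (nf_shift zs ys \<nu>) (Poly_Mapping.lookup f \<nu>)) \<mu>) \<noteq> 0"
    by (simp add: poly_shift_eq in_keys_iff lookup_sum)
  then obtain \<nu> where "\<nu> \<in> Poly_Mapping.keys f" "Poly_Mapping.lookup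
      (Poly_Mapping.single (nf_shift zs ys \<nu>) (Poly_Mapping.lookup f \<nu>)) \<mu> \<noteq> 0"
    by (rule sum.not_neutral_contains_not_neutral)
  then show "\<mu> \<in> nf_shift zs ys ` Poly_Mapping.keys f"
    by (auto simp: lookup_single when_def split: if_splits)
qed

lemma lookup_poly_shift:
  assumes "inj_on (nf_shift zs ys) N" "Poly_Mapping.keys f \<subseteq> N" "\<mu> \<in> N"
  shows "Poly_Mapping.lookup (poly_shift Xs zs ys f) (nf_shift zs ys \<mu>) = Poly_Mapping.lookup f \<mu>"
proof -
  have "Poly_Mapping.lookup (poly_shift Xs zs ys f) (nf_shift zs ys \<mu>) =
    (\<Sum>\<nu>\<in>Poly_Mapping.keys f. if \<nu> = \<mu> then Poly_Mapping.lookup f \<nu> else 0)"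
    unfolding poly_shift_eq lookup_sum
    by (rule sum.cong) (use assms in \<open>auto simp: lookup_single when_def inj_on_def\<close>)
  also have "\<dots> = Poly_Mapping.lookup f \<mu>" by (auto simp: in_keys_iff)
  finally show ?thesis .
qed

section \<open>Leading monomials and monotonicity\<close>

locale nf_order =
  fixes Xs :: "'x set" and R :: "'x nf rel"
  assumes order: "monomial_order Xs R"
begin

lemma R_NF: "(\<mu>, \<nu>) \<in> R \<Longrightarrow> \<mu> \<in> NF Xs \<and> \<nu> \<in> NF Xs"
  and R_refl: "\<mu> \<in> NF Xs \<Longrightarrow> (\<mu>, \<mu>) \<in> R"
  and R_trans: "\<lbrakk>(\<mu>, \<nu>) \<in> R; (\<nu>, \<xi>) \<in> R\<rbrakk> \<Longrightarrow> (\<mu>, \<xi>) \<in> R"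
  and R_antisym: "\<lbrakk>(\<mu>, \<nu>) \<in> R; (\<nu>, \<mu>) \<in> R\<rbrakk> \<Longrightarrow> \<mu> = \<nu>"
  and R_total: "\<lbrakk>\<mu> \<in> NF Xs; \<nu> \<in> NF Xs\<rbrakk> \<Longrightarrow> (\<mu>, \<nu>) \<in> R \<or> (\<nu>, \<mu>) \<in> R"
  and R_wf: "wf (R - Id)"
proof -
  have wo: "well_order_on (NF Xs) R" using order by (simp add: monomial_order_def)
  then show "(\<mu>, \<nu>) \<in> R \<Longrightarrow> \<mu> \<in> NF Xs \<and> \<nu> \<in> NF Xs"
    by (rule well_order_on_domain)
  have wo': "Well_order R" using wo well_order_on_Well_order by blast
  show refl: "\<mu> \<in> NF Xs \<Longrightarrow> (\<mu>, \<mu>) \<in> R" for \<mu>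
    using wo by (auto simp: well_order_on_def linear_order_on_def partial_order_on_def preorder_on_def
        dest: refl_onD)
  show "\<lbrakk>(\<mu>, \<nu>) \<in> R; (\<nu>, \<xi>) \<in> R\<rbrakk> \<Longrightarrow> (\<mu>, \<xi>) \<in> R"
    using wo by (auto simp: well_order_on_def linear_order_on_def partial_order_on_def preorder_on_def
        dest: transD)
  show "\<lbrakk>(\<mu>, \<nu>) \<in> R; (\<nu>, \<mu>) \<in> R\<rbrakk> \<Longrightarrow> \<mu> = \<nu>"
    using wo by (auto simp: well_order_on_def linear_order_on_def partial_order_on_def dest: antisymD)
  show "\<lbrakk>\<mu> \<in> NF Xs; \<nu> \<in> NF Xs\<rbrakk> \<Longrightarrow> (\<mu>, \<nu>) \<in> R \<or> (\<nu>, \<mu>) \<in> R"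
    using wo refl by (cases "\<mu> = \<nu>") (auto simp: well_order_on_def linear_order_on_def total_on_def)
  show "wf (R - Id)" using wo by (simp add: well_order_on_def)
qed

abbreviation nf_less (infix "\<lhd>\<^sub>R" 50) where "\<mu> \<lhd>\<^sub>R \<nu> \<equiv> (\<mu>, \<nu>) \<in> R - Id"

lemma less_trans: "\<mu> \<lhd>\<^sub>R \<nu> \<Longrightarrow> \<nu> \<lhd>\<^sub>R \<xi> \<Longrightarrow> \<mu> \<lhd>\<^sub>R \<xi>"
  using R_trans R_antisym by blast

lemma less_linear: "\<mu> \<in> NF Xs \<Longrightarrow> \<nu> \<in> NF Xs \<Longrightarrow> \<mu> \<lhd>\<^sub>R \<nu> \<or> \<mu> = \<nu> \<or> \<nu> \<lhd>\<^sub>R \<mu>"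
  using R_total by blast

lemma less_mult:
  assumes "\<mu> \<lhd>\<^sub>R \<nu>" "\<xi> \<in> NF Xs"
  shows "nf_mult \<mu> \<xi> \<lhd>\<^sub>R nf_mult \<nu> \<xi>" "nf_mult \<xi> \<mu> \<lhd>\<^sub>R nf_mult \<xi> \<nu>"
  using order assms R_NF[of \<mu> \<nu>] unfolding monomial_order_def by blast+

lemma Gen_NF: "x \<in> Xs \<Longrightarrow> Gen x \<in> NF Xs"
  by (simp add: NF_def)

lemma nf_shift_NF: "\<lbrakk>\<mu> \<in> NF Xs; set zs \<subseteq> Xs; set ys \<subseteq> Xs\<rbrakk> \<Longrightarrow> nf_shift zs ys \<mu> \<in> NF Xs"
proof -
  assume *: "\<mu> \<in> NF Xs" "set zs \<subseteq> Xs" "set ys \<subseteq> Xs"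
  have "foldl (\<lambda>\<nu> y. nf_mult \<nu> (Gen y)) \<mu> ys \<in> NF Xs"
    using *(1,3) by (induction ys arbitrary: \<mu>) (simp_all add: nf_mult_NF Gen_NF)
  with *(2) show ?thesis
    unfolding nf_shift_def by (induction zs) (simp_all add: nf_mult_NF Gen_NF)
qed

lemma less_nf_shift: "\<lbrakk>\<mu> \<lhd>\<^sub>R \<nu>; set zs \<subseteq> Xs; set ys \<subseteq> Xs\<rbrakk> \<Longrightarrow> nf_shift zs ys \<mu> \<lhd>\<^sub>R nf_shift zs ys \<nu>"
proof -
  assume *: "\<mu> \<lhd>\<^sub>R \<nu>" "set zs \<subseteq> Xs" "set ys \<subseteq> Xs"
  have "foldl (\<lambda>\<nu> y. nf_mult \<nu> (Gen y)) \<mu> ys \<lhd>\<^sub>R foldl (\<lambda>\<nu> y. nf_mult \<nu> (Gen y)) \<nu> ys"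
    using *(1,3)
  proof (induction ys arbitrary: \<mu> \<nu>)
    case (Cons y ys)
    then have "nf_mult \<mu> (Gen y) \<lhd>\<^sub>R nf_mult \<nu> (Gen y)" by (intro less_mult Gen_NF) simp_all
    with Cons show ?case by simp
  qed simp
  with *(2) show ?thesis
    unfolding nf_shift_def
  proof (induction zs)
    case (Cons z zs)
    then show ?case using less_mult(2)[OF _ Gen_NF[of z]] by simp
  qed simp
qed

text \<open>A strictly monotone map on a totally ordered set is injective; this treats letters and
  brackets alike.\<close>

lemma inj_on_nf_shift: "set zs \<subseteq> Xs \<Longrightarrow> set ys \<subseteq> Xs \<Longrightarrow> inj_on (nf_shift zs ys) (NF Xs)"
proof (rule inj_onI, rule ccontr)
  fix \<mu> \<nu>
  assume *: "set zs \<subseteq> Xs" "set ys \<subseteq> Xs" "\<mu> \<in> NF Xs" "\<nu> \<in> NF Xs"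
    "nf_shift zs ys \<mu> = nf_shift zs ys \<nu>" "\<mu> \<noteq> \<nu>"
  show False
    using less_linear[OF *(3,4)] less_nf_shift[OF _ *(1,2), of \<mu> \<nu>] less_nf_shift[OF _ *(1,2), of \<nu> \<mu>] *(5,6)
    by auto
qed

lemma lead_eqI:
  assumes "\<mu> \<in> Poly_Mapping.keys f" "\<And>\<nu>. \<nu> \<in> Poly_Mapping.keys f \<Longrightarrow> (\<nu>, \<mu>) \<in> R"
  shows "lead R f = \<mu>"
  unfolding lead_def by (rule the_equality) (use assms R_antisym in blast)+

lemma lead_maximal:
  assumes "f \<noteq> 0" "Poly_Mapping.keys f \<subseteq> NF Xs"
  shows "lead R f \<in> Poly_Mapping.keys f" "\<And>\<nu>. \<nu> \<in> Poly_Mapping.keys f \<Longrightarrow> (\<nu>, lead R f) \<in> R"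
proof -
  have "\<exists>\<mu>\<in>F. \<forall>\<nu>\<in>F. (\<nu>, \<mu>) \<in> R" if "finite F" "F \<noteq> {}" "F \<subseteq> NF Xs" for F
    using that
  proof (induction F rule: finite_ne_induct)
    case (singleton \<mu>)
    then show ?case by (simp add: R_refl)
  next
    case (insert \<mu> F)
    then obtain \<xi> where \<xi>: "\<xi> \<in> F" "\<forall>\<nu>\<in>F. (\<nu>, \<xi>) \<in> R" by auto
    show ?case
    proof (cases "(\<mu>, \<xi>) \<in> R")
      case False
      then have "(\<xi>, \<mu>) \<in> R" using insert.prems \<xi>(1) R_total by blast
      then have "(\<nu>, \<mu>) \<in> R" if "\<nu> \<in> insert \<mu> F" for \<nu>
        using that \<xi>(2) insert.prems R_refl R_trans[of \<nu> \<xi> \<mu>] by auto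
      then show ?thesis by blast
    qed (use \<xi> in auto)
  qed
  from this[of "Poly_Mapping.keys f"] obtain \<mu> where
    \<mu>: "\<mu> \<in> Poly_Mapping.keys f" "\<forall>\<nu>\<in>Poly_Mapping.keys f. (\<nu>, \<mu>) \<in> R"
    using assms by auto
  then have "lead R f = \<mu>" by (intro lead_eqI) auto
  then show "lead R f \<in> Poly_Mapping.keys f" "\<And>\<nu>. \<nu> \<in> Poly_Mapping.keys f \<Longrightarrow> (\<nu>, lead R f) \<in> R"
    using \<mu> by auto
qed

text \<open>By injectivity no terms cancel, and by monotonicity the image of the leading monomial
  stays the largest.\<close>

lemma lead_poly_shift:
  assumes "f \<noteq> 0" "Poly_Mapping.keys f \<subseteq> NF Xs" "set zs \<subseteq> Xs" "set ys \<subseteq> Xs"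
  shows "lead R (poly_shift Xs zs ys f) = nf_shift zs ys (lead R f)"
    and "nf_shift zs ys (lead R f) \<in> Poly_Mapping.keys (poly_shift Xs zs ys f)"
proof -
  note l = lead_maximal[OF assms(1,2)]
  show k: "nf_shift zs ys (lead R f) \<in> Poly_Mapping.keys (poly_shift Xs zs ys f)"
    using lookup_poly_shift[OF inj_on_nf_shift[OF assms(3,4)] assms(2), of "lead R f" Xs] l(1) assms(2)
    by (auto simp: in_keys_iff)
  show "lead R (poly_shift Xs zs ys f) = nf_shift zs ys (lead R f)"
  proof (rule lead_eqI[OF k])
    fix \<nu> assume "\<nu> \<in> Poly_Mapping.keys (poly_shift Xs zs ys f)"
    then obtain \<nu>' where n: "\<nu> = nf_shift zs ys \<nu>'" "\<nu>' \<in> Poly_Mapping.keys f" using keys_poly_shift by blast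
    show "(\<nu>, nf_shift zs ys (lead R f)) \<in> R"
    proof (cases "\<nu>' = lead R f")
      case True
      then show ?thesis using n l(1) assms by (auto intro!: R_refl nf_shift_NF)
    next
      case False
      then show ?thesis using less_nf_shift[of \<nu>' "lead R f" zs ys] l(2) n assms by auto
    qed
  qed
qed

text \<open>A strictly monotone map never moves an element of a well order down: otherwise
  \<open>\<mu>\<close>, \<open>f \<mu>\<close>, \<open>f (f \<mu>)\<close> and so on would descend
  forever.\<close>

lemma less_mult_self:
  assumes mono: "\<And>\<mu> \<nu>. \<mu> \<lhd>\<^sub>R \<nu> \<Longrightarrow> f \<mu> \<lhd>\<^sub>R f \<nu>" and "\<And>\<mu>. \<mu> \<in> NF Xs \<Longrightarrow> f \<mu> \<in> NF Xs"
    and "\<mu> \<in> NF Xs" "f \<mu> \<noteq> \<mu>"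
  shows "\<mu> \<lhd>\<^sub>R f \<mu>"
proof -
  have "\<not> f \<mu> \<lhd>\<^sub>R \<mu>"
  proof (induction \<mu> rule: wf_induct_rule[OF R_wf])
    case (1 \<mu>)
    show ?case using 1[of "f \<mu>"] mono[of "f \<mu>" \<mu>] by blast
  qed
  then show ?thesis using less_linear[OF assms(3) assms(2)[OF assms(3)]] assms(4) by auto
qed

section \<open>The cone of exponent differences\<close>

definition order_cone :: "('x \<times> bool \<Rightarrow> int) set" where
  "order_cone = {\<lambda>i. int (expo (Mon u' v') i) - int (expo (Mon u v) i) | u v u' v'. Mon u v \<lhd>\<^sub>R Mon u' v'}"

lemma order_coneI:
  "\<mu> \<lhd>\<^sub>R \<nu> \<Longrightarrow> \<mu> = Mon u v \<Longrightarrow> \<nu> = Mon u' v' \<Longrightarrow> (\<lambda>i. int (expo \<nu> i) - int (expo \<mu> i)) \<in> order_cone"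
  unfolding order_cone_def by blast

text \<open>Two inequalities between brackets multiply: replace first the left factor and then the
  right one by the larger bracket. Exponent vectors of brackets add under multiplication.\<close>

lemma order_cone_add:
  assumes "a \<in> order_cone" "b \<in> order_cone"
  shows "(\<lambda>i. a i + b i) \<in> order_cone"
proof -
  obtain u v u' v' where a: "a = (\<lambda>i. int (expo (Mon u' v') i) - int (expo (Mon u v) i))"
      "Mon u v \<lhd>\<^sub>R Mon u' v'" using assms(1) unfolding order_cone_def by auto
  obtain p q p' q' where b: "b = (\<lambda>i. int (expo (Mon p' q') i) - int (expo (Mon p q) i))"
      "Mon p q \<lhd>\<^sub>R Mon p' q'" using assms(2) unfolding order_cone_def by auto
  have "nf_mult (Mon u v) (Mon p q) \<lhd>\<^sub>R nf_mult (Mon u' v') (Mon p q)"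
    using less_mult(1)[OF a(2)] R_NF b(2) by blast
  moreover have "nf_mult (Mon u' v') (Mon p q) \<lhd>\<^sub>R nf_mult (Mon u' v') (Mon p' q')"
    using less_mult(2)[OF b(2)] R_NF a(2) by blast
  ultimately have "nf_mult (Mon u v) (Mon p q) \<lhd>\<^sub>R nf_mult (Mon u' v') (Mon p' q')"
    by (rule less_trans)
  from order_coneI[OF this nf_mult.simps(4) nf_mult.simps(4)]
  have "(\<lambda>i. int (expo (Mon (u' + p') (v' + q')) i) - int (expo (Mon (u + p) (v + q)) i)) \<in> order_cone"
    by simp
  also have "(\<lambda>i. int (expo (Mon (u' + p') (v' + q')) i) - int (expo (Mon (u + p) (v + q)) i)) =
      (\<lambda>i. a i + b i)"
    by (auto simp: a b)
  finally show ?thesis .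
qed

text \<open>A bracket is determined by its exponent vector, and the order is strict.\<close>

lemma order_cone_zero: "(\<lambda>i. 0) \<notin> order_cone"
proof
  assume "(\<lambda>i. 0) \<in> order_cone"
  then obtain u v u' v' where eq: "(\<lambda>i. 0) = (\<lambda>i. int (expo (Mon u' v') i) - int (expo (Mon u v) i))"
      and less: "Mon u v \<lhd>\<^sub>R Mon u' v'" unfolding order_cone_def by auto
  have "count u x = count u' x" "count v x = count v' x" for x
    using fun_cong[OF eq, of "(x, False)"] fun_cong[OF eq, of "(x, True)"] by simp_all
  then have "u = u'" "v = v'" by (auto intro: multiset_eqI)
  with less show False by simp
qed

text \<open>Multiplication by \<open>x\<close> on one side increases \<open>[x;x]\<close> in the
  well order. Starting from a bracket makes the difference of exponents exactly a unit vector. These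
  vectors later force all weights to be positive.\<close>

lemma order_cone_unit:
  assumes "x \<in> Xs"
  shows "(\<lambda>i. if i = (x, b) then 1 else 0) \<in> order_cone"
proof -
  let ?\<mu> = "Mon {#x#} {#x#}"
  have n: "?\<mu> \<in> NF Xs" using assms by (simp add: NF_def)
  show ?thesis
  proof (cases b)
    case True
    have "?\<mu> \<lhd>\<^sub>R nf_mult ?\<mu> (Gen x)"
      by (rule less_mult_self[where f = "\<lambda>\<mu>. nf_mult \<mu> (Gen x)"])
         (use assms n in \<open>auto intro!: less_mult(1)[simplified] nf_mult_NF Gen_NF\<close>)
    from order_coneI[OF this] show ?thesis
      by (auto simp: fun_eq_iff True elim!: back_subst[of "\<lambda>f. f \<in> order_cone"])
  next
    case False
    have "?\<mu> \<lhd>\<^sub>R nf_mult (Gen x) ?\<mu>"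
      by (rule less_mult_self[where f = "\<lambda>\<mu>. nf_mult (Gen x) \<mu>"])
         (use assms n in \<open>auto intro!: less_mult(2)[simplified] nf_mult_NF Gen_NF\<close>)
    from order_coneI[OF this] show ?thesis
      by (auto simp: fun_eq_iff False elim!: back_subst[of "\<lambda>f. f \<in> order_cone"])
  qed
qed

end

section \<open>Reduction modulo a Groebner-Shirshov basis\<close>

lemma BC_algebra: "nonassoc_algebra (BC Xs)"
  using BC_bicommutative by (rule bicommutative_algebra.axioms(1))

lemma submodule_BC:
  assumes "submodule W scalars (BC Xs)"
  shows "pm.subspace W" "W \<subseteq> {f. Poly_Mapping.keys f \<subseteq> NF Xs}"
proof -
  interpret BC: nonassoc_algebra "BC Xs" by (rule BC_algebra)
  show "pm.subspace W"
    unfolding pm.subspace_def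
    using BC.submoduleE(4,5)[OF assms] subgroup.one_closed[of W "add_monoid (BC Xs)"] assms
    by (auto simp: submodule_def)
  show "W \<subseteq> {f. Poly_Mapping.keys f \<subseteq> NF Xs}"
    using submodule_carrier[OF assms] by simp
qed

lemma ideal_poly_shift:
  assumes I: "alg_ideal (BC Xs) I" and "f \<in> I" "set zs \<subseteq> Xs" "set ys \<subseteq> Xs"
  shows "poly_shift Xs zs ys f \<in> I"
proof -
  have g: "gen x \<in> carrier (BC Xs)" if "x \<in> Xs" for x using that by (simp add: gen_def NF_def)
  have "left_normed (BC Xs) f (map gen ys) \<in> I"
    using assms(2,4) unfolding left_normed_def
  proof (induction ys arbitrary: f)
    case (Cons y ys)
    have "f \<otimes>\<^bsub>BC Xs\<^esub> gen y \<in> I" using I Cons.prems g[of y] unfolding alg_ideal_def by auto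
    then show ?case using Cons by simp
  qed simp
  then show ?thesis
    using assms(3) unfolding poly_shift_def right_normed_def
  proof (induction zs)
    case (Cons z zs)
    then show ?case using I g[of z] unfolding alg_ideal_def by auto
  qed simp
qed

lemma NF_length_pos: "\<mu> \<in> NF Xs \<Longrightarrow> 1 \<le> nf_length \<mu>"
  by (auto simp: NF_def Suc_le_eq nonempty_has_size)

lemma NF_MonD: "Mon u v \<in> NF Xs \<Longrightarrow> u \<noteq> {#} \<and> v \<noteq> {#} \<and> set_mset u \<subseteq> Xs \<and> set_mset v \<subseteq> Xs"
  by (auto simp: NF_def)

lemma expo_outside: "\<mu> \<in> NF Xs \<Longrightarrow> i \<notin> Xs \<times> UNIV \<Longrightarrow> expo \<mu> i = 0"
  by (cases \<mu>; cases i) (auto dest!: NF_MonD simp: count_eq_zero_iff)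

lemma nf_length_expo:
  assumes "finite Xs" "Mon u v \<in> NF Xs"
  shows "nf_length (Mon u v) = (\<Sum>i\<in>Xs \<times> UNIV. expo (Mon u v) i)"
proof -
  have "size u = (\<Sum>x\<in>Xs. count u x)" "size v = (\<Sum>x\<in>Xs. count v x)"
    using NF_MonD[OF assms(2)] assms(1)
    by (auto simp: size_multiset_overloaded_eq count_eq_zero_iff intro!: sum.mono_neutral_left)
  moreover have "(\<Sum>i\<in>Xs \<times> UNIV. expo (Mon u v) i) = (\<Sum>x\<in>Xs. \<Sum>b\<in>UNIV. expo (Mon u v) (x, b))"
    by (simp add: sum.cartesian_product)
  ultimately show ?thesis by (simp add: UNIV_bool sum.distrib)
qed

locale gs_setting = nf_order Xs R for Xs :: "'x set" and R +
  fixes S :: "('x nf \<Rightarrow>\<^sub>0 'k::field) set"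
  assumes fin_X: "finite Xs" and fin_S: "finite S" and gs: "GS_basis Xs R S"
begin

abbreviation "IdS \<equiv> gen_ideal (BC Xs) S"
abbreviation "irr \<equiv> Irr Xs R S"

lemma S_D:
  assumes "s \<in> S"
  shows "s \<noteq> 0" "Poly_Mapping.keys s \<subseteq> NF Xs" "lead R s \<in> Poly_Mapping.keys s" "lead R s \<in> NF Xs"
    "\<And>\<nu>. \<nu> \<in> Poly_Mapping.keys s \<Longrightarrow> (\<nu>, lead R s) \<in> R"
proof -
  show 1: "s \<noteq> 0" "Poly_Mapping.keys s \<subseteq> NF Xs"
    using assms gs by (auto simp: GS_basis_def monic_set_def)
  then show "lead R s \<in> Poly_Mapping.keys s" "\<And>\<nu>. \<nu> \<in> Poly_Mapping.keys s \<Longrightarrow> (\<nu>, lead R s) \<in> R"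
    by (rule lead_maximal)+
  then show "lead R s \<in> NF Xs" using 1 by blast
qed

lemma ideal_IdS: "alg_ideal (BC Xs) IdS" and S_IdS: "S \<subseteq> IdS"
  using gen_ideal_ideal[OF BC_algebra, of S Xs] gs unfolding GS_basis_def by blast+

lemma IdS_subspace: "pm.subspace IdS" and IdS_NF: "IdS \<subseteq> {f. Poly_Mapping.keys f \<subseteq> NF Xs}"
  using submodule_BC ideal_IdS unfolding alg_ideal_def by blast+

text \<open>The elements of \<open>S\<close> themselves are empty shifts. A letter has length 1, so
  the length condition in the definition leaves only brackets as leading monomials of properly
  shifted elements.\<close>

lemma normal_S_polysE:
  assumes "h \<in> normal_S_polys Xs R S"
  obtains s zs ys where "s \<in> S" "set zs \<subseteq> Xs" "set ys \<subseteq> Xs" "h = poly_shift Xs zs ys s"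
    "zs = [] \<and> ys = [] \<or> (\<exists>p q. lead R s = Mon p q)"
proof -
  consider "h \<in> S" | s zs ys where "h = poly_shift Xs zs ys s" "s \<in> S" "2 \<le> nf_length (lead R s)"
    "set zs \<subseteq> Xs" "set ys \<subseteq> Xs"
    using assms unfolding normal_S_polys_def poly_shift_def by blast
  then show thesis
  proof cases
    case 1
    then show thesis
      by (intro that[of h "[]" "[]"]) (auto simp: poly_shift_def left_normed_def right_normed_def)
  next
    case (2 s zs ys)
    moreover have "\<exists>p q. lead R s = Mon p q" using 2(3) by (cases "lead R s") auto
    ultimately show thesis using that by blast
  qed
qed

lemma normal_S_polys_lead:
  assumes "h \<in> normal_S_polys Xs R S"
  shows "lead R h \<in> Poly_Mapping.keys h" "h \<in> IdS"
    "\<And>\<nu>. \<nu> \<in> Poly_Mapping.keys h \<Longrightarrow> (\<nu>, lead R h) \<in> R"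
proof -
  obtain s zs ys where s: "s \<in> S" "set zs \<subseteq> Xs" "set ys \<subseteq> Xs" "h = poly_shift Xs zs ys s"
    using normal_S_polysE[OF assms] by metis
  show l: "lead R h \<in> Poly_Mapping.keys h" using lead_poly_shift[OF S_D(1,2)[OF s(1)] s(2,3)] s(4) by simp
  show h: "h \<in> IdS" using ideal_poly_shift[OF ideal_IdS _ s(2,3)] S_IdS s(1,4) by blast
  show "\<And>\<nu>. \<nu> \<in> Poly_Mapping.keys h \<Longrightarrow> (\<nu>, lead R h) \<in> R"
    using h IdS_NF l by (intro lead_maximal(2)) auto
qed

text \<open>Elements of \<open>S\<close> led by a letter drop out: their only normal S-polynomial is
  the element itself, which has that letter as leading monomial. When a leading bracket divides, the
  quotient words \<open>u - p\<close> and \<open>v - q\<close> provide the shift.\<close>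

lemma Irr_Mon_iff:
  assumes "Mon u v \<in> NF Xs"
  shows "Mon u v \<in> irr \<longleftrightarrow> (\<forall>s\<in>S. \<forall>p q. lead R s = Mon p q \<longrightarrow> \<not> (p \<subseteq># u \<and> q \<subseteq># v))"
proof -
  have "(\<exists>s\<in>S. \<exists>p q. lead R s = Mon p q \<and> p \<subseteq># u \<and> q \<subseteq># v)"
    if h: "Mon u v = lead R h" "h \<in> normal_S_polys Xs R S" for h
  proof -
    obtain s zs ys where s: "s \<in> S" "set zs \<subseteq> Xs" "set ys \<subseteq> Xs" "h = poly_shift Xs zs ys s"
      "zs = [] \<and> ys = [] \<or> (\<exists>p q. lead R s = Mon p q)"
      using normal_S_polysE[OF h(2)] by metis
    have "Mon u v = nf_shift zs ys (lead R s)"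
      using lead_poly_shift(1)[OF S_D(1,2)[OF s(1)] s(2,3)] s(4) h(1) by simp
    then have "\<exists>p q. lead R s = Mon p q \<and> p \<subseteq># u \<and> q \<subseteq># v"
      using s(5) by (cases "lead R s") (auto simp: nf_shift_Mon)
    then show ?thesis using s(1) by blast
  qed
  moreover have "Mon u v \<in> lead R ` normal_S_polys Xs R S"
    if s: "s \<in> S" "lead R s = Mon p q" "p \<subseteq># u" "q \<subseteq># v" for s p q
  proof -
    obtain zs ys where zy: "mset zs = u - p" "mset ys = v - q" by (metis ex_mset)
    then have sub: "set zs \<subseteq> Xs" "set ys \<subseteq> Xs"
      using NF_MonD[OF assms] in_diffD by (metis set_mset_mset subset_eq)+
    have "2 \<le> nf_length (lead R s)"
      using NF_MonD[of p q Xs] S_D(4)[OF s(1)] s(2) by (auto simp: nonempty_has_size)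
    then have "poly_shift Xs zs ys s \<in> normal_S_polys Xs R S"
      using s(1) sub unfolding normal_S_polys_def poly_shift_def by blast
    moreover have "lead R (poly_shift Xs zs ys s) = Mon u v"
      using lead_poly_shift(1)[OF S_D(1,2)[OF s(1)] sub] s zy by (simp add: nf_shift_Mon subset_mset.add_diff_inverse)
    ultimately show ?thesis by (metis imageI)
  qed
  ultimately show ?thesis using assms unfolding Irr_def by blast
qed

lemma irr_NF: "irr \<subseteq> NF Xs"
  by (auto simp: Irr_def)

text \<open>Linear independence of the irreducible normal forms modulo the ideal.\<close>

lemma IdS_irr_zero:
  assumes "g \<in> IdS" "Poly_Mapping.keys g \<subseteq> irr"
  shows "g = 0"
proof (rule ccontr)
  assume "g \<noteq> 0"
  then have "lead R g \<in> Poly_Mapping.keys g" using assms IdS_NF by (intro lead_maximal(1)) auto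
  moreover have "lead R g \<in> lead R ` normal_S_polys Xs R S"
    using gs assms(1) \<open>g \<noteq> 0\<close> by (auto simp: GS_basis_def)
  ultimately show False using assms(2) by (auto simp: Irr_def)
qed

section \<open>Weights that control reduction\<close>

definition wt :: "('x \<times> bool \<Rightarrow> real) \<Rightarrow> 'x nf \<Rightarrow> real" where
  "wt \<omega> \<mu> = (\<Sum>i\<in>Xs \<times> UNIV. \<omega> i * real (expo \<mu> i))"

lemma wt_Gen [simp]: "wt \<omega> (Gen x) = 0"
  by (simp add: wt_def)

lemma wt_nf_shift_Mon: "wt \<omega> (nf_shift zs ys (Mon u v)) = wt \<omega> (Mon u v) + wt \<omega> (Mon (mset zs) (mset ys))"
proof -
  have "expo (nf_shift zs ys (Mon u v)) i = expo (Mon u v) i + expo (Mon (mset zs) (mset ys)) i" for i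
    by (cases i) (simp add: nf_shift_Mon)
  then show ?thesis by (simp add: wt_def distrib_left sum.distrib)
qed

lemma wt_nonneg: "(\<And>i. i \<in> Xs \<times> UNIV \<Longrightarrow> 0 < \<omega> i) \<Longrightarrow> 0 \<le> wt \<omega> \<mu>"
  unfolding wt_def by (intro sum_nonneg mult_nonneg_nonneg) (auto intro: less_imp_le)

text \<open>Exponent differences make sense between brackets only, and \<open>\<nu>\<close> may be a
  letter. So one factor \<open>z\<close> is first put on the right (\<open>D1\<close>) or on the
  left (\<open>D2\<close>); all further factors add the same weight to both sides, so finitely many
  differences suffice for all shifts.\<close>

lemma compatible_weight_exists:
  obtains \<omega> where "\<And>i. i \<in> Xs \<times> UNIV \<Longrightarrow> 0 < \<omega> i"
    "\<And>s \<nu> zs ys p q. \<lbrakk>s \<in> S; \<nu> \<in> Poly_Mapping.keys s; set zs \<subseteq> Xs; set ys \<subseteq> Xs; lead R s = Mon p q\<rbrakk> \<Longrightarrow>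
        wt \<omega> (nf_shift zs ys \<nu>) \<le> wt \<omega> (nf_shift zs ys (lead R s))"
proof -
  let ?I = "Xs \<times> (UNIV :: bool set)"
  define diff where "diff \<mu> \<nu> = (\<lambda>i. int (expo \<nu> i) - int (expo \<mu> i))" for \<mu> \<nu> :: "'x nf"
  define U where "U = (\<lambda>j i. if i = j then 1 else 0 :: int) ` ?I"
  define T where "T = (SIGMA s:S. (Poly_Mapping.keys s - {lead R s}) \<times> Xs)"
  define D1 where "D1 = (\<lambda>(s, \<nu>, z). diff (nf_mult \<nu> (Gen z)) (nf_mult (lead R s) (Gen z))) ` T"
  define D2 where "D2 = (\<lambda>(s, \<nu>, z). diff (nf_mult (Gen z) \<nu>) (nf_mult (Gen z) (lead R s))) ` T"
  have fin: "finite (U \<union> D1 \<union> D2)"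
    unfolding U_def D1_def D2_def T_def using fin_X fin_S by auto
  have inT: "\<nu> \<lhd>\<^sub>R lead R s \<and> Gen z \<in> NF Xs \<and> \<nu> \<in> NF Xs \<and> lead R s \<in> NF Xs" if "(s, \<nu>, z) \<in> T" for s \<nu> z
    using that S_D[of s] by (auto simp: T_def Gen_NF)
  have cone: "diff \<mu> \<nu> \<in> order_cone" if "\<mu> \<lhd>\<^sub>R \<nu>" "\<mu> = nf_mult a b" "\<nu> = nf_mult c d" for \<mu> \<nu> a b c d
    using order_coneI[OF that(1)] nf_mult_is_Mon[of a b] nf_mult_is_Mon[of c d] that(2,3)
    unfolding diff_def by metis
  have "U \<subseteq> order_cone" unfolding U_def using order_cone_unit by auto
  moreover have "D1 \<subseteq> order_cone" "D2 \<subseteq> order_cone"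
    unfolding D1_def D2_def using inT less_mult by (fastforce intro!: cone)+
  ultimately have cone_sub: "U \<union> D1 \<union> D2 \<subseteq> order_cone" by blast
  have diff0: "diff \<mu> \<nu> i = 0" if "\<mu> \<in> NF Xs" "\<nu> \<in> NF Xs" "i \<notin> ?I" for \<mu> \<nu> i
    using expo_outside[OF that(1,3)] expo_outside[OF that(2,3)] by (simp add: diff_def)
  have supp: "d i = 0" if d: "d \<in> U \<union> D1 \<union> D2" and i: "i \<notin> ?I" for d i
  proof -
    consider "d \<in> U" | s \<nu> z where "(s, \<nu>, z) \<in> T" "d = diff (nf_mult \<nu> (Gen z)) (nf_mult (lead R s) (Gen z))"
      | s \<nu> z where "(s, \<nu>, z) \<in> T" "d = diff (nf_mult (Gen z) \<nu>) (nf_mult (Gen z) (lead R s))"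
      using d unfolding D1_def D2_def by auto
    then show ?thesis
    proof cases
      case 1 then show ?thesis using i by (auto simp: U_def)
    next
      case 2 then show ?thesis using inT[OF 2(1)] diff0[OF _ _ i] nf_mult_NF by metis
    next
      case 3 then show ?thesis using inT[OF 3(1)] diff0[OF _ _ i] nf_mult_NF by metis
    qed
  qed
  have "\<exists>w. \<forall>d\<in>U \<union> D1 \<union> D2. 0 < (\<Sum>i\<in>?I. w i * real_of_int (d i))"
  proof (rule positive_functional_exists[where P = order_cone])
    show "finite ?I" using fin_X by simp
    show "(\<lambda>i. a i + b i) \<in> order_cone" if "a \<in> order_cone" "b \<in> order_cone" for a b
      using that by (rule order_cone_add)
  qed (rule fin cone_sub order_cone_zero | erule (1) supp)+
  then obtain w where w: "\<forall>d\<in>U \<union> D1 \<union> D2. 0 < (\<Sum>i\<in>?I. w i * real_of_int (d i))" ..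
  have wdiff: "(\<Sum>i\<in>?I. w i * real_of_int (diff \<mu> \<nu> i)) = wt w \<nu> - wt w \<mu>" for \<mu> \<nu>
    by (simp add: wt_def diff_def right_diff_distrib sum_subtractf)
  show thesis
  proof (rule that[of w])
    show pos: "0 < w j" if "j \<in> ?I" for j
    proof -
      have "0 < (\<Sum>i\<in>?I. w i * real_of_int (if i = j then 1 else 0))"
        using that by (intro bspec[OF w]) (simp add: U_def)
      also have "\<dots> = (\<Sum>i\<in>?I. if i = j then w i else 0)" by (rule sum.cong) auto
      also have "\<dots> = w j" using that fin_X by (simp del: mem_Times_iff)
      finally show ?thesis .
    qed
    fix s \<nu> zs ys p q
    assume s: "s \<in> S" and \<nu>: "\<nu> \<in> Poly_Mapping.keys s" and sub: "set zs \<subseteq> Xs" "set ys \<subseteq> Xs"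
      and l: "lead R s = Mon p q"
    have R: "wt w (nf_mult \<nu> (Gen z)) \<le> wt w (nf_mult (lead R s) (Gen z))" if "z \<in> Xs" for z
    proof (cases "\<nu> = lead R s")
      case False
      then have "(s, \<nu>, z) \<in> T" using that s \<nu> by (simp add: T_def)
      then have "diff (nf_mult \<nu> (Gen z)) (nf_mult (lead R s) (Gen z)) \<in> D1" unfolding D1_def by force
      then have "0 < wt w (nf_mult (lead R s) (Gen z)) - wt w (nf_mult \<nu> (Gen z))"
        unfolding wdiff[symmetric] by (intro bspec[OF w]) simp
      then show ?thesis by simp
    qed simp
    have L: "wt w (nf_mult (Gen z) \<nu>) \<le> wt w (nf_mult (Gen z) (lead R s))" if "z \<in> Xs" for z
    proof (cases "\<nu> = lead R s")
      case False
      then have "(s, \<nu>, z) \<in> T" using that s \<nu> by (simp add: T_def)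
      then have "diff (nf_mult (Gen z) \<nu>) (nf_mult (Gen z) (lead R s)) \<in> D2" unfolding D2_def by force
      then have "0 < wt w (nf_mult (Gen z) (lead R s)) - wt w (nf_mult (Gen z) \<nu>)"
        unfolding wdiff[symmetric] by (intro bspec[OF w]) simp
      then show ?thesis by simp
    qed simp
    have shift: "wt w (nf_shift zs ys (nf_mult a b)) \<le> wt w (nf_shift zs ys (nf_mult c d))"
      if "wt w (nf_mult a b) \<le> wt w (nf_mult c d)" for zs ys a b c d
      using that nf_mult_is_Mon[of a b] nf_mult_is_Mon[of c d] by (auto simp: wt_nf_shift_Mon)
    show "wt w (nf_shift zs ys \<nu>) \<le> wt w (nf_shift zs ys (lead R s))"
    proof (cases ys)
      case (Cons y yt)
      then show ?thesis using shift[OF R[of y]] sub by (simp add: nf_shift_Cons_right)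
    next
      case Nil
      show ?thesis
      proof (cases zs rule: rev_cases)
        case (snoc zt z)
        then show ?thesis using shift[OF L[of z]] sub Nil by (simp add: nf_shift_snoc_left)
      next
        case zs: Nil
        show ?thesis
        proof (cases \<nu>)
          case (Gen x)
          then show ?thesis using Nil zs wt_nonneg[OF pos] by simp
        next
          case (Mon u v)
          \<comment> \<open>Both monomials are brackets here, so an extra factor \<open>z\<close>
            adds the same weight to both and can be cancelled from the comparison.\<close>
          then obtain z where z: "z \<in> Xs" using NF_MonD[of u v] S_D(2)[OF s] \<nu> by fastforce
          have shift1: "nf_mult (Mon u v) (Gen z) = nf_shift [] [z] (Mon u v)" for u v by (simp add: nf_shift_def)
          show ?thesis using R[OF z] by (simp add: Mon l Nil zs shift1 wt_nf_shift_Mon del: nf_mult.simps)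
        qed
      qed
    qed
  qed
qed

text \<open>Termination comes from the well order \<open>R\<close>, the size bound from the weight.
  A step led by a bracket does not raise the weight; a step led by a letter uses an unshifted
  element of \<open>S\<close>, whose monomials weigh at most \<open>T0\<close>. Hence the maximum in
  the hypothesis.\<close>

lemma reduction_weight:
  assumes pos: "\<And>i. i \<in> Xs \<times> UNIV \<Longrightarrow> 0 < \<omega> i"
    and mono: "\<And>s \<nu> zs ys p q. \<lbrakk>s \<in> S; \<nu> \<in> Poly_Mapping.keys s; set zs \<subseteq> Xs; set ys \<subseteq> Xs; lead R s = Mon p q\<rbrakk> \<Longrightarrow>
        wt \<omega> (nf_shift zs ys \<nu>) \<le> wt \<omega> (nf_shift zs ys (lead R s))"
    and T0: "\<And>s \<nu>. s \<in> S \<Longrightarrow> \<nu> \<in> Poly_Mapping.keys s \<Longrightarrow> wt \<omega> \<nu> \<le> T0"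
    and \<mu>: "\<mu> \<in> NF Xs" "max (wt \<omega> \<mu>) T0 \<le> T"
  shows "Poly_Mapping.single \<mu> 1 \<in> {x + y |x y. x \<in> IdS \<and> y \<in> {g. Poly_Mapping.keys g \<subseteq> {\<nu>\<in>irr. wt \<omega> \<nu> \<le> T}}}"
proof -
  let ?J = "{x + y |x y. x \<in> IdS \<and> y \<in> {g. Poly_Mapping.keys g \<subseteq> {\<nu>\<in>irr. wt \<omega> \<nu> \<le> T}}}"
  have J: "pm.subspace ?J" by (rule pm.subspace_sums[OF IdS_subspace keys_subspace])
  show ?thesis
    using \<mu>
  proof (induction \<mu> rule: wf_induct_rule[OF R_wf])
    case (1 \<mu>)
    show ?case
    proof (cases "\<mu> \<in> irr")
      case True
      then have "Poly_Mapping.single \<mu> (1::'k) = 0 + Poly_Mapping.single \<mu> 1 \<and> 0 \<in> IdS \<and>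
          Poly_Mapping.single \<mu> (1::'k) \<in> {g. Poly_Mapping.keys g \<subseteq> {\<nu>\<in>irr. wt \<omega> \<nu> \<le> T}}"
        using 1(3) pm.subspace_0[OF IdS_subspace] by simp
      then show ?thesis by blast
    next
      case False
      then obtain h where h: "h \<in> normal_S_polys Xs R S" "\<mu> = lead R h" using 1(2) by (auto simp: Irr_def)
      note hl = normal_S_polys_lead[OF h(1), folded h(2)]
      obtain s zs ys where s: "s \<in> S" "set zs \<subseteq> Xs" "set ys \<subseteq> Xs" "h = poly_shift Xs zs ys s"
        "zs = [] \<and> ys = [] \<or> (\<exists>p q. lead R s = Mon p q)"
        using normal_S_polysE[OF h(1)] by metis
      have tail: "max (wt \<omega> \<nu>) T0 \<le> T" if \<nu>: "\<nu> \<in> Poly_Mapping.keys h" for \<nu>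
      proof -
        obtain \<nu>' where n: "\<nu>' \<in> Poly_Mapping.keys s" "\<nu> = nf_shift zs ys \<nu>'"
          using \<nu> keys_poly_shift s(4) by blast
        have lh: "\<mu> = nf_shift zs ys (lead R s)"
          using lead_poly_shift(1)[OF S_D(1,2)[OF s(1)] s(2,3)] s(4) h(2) by simp
        show ?thesis
        proof (cases "\<exists>p q. lead R s = Mon p q")
          case True
          then have "wt \<omega> \<nu> \<le> wt \<omega> \<mu>" using mono[OF s(1) n(1) s(2,3)] n(2) lh by blast
          then show ?thesis using 1(3) by simp
        next
          case False
          then have "wt \<omega> \<nu> \<le> T0" using s(5) n T0[OF s(1) n(1)] by simp
          then show ?thesis using 1(3) by simp
        qed
      qed
      define a where "a = Poly_Mapping.lookup h \<mu>"
      have a: "a \<noteq> 0" using hl(1) by (simp add: a_def in_keys_iff)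
      \<comment> \<open>\<open>h\<close> is solved for its leading term; the rest \<open>?s\<close>
        consists of \<open>R\<close>-smaller monomials, to which the induction hypothesis
        applies.\<close>
      let ?s = "\<Sum>\<nu>\<in>Poly_Mapping.keys h - {\<mu>}. pm_scale (Poly_Mapping.lookup h \<nu>) (Poly_Mapping.single \<nu> 1)"
      have "pm_scale a (Poly_Mapping.single \<mu> 1) + ?s =
          (\<Sum>\<nu>\<in>Poly_Mapping.keys h. Poly_Mapping.single \<nu> (Poly_Mapping.lookup h \<nu>))"
        by (subst sum.remove[OF finite_keys hl(1)]) (simp add: map_scale_single a_def)
      also have "\<dots> = h" by (rule pm_decomp[symmetric])
      finally have "h - ?s = pm_scale a (Poly_Mapping.single \<mu> 1)"
        by (intro diff_eq_eq[THEN iffD2]) (rule sym)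
      then have "pm_scale (1 / a) (h - ?s) = pm_scale (1 / a) (pm_scale a (Poly_Mapping.single \<mu> 1))"
        by (rule arg_cong)
      also have "\<dots> = Poly_Mapping.single \<mu> 1" using a by (simp add: map_scale_single)
      finally have eq: "Poly_Mapping.single \<mu> 1 = pm_scale (1 / a) (h - ?s)" by simp
      have "h = h + 0 \<and> h \<in> IdS \<and> 0 \<in> {g. Poly_Mapping.keys g \<subseteq> {\<nu>\<in>irr. wt \<omega> \<nu> \<le> T}}"
        using hl(2) by simp
      then have "h \<in> ?J" by blast
      moreover have "Poly_Mapping.single \<nu> 1 \<in> ?J" if "\<nu> \<in> Poly_Mapping.keys h - {\<mu>}" for \<nu>
        using that hl(3)[of \<nu>] IdS_NF hl(2) tail by (intro 1(1)) auto
      then have "?s \<in> ?J" using J by (intro pm.subspace_sum pm.subspace_scale)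
      ultimately show ?thesis unfolding eq using J by (intro pm.subspace_scale pm.subspace_diff)
    qed
  qed
qed

text \<open>Positive weights are comparable with length on brackets, which turns the weight bound
  into a length bound. It matters that \<open>C\<close> is uniform in \<open>f\<close> and
  \<open>m\<close>: a linear change of scale does not affect the exponent of growth.\<close>

lemma normal_form_exists:
  "\<exists>C::nat. \<forall>f m. Poly_Mapping.keys f \<subseteq> {\<mu> \<in> NF Xs. nf_length \<mu> \<le> m} \<longrightarrow>
     (\<exists>g. Poly_Mapping.keys g \<subseteq> {\<mu> \<in> irr. nf_length \<mu> \<le> C * m} \<and> f - g \<in> IdS)"
proof -
  let ?I = "Xs \<times> (UNIV :: bool set)"
  obtain \<omega> where pos: "\<And>i. i \<in> Xs \<times> UNIV \<Longrightarrow> 0 < \<omega> i"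
    and mono: "\<And>s \<nu> zs ys p q. \<lbrakk>s \<in> S; \<nu> \<in> Poly_Mapping.keys s; set zs \<subseteq> Xs; set ys \<subseteq> Xs; lead R s = Mon p q\<rbrakk> \<Longrightarrow>
        wt \<omega> (nf_shift zs ys \<nu>) \<le> wt \<omega> (nf_shift zs ys (lead R s))"
    using compatible_weight_exists by metis
  have finI: "finite ?I" using fin_X by simp
  define T0 where "T0 = Max (insert 0 (\<Union>s\<in>S. wt \<omega> ` Poly_Mapping.keys s))"
  have T0: "wt \<omega> \<nu> \<le> T0" if "s \<in> S" "\<nu> \<in> Poly_Mapping.keys s" for s \<nu>
    unfolding T0_def using that fin_S by (intro Max_ge) auto
  have T0': "0 \<le> T0" unfolding T0_def using fin_S by (intro Max_ge) auto
  define c where "c = Min (insert 1 (\<omega> ` ?I))"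
  have c: "0 < c" "\<And>i. i \<in> ?I \<Longrightarrow> c \<le> \<omega> i"
    unfolding c_def using finI pos by (auto simp del: mem_Times_iff)
  define M where "M = (\<Sum>i\<in>?I. \<omega> i)"
  have M: "\<omega> i \<le> M" if "i \<in> ?I" for i
    unfolding M_def using that finI pos by (intro member_le_sum) (auto intro: less_imp_le)
  have M0: "0 \<le> M" unfolding M_def using pos by (intro sum_nonneg) (auto intro: less_imp_le)
  have lower: "c * real (nf_length (Mon u v)) \<le> wt \<omega> (Mon u v)" if "Mon u v \<in> NF Xs" for u v
    unfolding nf_length_expo[OF fin_X that] wt_def of_nat_sum sum_distrib_left
    using c by (intro sum_mono mult_right_mono) auto
  have upper: "wt \<omega> \<mu> \<le> M * real (nf_length \<mu>)" if "\<mu> \<in> NF Xs" for \<mu>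
  proof (cases \<mu>)
    case (Mon u v)
    show ?thesis
      unfolding Mon nf_length_expo[OF fin_X that[unfolded Mon]] wt_def of_nat_sum sum_distrib_left
      using M by (intro sum_mono mult_right_mono) auto
  qed (use M0 in simp)
  \<comment> \<open>The weight of a bracket lies between \<open>c\<close> and \<open>M\<close> times
    its length. \<open>Suc\<close> makes \<open>C\<close> at least 1, as letters require, since
    their weight 0 says nothing about their length 1.\<close>
  define C where "C = Suc (nat \<lceil>(M + T0) / c\<rceil>)"
  have C: "(M + T0) / c \<le> real C" unfolding C_def by linarith
  show ?thesis
  proof (rule exI[of _ C], intro allI impI)
    fix f :: "'x nf \<Rightarrow>\<^sub>0 'k" and m
    assume f: "Poly_Mapping.keys f \<subseteq> {\<mu> \<in> NF Xs. nf_length \<mu> \<le> m}"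
    show "\<exists>g. Poly_Mapping.keys g \<subseteq> {\<mu> \<in> irr. nf_length \<mu> \<le> C * m} \<and> f - g \<in> IdS"
    proof (cases "f = 0")
      case True
      then show ?thesis using pm.subspace_0[OF IdS_subspace] by (intro exI[of _ 0]) simp
    next
      case False
      then obtain \<mu>0 where "\<mu>0 \<in> Poly_Mapping.keys f" by fastforce
      \<comment> \<open>Normal forms have length at least 1, so a nonzero \<open>f\<close> forces
        \<open>1 \<le> m\<close>; this lets \<open>T0 * m\<close> absorb the additive constant
        \<open>T0\<close>.\<close>
      then have m1: "1 \<le> m" using f NF_length_pos[of \<mu>0 Xs] by fastforce
      let ?K = "{g :: 'x nf \<Rightarrow>\<^sub>0 'k. Poly_Mapping.keys g \<subseteq> {\<nu>\<in>irr. wt \<omega> \<nu> \<le> (M + T0) * real m}}"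
      let ?J = "{x + y |x y. x \<in> IdS \<and> y \<in> ?K}"
      have J: "pm.subspace ?J" by (rule pm.subspace_sums[OF IdS_subspace keys_subspace])
      have "Poly_Mapping.single \<mu> 1 \<in> ?J" if "\<mu> \<in> Poly_Mapping.keys f" for \<mu>
      proof -
        have n: "\<mu> \<in> NF Xs" "nf_length \<mu> \<le> m" using that f by auto
        have "wt \<omega> \<mu> \<le> M * real m"
          using upper[OF n(1)] mult_left_mono[OF of_nat_mono[OF n(2)] M0] by linarith
        moreover have "T0 \<le> T0 * real m" using mult_left_mono[of 1 "real m" T0] m1 T0' by simp
        moreover have "0 \<le> M * real m" using M0 by simp
        ultimately have "max (wt \<omega> \<mu>) T0 \<le> (M + T0) * real m" using T0' by (simp add: distrib_right)
        from reduction_weight[OF pos mono T0 n(1) this] show ?thesis by simp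
      qed
      then have "(\<Sum>\<mu>\<in>Poly_Mapping.keys f. pm_scale (Poly_Mapping.lookup f \<mu>) (Poly_Mapping.single \<mu> 1)) \<in> ?J"
        using J by (intro pm.subspace_sum pm.subspace_scale)
      then have "f \<in> ?J" by (simp add: map_scale_single flip: pm_decomp)
      then obtain x g where g: "f = x + g" "x \<in> IdS" "g \<in> ?K" by blast
      have "nf_length \<nu> \<le> C * m" if "\<nu> \<in> Poly_Mapping.keys g" for \<nu>
      proof (cases \<nu>)
        case (Gen x)
        then show ?thesis using m1 by (simp add: C_def)
      next
        case (Mon u v)
        have "c * real (nf_length \<nu>) \<le> (M + T0) * real m"
          using lower[of u v] that g(3) irr_NF Mon by force
        then have "real (nf_length \<nu>) \<le> (M + T0) / c * real m" using c(1) by (simp add: field_simps)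
        also have "\<dots> \<le> real C * real m" using C by (intro mult_right_mono) auto
        finally show ?thesis by (simp flip: of_nat_mult)
      qed
      then show ?thesis using g by (intro exI[of _ g]) auto
    qed
  qed
qed

end

section \<open>Counting irreducible normal forms\<close>

context gs_setting
begin

abbreviation "N \<equiv> N_of Xs R S"
abbreviation "I \<equiv> Xs \<times> (UNIV :: bool set)"

lemma finite_I: "finite I"
  using fin_X by simp

text \<open>The minimum in \<open>N_of\<close> exists because any number exceeding the lengths of
  all leading monomials qualifies. Its use is that exponents in leading brackets never exceed
  \<open>N\<close>.\<close>

lemma
  shows N_pos: "0 < N" and N_lead: "\<And>s p q i. s \<in> S \<Longrightarrow> lead R s = Mon p q \<Longrightarrow> expo (Mon p q) i \<le> N"
proof -
  let ?X = "\<lambda>n. repeat_mset n (mset_set Xs)"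
  have "0 < N \<and> (\<forall>s\<in>S. nf_dvd (lead R s) (Mon (?X N) (?X N)))"
  proof (cases "S = {}")
    case True
    then show ?thesis by (simp add: N_of_def)
  next
    case False
    have cnt: "count (?X n) x = (if x \<in> Xs then n else 0)" for n x
      using fin_X by (simp add: count_mset_set')
    define n where "n = Suc (\<Sum>s\<in>S. nf_length (lead R s))"
    have "nf_dvd (lead R s) (Mon (?X n) (?X n))" if "s \<in> S" for s
    proof (cases "lead R s")
      case (Gen x)
      then have "x \<in> Xs" using S_D(4)[OF that] by (auto simp: NF_def)
      then have "0 < count (?X n) x" unfolding cnt by (simp add: n_def)
      then show ?thesis by (simp only: Gen nf_dvd.simps count_greater_zero_iff simp_thms)
    next
      case (Mon p q)
      have len: "nf_length (lead R s) \<le> n"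
        using member_le_sum[of s S "\<lambda>s. nf_length (lead R s)"] that fin_S by (simp add: n_def)
      have sub: "set_mset p \<subseteq> Xs" "set_mset q \<subseteq> Xs"
        using NF_MonD[of p q Xs] S_D(4)[OF that] Mon by auto
      have "count p x \<le> count (?X n) x" for x
        using count_le_size[of p x] len sub(1) Mon cnt[of n x] by (auto simp: count_eq_zero_iff subset_iff)
      moreover have "count q x \<le> count (?X n) x" for x
        using count_le_size[of q x] len sub(2) Mon cnt[of n x] by (auto simp: count_eq_zero_iff subset_iff)
      ultimately show ?thesis by (simp add: Mon subseteq_mset_def)
    qed
    then have "\<exists>n. 0 < n \<and> (\<forall>s\<in>S. nf_dvd (lead R s) (Mon (?X n) (?X n)))"
      by (intro exI[of _ n]) (simp add: n_def)
    from LeastI_ex[OF this] False show ?thesis by (simp add: N_of_def)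
  qed
  then have dv: "\<And>s. s \<in> S \<Longrightarrow> nf_dvd (lead R s) (Mon (?X N) (?X N))" and pos: "0 < N" by auto
  show "0 < N" by (rule pos)
  fix s p q i assume s: "s \<in> S" "lead R s = Mon p q"
  have cnt: "count (?X N) x \<le> N" for x using fin_X by (simp add: count_mset_set')
  have "p \<subseteq># ?X N" "q \<subseteq># ?X N" using dv[OF s(1)] s(2) by auto
  then show "expo (Mon p q) i \<le> N"
    using cnt by (cases i) (auto simp: subseteq_mset_def intro: order.trans)
qed

text \<open>Leading brackets have exponents at most \<open>N\<close>, so divisibility by them only
  sees exponents cut off at \<open>N\<close>. This serves both to truncate a monomial and to raise
  exponents that already exceed \<open>N\<close>.\<close>

lemma irr_transfer:
  assumes "Mon u v \<in> irr" "Mon u' v' \<in> NF Xs" "\<And>i. min N (expo (Mon u' v') i) \<le> expo (Mon u v) i"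
  shows "Mon u' v' \<in> irr"
proof -
  have NF: "Mon u v \<in> NF Xs" using assms(1) irr_NF by blast
  have "p \<subseteq># u \<and> q \<subseteq># v" if s: "s \<in> S" "lead R s = Mon p q" "p \<subseteq># u'" "q \<subseteq># v'" for s p q
  proof -
    have "expo (Mon p q) i \<le> expo (Mon u' v') i" for i
      using s(3,4) by (cases i) (auto simp: subseteq_mset_def)
    then have "expo (Mon p q) i \<le> expo (Mon u v) i" for i
      using N_lead[OF s(1,2), of i] assms(3)[of i] by (meson min.boundedI order.trans)
    then have "expo (Mon p q) (x, b) \<le> expo (Mon u v) (x, b)" for x b .
    from this[of _ False] this[of _ True] show ?thesis by (simp add: subseteq_mset_def)
  qed
  then show ?thesis using assms(1) Irr_Mon_iff[OF NF] Irr_Mon_iff[OF assms(2)] by blast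
qed

section \<open>Normal forms from exponent vectors\<close>

definition word :: "('x \<times> bool \<Rightarrow> nat) \<Rightarrow> bool \<Rightarrow> 'x multiset" where
  "word e b = (\<Sum>x\<in>Xs. replicate_mset (e (x, b)) x)"

definition of_expo :: "('x \<times> bool \<Rightarrow> nat) \<Rightarrow> 'x nf" where
  "of_expo e = Mon (word e False) (word e True)"

lemma count_word: "count (word e b) x = (if x \<in> Xs then e (x, b) else 0)"
proof -
  have "count (word e b) x = (\<Sum>y\<in>Xs. if y = x then e (y, b) else 0)"
    unfolding word_def count_sum by (rule sum.cong) auto
  then show ?thesis using fin_X by simp
qed

lemma expo_of_expo: "expo (of_expo e) i = (if i \<in> I then e i else 0)"
  by (cases i; cases "snd i") (auto simp: of_expo_def count_word)

lemma of_expo_expo: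
  assumes "Mon u v \<in> NF Xs" "\<And>i. i \<in> I \<Longrightarrow> e i = expo (Mon u v) i"
  shows "of_expo e = Mon u v"
proof -
  have "word e False = u" "word e True = v"
  proof -
    have "count u x = 0" "count v x = 0" if "x \<notin> Xs" for x
      using that NF_MonD[OF assms(1)] by (auto simp: count_eq_zero_iff)
    then show "word e False = u" "word e True = v"
      using assms(2) by (auto intro!: multiset_eqI simp: count_word)
  qed
  then show ?thesis by (simp add: of_expo_def)
qed

text \<open>Exponents that stay positive on the support keep both words nonempty.\<close>

lemma of_expo_NF:
  assumes "Mon u v \<in> NF Xs" "\<And>i. i \<in> I \<Longrightarrow> 0 < expo (Mon u v) i \<Longrightarrow> 0 < e i"
  shows "of_expo e \<in> NF Xs"
proof -
  note uv = NF_MonD[OF assms(1)]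
  obtain x y where xy: "x \<in># u" "y \<in># v" using uv by blast
  then have "0 < e (x, False)" "0 < e (y, True)" "x \<in> Xs" "y \<in> Xs"
    using assms(2)[of "(x, False)"] assms(2)[of "(y, True)"] uv by (auto simp: subset_iff)
  then have "count (word e False) x > 0" "count (word e True) y > 0" by (simp_all add: count_word)
  then have "word e False \<noteq> {#}" "word e True \<noteq> {#}" by auto
  moreover have "set_mset (word e b) \<subseteq> Xs" for b
    by (auto simp: count_word simp flip: count_greater_zero_iff split: if_splits)
  ultimately show ?thesis by (simp add: NF_def of_expo_def)
qed

lemma nf_length_of_expo: "of_expo e \<in> NF Xs \<Longrightarrow> nf_length (of_expo e) = (\<Sum>i\<in>I. e i)"
  using nf_length_expo[OF fin_X, of "word e False" "word e True"]
  by (simp add: of_expo_def[symmetric] expo_of_expo)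

text \<open>The positions whose exponent can be raised without any effect on irreducibility.\<close>

definition free_positions :: "'x nf \<Rightarrow> ('x \<times> bool) set" where
  "free_positions \<mu> = {i \<in> I. N < expo \<mu> i}"

lemma Sdeg_mon_eq: "Sdeg_mon Xs N (Mon u v) = card (free_positions (Mon u v))"
proof -
  have "free_positions (Mon u v) =
      (\<lambda>x. (x, False)) ` {x \<in> Xs. N < count u x} \<union> (\<lambda>x. (x, True)) ` {x \<in> Xs. N < count v x}"
    by (auto simp: free_positions_def image_iff split: if_splits)
  moreover have "card ((\<lambda>x. (x, b)) ` A) = card A" for A :: "'x set" and b :: bool
    by (rule card_image) (simp add: inj_on_def)
  moreover have "(\<lambda>x. (x, False)) ` {x \<in> Xs. N < count u x} \<inter> (\<lambda>x. (x, True)) ` {x \<in> Xs. N < count v x} = {}"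
    by auto
  ultimately show ?thesis using fin_X by (simp add: card_Un_disjoint del: expo.simps)
qed

definition test_mons :: "'x nf set" where
  "test_mons = {Mon u v | u v. Mon u v \<in> irr - Gen ` Xs \<and>
     (\<forall>x\<in>Xs. count u x \<in> {0, 1, N + 1} \<and> count v x \<in> {0, 1, N + 1})}"

abbreviation "d \<equiv> Sdeg Xs R S test_mons"

lemma finite_Sdeg_image: "finite (Sdeg_mon Xs N ` test_mons)"
proof (rule finite_subset)
  show "Sdeg_mon Xs N ` test_mons \<subseteq> {..card I}"
    using card_mono[OF finite_I] by (auto simp: test_mons_def Sdeg_mon_eq free_positions_def
        simp del: Sdeg_mon.simps intro!: card_mono finite_I)
qed simp

text \<open>The truncation \<open>e\<close> divides the given monomial and therefore stays
  irreducible. The value 1 preserves the support, so both words remain nonempty, and since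
  \<open>N\<close> is positive exactly the same positions exceed \<open>N\<close>.\<close>

lemma card_free_positions_le:
  assumes "Mon u v \<in> irr"
  shows "card (free_positions (Mon u v)) \<le> d"
proof -
  define e where "e i = (if N < expo (Mon u v) i then N + 1 else if 0 < expo (Mon u v) i then 1 else 0)" for i
  have uv: "Mon u v \<in> NF Xs" using assms irr_NF by blast
  have NF: "of_expo e \<in> NF Xs" by (rule of_expo_NF[OF uv]) (simp add: e_def)
  have "of_expo e \<in> irr"
    using assms NF unfolding of_expo_def
    by (rule irr_transfer) (use N_pos in \<open>auto simp: expo_of_expo[unfolded of_expo_def] e_def simp del: expo.simps\<close>)
  moreover have "count (word e b) x \<in> {0, 1, N + 1}" for b x by (simp add: count_word e_def)
  ultimately have "of_expo e \<in> test_mons" unfolding test_mons_def of_expo_def by blast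
  then have "Sdeg_mon Xs N (of_expo e) \<le> d"
    using finite_Sdeg_image unfolding Sdeg_def by (auto intro: Max_ge)
  moreover have "free_positions (of_expo e) = free_positions (Mon u v)"
    using N_pos by (auto simp: free_positions_def expo_of_expo e_def simp del: expo.simps split: if_splits)
  ultimately show ?thesis by (simp add: Sdeg_mon_eq of_expo_def del: Sdeg_mon.simps)
qed

text \<open>A positive \<open>d\<close> cannot be the value 0 that \<open>Sdeg\<close> gives to the
  empty set by convention, so the maximum is attained.\<close>

lemma free_positions_witness:
  assumes "0 < d"
  obtains u v where "Mon u v \<in> irr" "card (free_positions (Mon u v)) = d"
proof -
  have ne: "test_mons \<noteq> {}" using assms by (auto simp: Sdeg_def)
  then have "d \<in> Sdeg_mon Xs N ` test_mons"
    using Max_in[OF finite_Sdeg_image] by (simp add: Sdeg_def)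
  then show thesis using that by (auto simp: test_mons_def Sdeg_mon_eq simp del: Sdeg_mon.simps)
qed

section \<open>Polynomial bounds for bounded length\<close>

definition irr_upto :: "nat \<Rightarrow> 'x nf set" where
  "irr_upto n = {\<mu> \<in> irr. nf_length \<mu> \<le> n}"

text \<open>Irreducible brackets are sorted by their set \<open>D\<close> of positions above
  \<open>N\<close>, which has at most \<open>d\<close> elements. Positions in \<open>D\<close> take
  at most \<open>n + 1\<close> values, the others at most \<open>N + 1\<close>, and the number of
  sets \<open>D\<close> does not depend on \<open>n\<close>.\<close>

lemma card_irr_upto_upper:
  obtains K :: nat where "1 \<le> K" "\<And>n. finite (irr_upto n) \<and> card (irr_upto n) \<le> K * (n + 1) ^ d"
proof -
  define E where "E n D = (\<Pi>\<^sub>E i\<in>I. if i \<in> D then {..n} else {..N})" for n and D :: "('x \<times> bool) set"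
  define \<D> where "\<D> = {D. D \<subseteq> I \<and> card D \<le> d}"
  \<comment> \<open>\<open>2 ^ card I\<close> bounds the number of sets \<open>D\<close>,
    \<open>card Xs\<close> accounts for the letters, and \<open>Suc\<close> keeps \<open>K\<close>
    positive.\<close>
  define K where "K = Suc (card Xs + 2 ^ card I * (N + 1) ^ card I)"
  have fin\<D>: "finite \<D>" "card \<D> \<le> 2 ^ card I"
  proof -
    have "\<D> \<subseteq> Pow I" by (auto simp: \<D>_def)
    from finite_subset[OF this] card_mono[OF _ this] finite_I card_Pow[OF finite_I]
    show "finite \<D>" "card \<D> \<le> 2 ^ card I" by simp_all
  qed
  have finE: "finite (E n D)" for n D
    unfolding E_def using finite_I by (intro finite_PiE) auto
  have cardE: "card (E n D) \<le> (N + 1) ^ card I * (n + 1) ^ d" if "D \<in> \<D>" for n D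
  proof -
    have "card (E n D) = (\<Prod>i\<in>I. card (if i \<in> D then {..n} else {..N}))"
      unfolding E_def using finite_I by (rule card_PiE)
    \<comment> \<open>The factor \<open>N + 1\<close> is spent at every position, also in
      \<open>D\<close>, so that the product splits into two powers.\<close>
    also have "\<dots> \<le> (\<Prod>i\<in>I. (N + 1) * (if i \<in> D then n + 1 else 1))"
      by (rule prod_mono) auto
    also have "\<dots> = (N + 1) ^ card I * (\<Prod>i\<in>I. if i \<in> D then n + 1 else 1)"
      by (simp only: prod.distrib prod_constant)
    also have "(\<Prod>i\<in>I. if i \<in> D then n + 1 else 1) = (n + 1) ^ card (I \<inter> D)"
      using prod.inter_restrict[OF finite_I, of "\<lambda>_. n + 1" D] by simp
    also have "I \<inter> D = D" using that by (auto simp: \<D>_def)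
    also have "(n + 1) ^ card D \<le> (n + 1) ^ d" using that by (intro power_increasing) (auto simp: \<D>_def)
    finally show ?thesis by simp
  qed
  have sub: "irr_upto n \<subseteq> Gen ` Xs \<union> of_expo ` (\<Union>D\<in>\<D>. E n D)" for n
  proof
    fix \<mu> assume \<mu>: "\<mu> \<in> irr_upto n"
    show "\<mu> \<in> Gen ` Xs \<union> of_expo ` (\<Union>D\<in>\<D>. E n D)"
    proof (cases \<mu>)
      case (Gen x)
      then show ?thesis using \<mu> irr_NF by (auto simp: irr_upto_def NF_def)
    next
      case (Mon u v)
      have irr: "Mon u v \<in> irr" and NF: "Mon u v \<in> NF Xs" using \<mu> irr_NF Mon by (auto simp: irr_upto_def)
      define e where "e = restrict (expo (Mon u v)) I"
      have "expo (Mon u v) i \<le> n" if "i \<in> I" for i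
      proof -
        have "expo (Mon u v) i \<le> (\<Sum>i\<in>I. expo (Mon u v) i)" by (rule member_le_sum[OF that _ finite_I]) simp
        then show ?thesis using \<mu> nf_length_expo[OF fin_X NF] by (simp add: Mon irr_upto_def del: expo.simps nf_length.simps)
      qed
      then have "e \<in> E n (free_positions (Mon u v))"
        by (auto simp: E_def e_def free_positions_def simp del: expo.simps)
      moreover have "free_positions (Mon u v) \<in> \<D>"
        using card_free_positions_le[OF irr] by (auto simp: \<D>_def free_positions_def)
      moreover have "of_expo e = \<mu>" unfolding Mon by (rule of_expo_expo[OF NF]) (simp add: e_def)
      ultimately show ?thesis by blast
    qed
  qed
  show thesis
  proof (rule that[of K])
    fix n
    have fin: "finite (\<Union>D\<in>\<D>. E n D)" using fin\<D>(1) finE by blast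
    have "card (\<Union>D\<in>\<D>. E n D) \<le> (\<Sum>D\<in>\<D>. card (E n D))" by (rule card_UN_le[OF fin\<D>(1)])
    also have "\<dots> \<le> card \<D> * ((N + 1) ^ card I * (n + 1) ^ d)"
      using sum_bounded_above[of \<D> "\<lambda>D. card (E n D)", OF cardE] by simp
    also have "\<dots> \<le> 2 ^ card I * ((N + 1) ^ card I * (n + 1) ^ d)"
      using fin\<D>(2) by (rule mult_right_mono) simp
    finally have U: "card (\<Union>D\<in>\<D>. E n D) \<le> 2 ^ card I * (N + 1) ^ card I * (n + 1) ^ d" by simp
    have fin': "finite (Gen ` Xs \<union> of_expo ` (\<Union>D\<in>\<D>. E n D))" using fin fin_X by simp
    have "card (irr_upto n) \<le> card (Gen ` Xs \<union> of_expo ` (\<Union>D\<in>\<D>. E n D))"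
      by (rule card_mono[OF fin' sub])
    also have "\<dots> \<le> card (Gen ` Xs) + card (of_expo ` (\<Union>D\<in>\<D>. E n D))" by (rule card_Un_le)
    also have "\<dots> \<le> card Xs + 2 ^ card I * (N + 1) ^ card I * (n + 1) ^ d"
      using card_image_le[OF fin_X, of Gen] card_image_le[OF fin, of of_expo] U by linarith
    also have "\<dots> \<le> K * (n + 1) ^ d"
    proof -
      have "card Xs * 1 \<le> card Xs * (n + 1) ^ d" by (intro mult_le_mono2 one_le_power) simp
      then have "card Xs \<le> card Xs * (n + 1) ^ d + (n + 1) ^ d" by linarith
      then show ?thesis unfolding K_def by (simp only: mult_Suc distrib_right)
    qed
    finally show "finite (irr_upto n) \<and> card (irr_upto n) \<le> K * (n + 1) ^ d"
      using finite_subset[OF sub fin'] by simp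
  qed (simp add: K_def)
qed

text \<open>In an irreducible monomial with \<open>d\<close> exponents above \<open>N\<close>, these
  can be raised independently by amounts up to \<open>m\<close>. The results are distinct and
  irreducible, and \<open>L\<close> is the length of the initial monomial.\<close>

lemma card_irr_upto_lower:
  assumes "0 < d"
  obtains L :: nat where "\<And>m. (m + 1) ^ d \<le> card (irr_upto (L + d * m))"
proof -
  obtain u v where uv: "Mon u v \<in> irr" "card (free_positions (Mon u v)) = d"
    by (rule free_positions_witness[OF assms])
  have NF: "Mon u v \<in> NF Xs" using uv irr_NF by blast
  define D where "D = free_positions (Mon u v)"
  have D: "D \<subseteq> I" "finite D" using finite_I finite_subset by (auto simp: D_def free_positions_def)
  define F where "F c = (\<lambda>i :: 'x \<times> bool. expo (Mon u v) i + (if i \<in> D then c i else 0 :: nat))" for c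
  have F_NF: "of_expo (F c) \<in> NF Xs" for c by (rule of_expo_NF[OF NF]) (simp add: F_def)
  show thesis
  proof (rule that[of "nf_length (Mon u v)"])
    fix m :: nat
    let ?C = "\<Pi>\<^sub>E i\<in>D. {..m}"
    have "of_expo (F c) \<in> irr_upto (nf_length (Mon u v) + d * m)" if "c \<in> ?C" for c
    proof -
      have "of_expo (F c) \<in> irr"
        using uv(1) F_NF[of c] unfolding of_expo_def
        by (rule irr_transfer)
           (auto simp: expo_of_expo[unfolded of_expo_def] F_def D_def free_positions_def simp del: expo.simps)
      moreover have "nf_length (of_expo (F c)) \<le> nf_length (Mon u v) + d * m"
      proof -
        have "nf_length (of_expo (F c)) = nf_length (Mon u v) + (\<Sum>i\<in>I. if i \<in> D then c i else 0)"
          unfolding nf_length_of_expo[OF F_NF] nf_length_expo[OF fin_X NF] by (simp only: F_def sum.distrib)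
        also have "(\<Sum>i\<in>I. if i \<in> D then c i else 0) = (\<Sum>i\<in>I \<inter> D. c i)"
          by (rule sum.inter_restrict[OF finite_I, symmetric])
        also have "I \<inter> D = D" using D by blast
        also have "(\<Sum>i\<in>D. c i) \<le> card D * m"
          using that sum_bounded_above[of D c m] by auto
        finally show ?thesis using uv(2) by (simp add: D_def)
      qed
      ultimately show ?thesis by (simp add: irr_upto_def)
    qed
    then have "(\<lambda>c. of_expo (F c)) ` ?C \<subseteq> irr_upto (nf_length (Mon u v) + d * m)" by blast
    moreover have "inj_on (\<lambda>c. of_expo (F c)) ?C"
    proof (rule inj_onI)
      fix a b assume ab: "a \<in> ?C" "b \<in> ?C" "of_expo (F a) = of_expo (F b)"
      have "a i = b i" if "i \<in> D" for i
      proof -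
        have "i \<in> I" using that D by blast
        moreover have "expo (of_expo (F a)) i = expo (of_expo (F b)) i" using ab(3) by simp
        ultimately show ?thesis using that by (simp add: expo_of_expo F_def del: mem_Times_iff expo.simps)
      qed
      then show "a = b" using ab(1,2) by (intro PiE_ext[of a D _ b]) auto
    qed
    moreover have "card ?C = (m + 1) ^ d" using D uv(2) by (simp add: card_PiE D_def)
    moreover obtain K where "\<And>n. finite (irr_upto n) \<and> card (irr_upto n) \<le> K * (n + 1) ^ d"
      using card_irr_upto_upper by metis
    ultimately show "(m + 1) ^ d \<le> card (irr_upto (nf_length (Mon u v) + d * m))"
      by (metis card_image card_mono)
  qed
qed

end

section \<open>The Gelfand-Kirillov dimension of a presented algebra\<close>

lemma limsup_log_upper:
  fixes c :: "nat \<Rightarrow> nat"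
  assumes K: "0 < K" and le: "\<And>n. 2 \<le> n \<Longrightarrow> real (c n) \<le> K * real n ^ d"
  shows "limsup (\<lambda>n. ereal (log (real n) (real (c n)))) \<le> ereal (real d)"
proof -
  \<comment> \<open>A constant of at least 1 has a nonnegative logarithm, so the bound also covers
    \<open>c n = 0\<close>, where \<open>log\<close> takes the value 0.\<close>
  define K' where "K' = max 1 K"
  have "\<forall>\<^sub>F n in sequentially. ereal (log (real n) (real (c n))) \<le> ereal (ln K' / ln (real n) + real d)"
  proof (rule eventually_sequentiallyI[of 2])
    fix n :: nat assume n: "2 \<le> n"
    then have ln: "0 < ln (real n)" by simp
    have K'1: "1 \<le> K'" by (simp add: K'_def)
    show "ereal (log (real n) (real (c n))) \<le> ereal (ln K' / ln (real n) + real d)"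
    proof (cases "c n = 0")
      case True
      then show ?thesis using ln K'1 by (simp add: log_def)
    next
      case False
      have "real (c n) \<le> K' * real n ^ d"
        using le[OF n] mult_right_mono[of K K' "real n ^ d"] by (simp add: K'_def)
      then have "ln (real (c n)) \<le> ln (K' * real n ^ d)" using False by (intro ln_mono) auto
      also have "\<dots> = ln K' + real d * ln (real n)"
        using K'1 n by (simp add: ln_mult ln_realpow)
      finally have "ln (real (c n)) / ln (real n) \<le> (ln K' + real d * ln (real n)) / ln (real n)"
        using ln by (intro divide_right_mono) auto
      also have "\<dots> = ln K' / ln (real n) + real d" using ln by (simp add: add_divide_distrib)
      finally show ?thesis by (simp add: log_def)
    qed
  qed
  then have "limsup (\<lambda>n. ereal (log (real n) (real (c n)))) \<le> limsup (\<lambda>n. ereal (ln K' / ln (real n) + real d))"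
    by (rule Limsup_mono)
  also have "(\<lambda>n. ln K' / ln (real n) + real d) \<longlonglongrightarrow> real d" by real_asymp
  then have "limsup (\<lambda>n. ereal (ln K' / ln (real n) + real d)) = ereal (real d)"
    by (intro lim_imp_Limsup tendsto_ereal) simp_all
  finally show ?thesis .
qed

text \<open>For \<open>d = 0\<close> the bound is nonnegativity of the logarithm of a natural
  number, with \<open>ln 0 = 0\<close> included. The counting hypothesis is restricted to
  \<open>0 < d\<close> because there may be no irreducible normal form at all when
  \<open>d = 0\<close>.\<close>

lemma limsup_log_lower:
  fixes c :: "nat \<Rightarrow> nat"
  assumes le: "\<And>m. 0 < d \<Longrightarrow> (m + 1) ^ d \<le> c (L + d * m)" and mono: "\<And>m n. m \<le> n \<Longrightarrow> c m \<le> c n"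
  shows "ereal (real d) \<le> limsup (\<lambda>n. ereal (log (real n) (real (c n))))"
proof (cases "d = 0")
  case True
  have "0 = limsup (\<lambda>n. 0 :: ereal)" by (simp add: Limsup_const)
  also have "\<dots> \<le> limsup (\<lambda>n. ereal (log (real n) (real (c n))))"
  proof (rule Limsup_mono, rule eventually_sequentiallyI[of 2])
    fix n :: nat assume "2 \<le> n"
    then show "0 \<le> ereal (log (real n) (real (c n)))"
      by (cases "c n = 0") (simp_all add: log_def)
  qed
  finally show ?thesis using True by (simp add: zero_ereal_def)
next
  case False
  then have d: "0 < d" by simp
  have "(\<lambda>n. real d * ln ((real n - real L) / real d) / ln (real n)) \<longlonglongrightarrow> real d"
    using d by real_asymp
  then have "ereal (real d) = limsup (\<lambda>n. ereal (real d * ln ((real n - real L) / real d) / ln (real n)))"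
    by (intro lim_imp_Limsup[symmetric] tendsto_ereal) simp_all
  also have "\<dots> \<le> limsup (\<lambda>n. ereal (log (real n) (real (c n))))"
  proof (rule Limsup_mono, rule eventually_sequentiallyI[of "L + 2"])
    fix n assume n: "L + 2 \<le> n"
    \<comment> \<open>The largest \<open>m\<close> with \<open>L + d * m \<le> n\<close>; for it,
      \<open>m + 1\<close> still exceeds \<open>(n - L) / d\<close>.\<close>
    define m where "m = (n - L) div d"
    have "n - L < d * (m + 1)" using d unfolding m_def by (metis Suc_eq_plus1 dividend_less_times_div mult_Suc_right)
    then have "real (n - L) \<le> real (d * (m + 1))" by (intro of_nat_mono less_imp_le)
    then have q: "(real n - real L) / real d \<le> real (m + 1)" using n d by (simp add: field_simps of_nat_diff)
    have p: "0 < (real n - real L) / real d" using n d by simp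
    have "L + d * m \<le> n" using n unfolding m_def by (metis add_leE le_add_diff_inverse add_le_cancel_left times_div_less_eq_dividend)
    then have "(m + 1) ^ d \<le> c n" using le[OF d, of m] mono order.trans by blast
    then have "real (m + 1) ^ d \<le> real (c n)" by (metis of_nat_mono of_nat_power)
    moreover have "((real n - real L) / real d) ^ d \<le> real (m + 1) ^ d" using q p by (intro power_mono) auto
    ultimately have "((real n - real L) / real d) ^ d \<le> real (c n)" by linarith
    moreover have "0 < ((real n - real L) / real d) ^ d" using p by (rule zero_less_power)
    ultimately have "ln (((real n - real L) / real d) ^ d) \<le> ln (real (c n))" by (intro ln_mono) auto
    then have "real d * ln ((real n - real L) / real d) \<le> ln (real (c n))" using p by (simp only: ln_realpow)
    then show "ereal (real d * ln ((real n - real L) / real d) / ln (real n)) \<le> ereal (log (real n) (real (c n)))"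
      using n by (simp add: log_def divide_right_mono)
  qed
  finally show ?thesis .
qed

context gs_setting
begin

text \<open>Restricted to the span \<open>M\<close> of the irreducible normal forms,
  \<open>\<phi>\<close> is a linear bijection onto \<open>A\<close>: reduction makes it onto, and
  the defining property of \<open>S\<close> makes it injective. Its inverse supplies the
  coordinates.\<close>

theorem GKdim_presentation:
  fixes A :: "('k, 'a) module"
  assumes A: "nonassoc_algebra A" and hom: "alg_hom (BC Xs) A \<phi>"
    and surj: "\<phi> ` carrier (BC Xs) = carrier A"
    and ker: "\<And>f. f \<in> carrier (BC Xs) \<Longrightarrow> \<phi> f = \<zero>\<^bsub>A\<^esub> \<longleftrightarrow> f \<in> IdS"
  shows "GKdim A = ereal (real d)"
proof -
  interpret nonassoc_algebra A by (rule A)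
  let ?P = "{f :: 'x nf \<Rightarrow>\<^sub>0 'k. Poly_Mapping.keys f \<subseteq> NF Xs}"
  have P: "pm.subspace ?P" by (rule keys_subspace)
  have cl: "\<phi> f \<in> carrier A" if "f \<in> ?P" for f using hom that unfolding alg_hom_def by auto
  have ad: "\<phi> (f + g) = \<phi> f \<oplus>\<^bsub>A\<^esub> \<phi> g" if "f \<in> ?P" "g \<in> ?P" for f g
    using hom that unfolding alg_hom_def by simp
  have sc: "\<phi> (pm_scale c f) = c \<odot>\<^bsub>A\<^esub> \<phi> f" if "f \<in> ?P" for c f
    using hom that unfolding alg_hom_def by simp
  have mu: "\<phi> (bc_mult f g) = \<phi> f \<otimes>\<^bsub>A\<^esub> \<phi> g" if "f \<in> ?P" "g \<in> ?P" for f g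
    using hom that unfolding alg_hom_def by simp
  have z: "\<phi> 0 = \<zero>\<^bsub>A\<^esub>" using ker[of 0] pm.subspace_0[OF IdS_subspace] by simp
  have eq_iff: "\<phi> f = \<phi> g \<longleftrightarrow> f - g \<in> IdS" if "f \<in> ?P" "g \<in> ?P" for f g
  proof -
    have fg: "f - g \<in> ?P" using P that by (rule pm.subspace_diff)
    have "\<phi> f = \<phi> (f - g) \<oplus>\<^bsub>A\<^esub> \<phi> g" using ad[OF fg that(2)] by simp
    then have "\<phi> f = \<phi> g \<longleftrightarrow> \<phi> (f - g) = \<zero>\<^bsub>A\<^esub>"
      using cl[OF fg] cl[OF that(2)] by simp
    then show ?thesis using ker fg by simp
  qed
  define M where "M = {f :: 'x nf \<Rightarrow>\<^sub>0 'k. Poly_Mapping.keys f \<subseteq> irr}"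
  have MP: "M \<subseteq> ?P" using irr_NF by (auto simp: M_def)
  have M: "pm.subspace M" unfolding M_def by (rule keys_subspace)
  from normal_form_exists obtain C :: nat where C: "\<forall>(f :: 'x nf \<Rightarrow>\<^sub>0 'k) m.
      Poly_Mapping.keys f \<subseteq> {\<mu> \<in> NF Xs. nf_length \<mu> \<le> m} \<longrightarrow>
       (\<exists>g. Poly_Mapping.keys g \<subseteq> {\<mu> \<in> irr. nf_length \<mu> \<le> C * m} \<and> f - g \<in> IdS)" ..
  define B where "B m = {f :: 'x nf \<Rightarrow>\<^sub>0 'k. Poly_Mapping.keys f \<subseteq> {\<mu> \<in> NF Xs. nf_length \<mu> \<le> m}}" for m
  have BP: "B m \<subseteq> ?P" for m by (auto simp: B_def)
  have B_sub: "pm.subspace (B m)" for m unfolding B_def by (rule keys_subspace)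
  have B_ex: "\<exists>m. f \<in> B m" if "f \<in> ?P" for f
    using that by (intro exI[of _ "Max (nf_length ` Poly_Mapping.keys f)"]) (auto simp: B_def)
  have nf: "\<exists>g\<in>M. Poly_Mapping.keys g \<subseteq> irr_upto (C * m) \<and> \<phi> g = \<phi> f" if f: "f \<in> B m" for f m
  proof -
    obtain g where g: "Poly_Mapping.keys g \<subseteq> {\<mu> \<in> irr. nf_length \<mu> \<le> C * m}" "f - g \<in> IdS"
      using C f unfolding B_def by blast
    then have "g \<in> M" by (auto simp: M_def)
    moreover have "\<phi> f = \<phi> g" using eq_iff[of f g] g(2) \<open>g \<in> M\<close> MP BP f by blast
    ultimately show ?thesis using g(1) by (auto simp: irr_upto_def)
  qed
  have injM: "inj_on \<phi> M"
  proof (rule inj_onI)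
    fix f g assume fg: "f \<in> M" "g \<in> M" "\<phi> f = \<phi> g"
    then have "f - g \<in> IdS" using eq_iff MP by blast
    moreover have "f - g \<in> M" using M fg(1,2) by (rule pm.subspace_diff)
    ultimately have "f - g = 0" by (intro IdS_irr_zero) (auto simp: M_def)
    then show "f = g" by simp
  qed
  have imgM: "\<phi> ` M = carrier A"
  proof
    show "\<phi> ` M \<subseteq> carrier A" using MP cl by blast
    show "carrier A \<subseteq> \<phi> ` M"
    proof
      fix a assume "a \<in> carrier A"
      then obtain f where f: "f \<in> ?P" "a = \<phi> f" using surj by auto
      then obtain m where "f \<in> B m" using B_ex by blast
      from nf[OF this] obtain g where "g \<in> M" "\<phi> g = \<phi> f" by blast
      then show "a \<in> \<phi> ` M" using f(2) by (metis imageI)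
    qed
  qed
  define \<psi> where "\<psi> = inv_into M \<phi>"
  have \<psi>: "\<psi> (\<phi> f) = f" if "f \<in> M" for f unfolding \<psi>_def using injM that by (rule inv_into_f_f)
  have pull: "\<exists>f\<in>M. a = \<phi> f" if "a \<in> carrier A" for a using that imgM by blast
  interpret coordinates A \<psi>
  proof
    show "inj_on \<psi> (carrier A)" unfolding \<psi>_def imgM[symmetric] by (rule inj_on_inv_into) simp
    fix x y assume "x \<in> carrier A" "y \<in> carrier A"
    then obtain f g where fg: "f \<in> M" "g \<in> M" "x = \<phi> f" "y = \<phi> g" using pull by metis
    then have "f + g \<in> M" using M by (intro pm.subspace_add)
    moreover have "x \<oplus>\<^bsub>A\<^esub> y = \<phi> (f + g)"
      unfolding fg(3,4) using fg(1,2) MP by (intro ad[symmetric]) blast+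
    ultimately show "\<psi> (x \<oplus>\<^bsub>A\<^esub> y) = \<psi> x + \<psi> y" using fg \<psi> by simp
  next
    fix x c assume "x \<in> carrier A"
    then obtain f where f: "f \<in> M" "x = \<phi> f" using pull by metis
    then have "pm_scale c f \<in> M" using M by (intro pm.subspace_scale)
    moreover have "c \<odot>\<^bsub>A\<^esub> x = \<phi> (pm_scale c f)"
      unfolding f(2) using f(1) MP by (intro sc[symmetric]) blast
    ultimately show "\<psi> (c \<odot>\<^bsub>A\<^esub> x) = pm_scale c (\<psi> x)" using f \<psi> by simp
  qed
  \<comment> \<open>Images of polynomials of bounded length form a multiplicative filtration, and
    every finite-dimensional subspace lies in one of its members.\<close>
  define F where "F m = \<phi> ` B m" for m
  have F_sub: "submodule (F m) scalars A" for m
  proof (rule submoduleI)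
    show "F m \<subseteq> carrier A" using BP cl unfolding F_def by blast
    show "\<zero>\<^bsub>A\<^esub> \<in> F m" unfolding F_def z[symmetric] using pm.subspace_0[OF B_sub] by blast
    show "\<ominus>\<^bsub>A\<^esub> a \<in> F m" if a: "a \<in> F m" for a
    proof -
      obtain f where f: "f \<in> B m" "a = \<phi> f" using a by (auto simp: F_def)
      have f': "f \<in> ?P" "- f \<in> B m" "- f \<in> ?P" using f BP pm.subspace_neg[OF B_sub f(1)] by blast+
      have "\<phi> (- f) \<oplus>\<^bsub>A\<^esub> \<phi> f = \<zero>\<^bsub>A\<^esub>" using ad[OF f'(3,1)] z by simp
      then have "\<ominus>\<^bsub>A\<^esub> a = \<phi> (- f)" using cl f' f(2) M.minus_equality by blast
      then show ?thesis using f' by (simp add: F_def)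
    qed
    show "a \<oplus>\<^bsub>A\<^esub> b \<in> F m" if ab: "a \<in> F m" "b \<in> F m" for a b
    proof -
      obtain f g where fg: "f \<in> B m" "a = \<phi> f" "g \<in> B m" "b = \<phi> g" using ab by (auto simp: F_def)
      have "a \<oplus>\<^bsub>A\<^esub> b = \<phi> (f + g)"
        unfolding fg(2,4) using fg(1,3) BP by (intro ad[symmetric]) blast+
      then show ?thesis using pm.subspace_add[OF B_sub fg(1,3)] by (simp add: F_def)
    qed
    show "c \<odot>\<^bsub>A\<^esub> a \<in> F m" if a: "a \<in> F m" for c a
    proof -
      obtain f where f: "f \<in> B m" "a = \<phi> f" using a by (auto simp: F_def)
      have "c \<odot>\<^bsub>A\<^esub> a = \<phi> (pm_scale c f)"
        unfolding f(2) using f(1) BP by (intro sc[symmetric]) blast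
      then show ?thesis using pm.subspace_scale[OF B_sub f(1)] by (simp add: F_def)
    qed
  qed
  have F_mono: "F m \<subseteq> F n" if "m \<le> n" for m n
    unfolding F_def B_def using that by (intro image_mono) auto
  have F_mult: "x \<otimes>\<^bsub>A\<^esub> y \<in> F (m + n)" if xy: "x \<in> F m" "y \<in> F n" for m n x y
  proof -
    obtain f g where fg: "f \<in> B m" "x = \<phi> f" "g \<in> B n" "y = \<phi> g" using xy by (auto simp: F_def)
    have "bc_mult f g \<in> B (m + n)"
      unfolding bc_mult_def
    proof (intro pm.subspace_sum[OF B_sub])
      fix \<mu> \<nu> assume "\<mu> \<in> Poly_Mapping.keys f" "\<nu> \<in> Poly_Mapping.keys g"
      then have "nf_mult \<mu> \<nu> \<in> NF Xs" "nf_length (nf_mult \<mu> \<nu>) \<le> m + n"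
        using fg(1,3) by (auto simp: B_def nf_length_mult intro!: nf_mult_NF add_mono)
      then show "Poly_Mapping.single (nf_mult \<mu> \<nu>) (Poly_Mapping.lookup f \<mu> * Poly_Mapping.lookup g \<nu>) \<in> B (m + n)"
        by (simp add: B_def)
    qed
    moreover have "x \<otimes>\<^bsub>A\<^esub> y = \<phi> (bc_mult f g)"
      unfolding fg(2,4) using fg(1,3) BP by (intro mu[symmetric]) blast+
    ultimately show ?thesis by (simp add: F_def)
  qed
  have filtration: "pow_space_upto A V n \<subseteq> F (m * n)" if V: "V \<subseteq> F m" for V m n
  proof (rule pow_space_upto_subset_filtration[where F = F, OF A])
    show "F m \<subseteq> F n" if "m \<le> n" for m n using that by (rule F_mono)
    show "x \<otimes>\<^bsub>A\<^esub> y \<in> F (m + n)" if "x \<in> F m" "y \<in> F n" for m n x y using that by (rule F_mult)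
  qed (use F_sub V in auto)
  let ?e = "\<lambda>\<mu>. Poly_Mapping.single \<mu> (1 :: 'k)"
  have F_span: "\<psi> ` F m \<subseteq> pm.span (?e ` irr_upto (C * m))" for m
  proof
    fix a assume "a \<in> \<psi> ` F m"
    then obtain f where f: "f \<in> B m" "a = \<psi> (\<phi> f)" by (auto simp: F_def)
    obtain g where g: "g \<in> M" "Poly_Mapping.keys g \<subseteq> irr_upto (C * m)" "\<phi> g = \<phi> f" using nf[OF f(1)] by blast
    then have "a = g" using f(2) \<psi> by metis
    then show "a \<in> pm.span (?e ` irr_upto (C * m))" using in_span_singles[OF g(2)] by simp
  qed
  obtain K :: nat where K: "1 \<le> K" "\<And>n. finite (irr_upto n) \<and> card (irr_upto n) \<le> K * (n + 1) ^ d"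
    using card_irr_upto_upper by metis
  have upper: "limsup (\<lambda>n. ereal (log (real n) (real (lin_dim A (pow_space_upto A V n))))) \<le> ereal (real d)"
    if V: "fin_dim_subspace A V" for V
  proof -
    obtain G where G: "finite G" "lin_basis A G V" using V by (auto simp: fin_dim_subspace_def)
    have GA: "G \<subseteq> carrier A" "V = lin_span A G" using G(2) by (auto simp: lin_basis_def)
    have "\<exists>m. a \<in> F m" if a: "a \<in> G" for a
    proof -
      obtain f where "f \<in> M" "a = \<phi> f" using pull a GA by blast
      then show ?thesis using B_ex[of f] MP by (auto simp: F_def)
    qed
    then obtain \<kappa> where \<kappa>: "\<And>a. a \<in> G \<Longrightarrow> a \<in> F (\<kappa> a)" by metis
    define m where "m = Max (insert 0 (\<kappa> ` G))"
    have "G \<subseteq> F m"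
    proof
      fix a assume a: "a \<in> G"
      then have "\<kappa> a \<le> m" unfolding m_def using G(1) by (intro Max_ge) auto
      then show "a \<in> F m" using \<kappa>[OF a] F_mono by blast
    qed
    then have VF: "V \<subseteq> F m" unfolding GA(2) by (rule lin_span_minimal[OF F_sub])
    have Vs: "submodule V scalars A" using V by (simp add: fin_dim_subspace_def)
    \<comment> \<open>With \<open>V\<close> inside \<open>F m\<close>, lengths up to
      \<open>m * n\<close> suffice before reduction and \<open>C * (m * n)\<close> after it;
      \<open>C\<close> and \<open>m\<close> only enter the constant.\<close>
    have dim: "real (lin_dim A (pow_space_upto A V n)) \<le> real (K * (C * m + 1) ^ d) * real n ^ d" if "2 \<le> n" for n
    proof -
      have "pow_space_upto A V n \<subseteq> F (m * n)"
        by (rule filtration[OF VF])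
      then have "\<psi> ` pow_space_upto A V n \<subseteq> pm.span (?e ` irr_upto (C * (m * n)))"
        using F_span by blast
      then have "lin_dim A (pow_space_upto A V n) \<le> card (?e ` irr_upto (C * (m * n)))"
        using K(2) by (intro lin_dim_bounds(1) submodule_pow_space_upto[OF A Vs]) auto
      also have "\<dots> \<le> card (irr_upto (C * (m * n)))" using K(2) by (intro card_image_le) blast
      also have "\<dots> \<le> K * (C * (m * n) + 1) ^ d" using K(2) by blast
      also have "\<dots> \<le> K * ((C * m + 1) * n) ^ d"
        using that by (intro mult_le_mono2 power_mono) (simp_all add: algebra_simps)
      finally show ?thesis by (metis (no_types, lifting) mult.assoc of_nat_mono of_nat_mult of_nat_power power_mult_distrib)
    qed
    have "0 < K * (C * m + 1) ^ d" using K(1) by simp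
    then have "0 < real (K * (C * m + 1) ^ d)" by (simp only: of_nat_0_less_iff)
    from limsup_log_upper[OF this dim] show ?thesis .
  qed
  \<comment> \<open>The lower bound is realised by the span of the generators: \<open>B 1\<close>
    consists of combinations of letters, as brackets have length at least 2.\<close>
  have V: "submodule (F 1) scalars A" by (rule F_sub)
  have pow: "\<phi> (?e \<mu>) \<in> pow_space A (F 1) (nf_length \<mu>)" if "\<mu> \<in> NF Xs" for \<mu>
    using that
  proof (induction "nf_length \<mu>" arbitrary: \<mu> rule: less_induct)
    case less
    have *: ?case if "\<mu> = nf_mult \<nu> \<xi>" "\<nu> \<in> NF Xs" "\<xi> \<in> NF Xs" for \<nu> \<xi>
    proof -
      have l: "1 \<le> nf_length \<nu>" "1 \<le> nf_length \<xi>" 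
        using NF_length_pos[OF that(2)] NF_length_pos[OF that(3)] by simp_all
      have "\<phi> (?e \<mu>) = \<phi> (?e \<nu>) \<otimes>\<^bsub>A\<^esub> \<phi> (?e \<xi>)"
        using mu[of "?e \<nu>" "?e \<xi>"] that by simp
      moreover have "\<phi> (?e \<nu>) \<in> pow_space A (F 1) (nf_length \<nu>)" "\<phi> (?e \<xi>) \<in> pow_space A (F 1) (nf_length \<xi>)"
        using l that by (intro less.hyps; simp add: nf_length_mult)+
      ultimately show ?thesis using pow_space_mult[OF A V _ _ l] that(1) by (simp add: nf_length_mult)
    qed
    show ?case
    proof (cases \<mu>)
      case (Gen x)
      then have "?e \<mu> \<in> B 1" using less.prems by (simp add: B_def)
      then show ?thesis using Gen by (simp add: pow_space.simps F_def)
    next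
      case (Mon u v)
      then have uv: "u \<noteq> {#}" "v \<noteq> {#}" "set_mset u \<subseteq> Xs" "set_mset v \<subseteq> Xs" using NF_MonD[of u v Xs] less.prems by auto
      then obtain y v' where v: "v = add_mset y v'" using multiset_cases by blast
      show ?thesis
      proof (cases "v' = {#}")
        case False
        then show ?thesis using Mon uv v by (intro *[of "Mon u v'" "Gen y"]) (auto simp: NF_def)
      next
        case v': True
        obtain z u' where u: "u = add_mset z u'" using uv multiset_cases by blast
        show ?thesis
        proof (cases "u' = {#}")
          case True
          then show ?thesis using Mon uv v u v' by (intro *[of "Gen z" "Gen y"]) (auto simp: NF_def)
        next
          case False
          then show ?thesis using Mon uv v u by (intro *[of "Gen z" "Mon u' v"]) (auto simp: NF_def)
        qed
      qed
    qed
  qed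
  have fdV: "fin_dim_subspace A (F 1)"
    by (rule fin_dim_subspaceI[OF V _ F_span]) (use K(2) in auto)
  have low: "card (irr_upto n) \<le> lin_dim A (pow_space_upto A (F 1) n)" for n
  proof -
    have "?e ` irr_upto n \<subseteq> \<psi> ` pow_space_upto A (F 1) n"
    proof (rule image_subsetI)
      fix \<mu> assume \<mu>: "\<mu> \<in> irr_upto n"
      then have \<mu>': "\<mu> \<in> NF Xs" "nf_length \<mu> \<le> n" "?e \<mu> \<in> M" using irr_NF by (auto simp: irr_upto_def M_def)
      have "\<phi> (?e \<mu>) \<in> pow_space_upto A (F 1) n"
        using pow[OF \<mu>'(1)] pow_space_upto_superset[OF A V NF_length_pos[OF \<mu>'(1)] \<mu>'(2)] by blast
      then show "?e \<mu> \<in> \<psi> ` pow_space_upto A (F 1) n" using \<psi>[OF \<mu>'(3)] by (metis imageI)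
    qed
    moreover have "\<psi> ` pow_space_upto A (F 1) n \<subseteq> pm.span (?e ` irr_upto (C * (1 * n)))"
      using filtration[of "F 1" 1 n] F_span by blast
    moreover have "finite (?e ` irr_upto (C * (1 * n)))" using K(2) by blast
    ultimately have "card (?e ` irr_upto n) \<le> lin_dim A (pow_space_upto A (F 1) n)"
      using lin_dim_bounds(2)[OF submodule_pow_space_upto[OF A V] _ _ independent_singles] by blast
    then show ?thesis by (simp add: card_image[OF inj_on_singles])
  qed
  have lower: "ereal (real d) \<le> limsup (\<lambda>n. ereal (log (real n) (real (lin_dim A (pow_space_upto A (F 1) n)))))"
  proof -
    obtain L where L: "\<And>m. 0 < d \<Longrightarrow> (m + 1) ^ d \<le> card (irr_upto (L + d * m))"
    proof (cases "0 < d")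
      case True
      then show thesis using card_irr_upto_lower that by metis
    next
      case False
      then show thesis by (intro that[of 0]) simp
    qed
    have "card (irr_upto m) \<le> card (irr_upto n)" if "m \<le> n" for m n
      using that K(2) by (intro card_mono) (auto simp: irr_upto_def)
    from limsup_log_lower[of d "\<lambda>n. card (irr_upto n)", OF L this]
    have "ereal (real d) \<le> limsup (\<lambda>n. ereal (log (real n) (real (card (irr_upto n)))))" .
    also have "\<dots> \<le> limsup (\<lambda>n. ereal (log (real n) (real (lin_dim A (pow_space_upto A (F 1) n)))))"
    proof (rule Limsup_mono, rule eventually_sequentiallyI[of 2])
      fix n :: nat assume n: "2 \<le> n"
      show "ereal (log (real n) (real (card (irr_upto n)))) \<le>
          ereal (log (real n) (real (lin_dim A (pow_space_upto A (F 1) n))))"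
      \<comment> \<open>An empty count needs separate care: \<open>log\<close> is then 0 by
        convention, which lies below the logarithm of any natural number to base
        \<open>n\<close>.\<close>
      proof (cases "card (irr_upto n) = 0")
        case True
        then show ?thesis
          using n by (cases "lin_dim A (pow_space_upto A (F 1) n) = 0") (simp_all add: log_def)
      next
        case False
        then show ?thesis using n low[of n] by simp
      qed
    qed
    finally show ?thesis .
  qed
  show ?thesis
  proof (cases "carrier A = {\<zero>\<^bsub>A\<^esub>}")
    case True
    \<comment> \<open>A single irreducible normal form would have a nonzero image in
      \<open>A\<close>. So the zero algebra leaves nothing to test, and the two conventions for the
      value 0 agree.\<close>
    have "irr = {}"
    proof (rule ccontr)
      assume "irr \<noteq> {}"
      then obtain \<mu> where "\<mu> \<in> irr" by blast
      then have "?e \<mu> \<in> M" "0 \<in> M" by (auto simp: M_def)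
      moreover from this have "\<phi> (?e \<mu>) = \<phi> 0" using True cl MP z by auto
      ultimately have "?e \<mu> = 0" using injM by (meson inj_onD)
      then show False by (metis lookup_single_eq lookup_zero one_neq_zero)
    qed
    then have "d = 0" by (simp add: Sdeg_def test_mons_def)
    then show ?thesis using True by (simp add: GKdim_def zero_ereal_def)
  next
    case False
    then have "GKdim A = (SUP V\<in>{V. fin_dim_subspace A V}.
       limsup (\<lambda>n. ereal (log (real n) (real (lin_dim A (pow_space_upto A V n))))))"
      by (simp add: GKdim_def)
    also have "\<dots> = ereal (real d)"
    proof (rule antisym)
      show "(SUP V\<in>{V. fin_dim_subspace A V}.
          limsup (\<lambda>n. ereal (log (real n) (real (lin_dim A (pow_space_upto A V n)))))) \<le> ereal (real d)"
        using upper by (intro SUP_least) simp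
      show "ereal (real d) \<le> (SUP V\<in>{V. fin_dim_subspace A V}.
          limsup (\<lambda>n. ereal (log (real n) (real (lin_dim A (pow_space_upto A V n))))))"
        using fdV by (intro order.trans[OF lower] SUP_upper) simp
    qed
    finally show ?thesis .
  qed
qed

end

section \<open>Finitely generated algebras\<close>

text \<open>
  The length has to come first: comparing only the words, $x < [u;v]$ would have to imply
  $[x;z] < [u;vz]$, that is $x \<le> u$, which fails for a letter $x$ larger than those of $u$.
\<close>

definition deglex_key :: "nat nf \<Rightarrow> nat \<times> nat multiset \<times> nat multiset" where
  "deglex_key \<mu> = (case \<mu> of Gen x \<Rightarrow> (1, {#x#}, {#}) | Mon u v \<Rightarrow> (size u + size v, u, v))"

definition deglex_less :: "(nat \<times> nat multiset \<times> nat multiset) rel" where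
  "deglex_less = less_than <*lex*> {(u, v). u < v} <*lex*> {(u, v). u < v}"

definition deglex :: "nat set \<Rightarrow> nat nf rel" where
  "deglex Xs = {(\<mu>, \<nu>). \<mu> \<in> NF Xs \<and> \<nu> \<in> NF Xs \<and> (\<mu> = \<nu> \<or> (deglex_key \<mu>, deglex_key \<nu>) \<in> deglex_less)}"

lemma deglex_less_iff:
  "((m, u, v), (n, u', v')) \<in> deglex_less \<longleftrightarrow> m < n \<or> m = n \<and> (u < u' \<or> u = u' \<and> v < v')"
  by (auto simp: deglex_less_def)

lemma wf_deglex_less: "wf deglex_less"
  unfolding deglex_less_def by (intro wf_lex_prod wf_less_than wf)

lemma inj_on_deglex_key: "inj_on deglex_key (NF Xs)"
  by (rule inj_onI) (auto simp: deglex_key_def NF_def split: nf.splits)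

lemma deglex_minus_Id:
  "(\<mu>, \<nu>) \<in> deglex Xs - Id \<longleftrightarrow> \<mu> \<in> NF Xs \<and> \<nu> \<in> NF Xs \<and> (deglex_key \<mu>, deglex_key \<nu>) \<in> deglex_less"
proof -
  have "(deglex_key \<xi>, deglex_key \<xi>) \<notin> deglex_less" for \<xi> using wf_deglex_less by (rule wf_not_refl)
  then show ?thesis by (auto simp: deglex_def)
qed

text \<open>Length is additive, so unequal lengths decide as before. Equal lengths occur only
  between two letters or between two brackets, since brackets have length at least 2; there the
  multiset order is compatible with adding a word.\<close>

lemma deglex_less_mult:
  assumes "(deglex_key \<mu>, deglex_key \<nu>) \<in> deglex_less" "\<mu> \<in> NF Xs" "\<nu> \<in> NF Xs"
  shows "(deglex_key (nf_mult \<mu> \<xi>), deglex_key (nf_mult \<nu> \<xi>)) \<in> deglex_less"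
    "(deglex_key (nf_mult \<xi> \<mu>), deglex_key (nf_mult \<xi> \<nu>)) \<in> deglex_less"
proof -
  have "size u > 0 \<and> size v > 0" if "Mon u v \<in> NF Xs" for u v
    using NF_MonD[OF that] by (simp add: nonempty_has_size)
  then show "(deglex_key (nf_mult \<mu> \<xi>), deglex_key (nf_mult \<nu> \<xi>)) \<in> deglex_less"
    "(deglex_key (nf_mult \<xi> \<mu>), deglex_key (nf_mult \<xi> \<nu>)) \<in> deglex_less"
    using assms by (cases \<mu>; cases \<nu>; cases \<xi>; fastforce simp: deglex_key_def deglex_less_iff)+
qed

lemma monomial_order_deglex: "monomial_order Xs (deglex Xs)"
proof -
  have tr: "trans deglex_less"
    unfolding deglex_less_def by (intro trans_lex_prod) (auto intro: transI)
  have tot: "\<mu> = \<nu> \<or> (deglex_key \<mu>, deglex_key \<nu>) \<in> deglex_less \<or> (deglex_key \<nu>, deglex_key \<mu>) \<in> deglex_less"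
    if "\<mu> \<in> NF Xs" "\<nu> \<in> NF Xs" for \<mu> \<nu>
  proof -
    have "k = l \<or> (k, l) \<in> deglex_less \<or> (l, k) \<in> deglex_less" for k l
      by (cases k; cases l) (auto simp: deglex_less_iff neq_iff)
    then show ?thesis using inj_onD[OF inj_on_deglex_key _ that] by blast
  qed
  have irr: "(k, k) \<notin> deglex_less" for k using wf_deglex_less by (rule wf_not_refl)
  have "well_order_on (NF Xs) (deglex Xs)"
    unfolding well_order_on_def linear_order_on_def partial_order_on_def preorder_on_def
  proof (intro conjI)
    show "deglex Xs \<subseteq> NF Xs \<times> NF Xs" by (auto simp: deglex_def)
    show "refl_on (NF Xs) (deglex Xs)" by (auto simp: deglex_def refl_on_def)
    show "trans (deglex Xs)" using tr by (auto simp: deglex_def intro!: transI dest: transD)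
    show "antisym (deglex Xs)"
      using transD[OF tr] irr unfolding deglex_def by (intro antisymI) blast
    show "total_on (NF Xs) (deglex Xs)" using tot by (auto simp: deglex_def total_on_def)
    show "wf (deglex Xs - Id)"
    proof (rule wf_subset)
      show "wf (inv_image deglex_less deglex_key)" using wf_deglex_less by (rule wf_inv_image)
      show "deglex Xs - Id \<subseteq> inv_image deglex_less deglex_key"
        using deglex_minus_Id by (auto simp: inv_image_def)
    qed
  qed
  moreover have "(nf_mult \<mu> \<xi>, nf_mult \<nu> \<xi>) \<in> deglex Xs - Id \<and> (nf_mult \<xi> \<mu>, nf_mult \<xi> \<nu>) \<in> deglex Xs - Id"
    if "\<mu> \<in> NF Xs" "\<nu> \<in> NF Xs" "\<xi> \<in> NF Xs" "(\<mu>, \<nu>) \<in> deglex Xs - Id" for \<mu> \<nu> \<xi>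
    using that deglex_less_mult[of \<mu> \<nu> Xs \<xi>] unfolding deglex_minus_Id by (simp add: nf_mult_NF)
  ultimately show ?thesis unfolding monomial_order_def by blast
qed

section \<open>Finite Groebner-Shirshov bases of ideals\<close>

context nf_order
begin

lemma monic_multiple:
  fixes f :: "'x nf \<Rightarrow>\<^sub>0 'k::field"
  assumes "f \<noteq> 0" "Poly_Mapping.keys f \<subseteq> NF Xs"
  shows "\<exists>c. pm_scale c f \<noteq> 0 \<and> lead R (pm_scale c f) = lead R f \<and> Poly_Mapping.lookup (pm_scale c f) (lead R f) = 1"
proof -
  let ?c = "1 / Poly_Mapping.lookup f (lead R f)"
  have c: "Poly_Mapping.lookup f (lead R f) \<noteq> 0" using lead_maximal(1)[OF assms] by (simp add: in_keys_iff)
  then have k: "Poly_Mapping.keys (pm_scale ?c f) = Poly_Mapping.keys f" by (auto simp: in_keys_iff)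
  then have "lead R (pm_scale ?c f) = lead R f" by (simp add: lead_def)
  moreover have "pm_scale ?c f \<noteq> 0" using k assms(1) by (metis keys_eq_empty)
  ultimately show ?thesis using c by (intro exI[of _ ?c]) simp
qed

lemma expo_dvd: "Mon u v \<in> NF Xs \<Longrightarrow> Mon u' v' \<in> NF Xs \<Longrightarrow>
  (\<forall>i\<in>Xs \<times> UNIV. expo (Mon u v) i \<le> expo (Mon u' v') i) \<longleftrightarrow> u \<subseteq># u' \<and> v \<subseteq># v'"
proof
  assume NF: "Mon u v \<in> NF Xs"
  assume *: "\<forall>i\<in>Xs \<times> UNIV. expo (Mon u v) i \<le> expo (Mon u' v') i"
  have "expo (Mon u v) i \<le> expo (Mon u' v') i" for i
    using * expo_outside[OF NF, of i] by (cases "i \<in> Xs \<times> UNIV") auto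
  from this[of "(_, False)"] this[of "(_, True)"] show "u \<subseteq># u' \<and> v \<subseteq># v'"
    by (simp add: subseteq_mset_def)
qed (auto simp: subseteq_mset_def)

text \<open>A monic element of \<open>J\<close> is picked for each of finitely many leading brackets
  that together divide into all others, and for each leading letter. These generate \<open>J\<close>
  by reduction: the irreducible remainder of an element of \<open>J\<close> lies in
  \<open>J\<close>, and if it were nonzero, its leading monomial would be reducible.\<close>

theorem finite_GS_basis_exists:
  fixes J :: "('x nf \<Rightarrow>\<^sub>0 'k::field) set"
  assumes fin: "finite Xs" and J: "alg_ideal (BC Xs) J"
  shows "\<exists>S. finite S \<and> GS_basis Xs R S \<and> gen_ideal (BC Xs) S = J"
proof -
  have sub: "pm.subspace J" "J \<subseteq> {f. Poly_Mapping.keys f \<subseteq> NF Xs}"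
    using submodule_BC J unfolding alg_ideal_def by blast+
  define T where "T = lead R ` (J - {0})"
  have T_NF: "T \<subseteq> NF Xs" unfolding T_def using lead_maximal(1) sub(2) by fastforce
  have pick: "\<exists>f. f \<in> J \<and> f \<noteq> 0 \<and> lead R f = \<mu> \<and> Poly_Mapping.lookup f \<mu> = 1" if "\<mu> \<in> T" for \<mu>
  proof -
    obtain f where f: "f \<in> J" "f \<noteq> 0" "\<mu> = lead R f" using \<open>\<mu> \<in> T\<close> by (auto simp: T_def)
    then obtain c where "pm_scale c f \<noteq> 0 \<and> lead R (pm_scale c f) = lead R f \<and>
        Poly_Mapping.lookup (pm_scale c f) (lead R f) = 1"
      using monic_multiple[of f] sub(2) by blast
    then show ?thesis using f pm.subspace_scale[OF sub(1) f(1), of c] by auto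
  qed
  then obtain s where s: "\<And>\<mu>. \<mu> \<in> T \<Longrightarrow> s \<mu> \<in> J \<and> s \<mu> \<noteq> 0 \<and> lead R (s \<mu>) = \<mu> \<and> Poly_Mapping.lookup (s \<mu>) \<mu> = 1"
    by metis
  \<comment> \<open>Letters are set aside: their exponent vector 0 would lie below every other,
    although a letter leads no shifted normal S-polynomial. There are finitely many of them, and
    \<open>S\<close> receives an element for each that occurs.\<close>
  define U where "U = expo ` (T - range Gen)"
  have "\<exists>M\<subseteq>U. finite M \<and> (\<forall>a\<in>U. \<exists>b\<in>M. \<forall>i\<in>Xs \<times> UNIV. b i \<le> a i)"
  proof (rule dickson)
    show "finite (Xs \<times> (UNIV :: bool set))" using fin by simp
    fix a b assume ab: "a \<in> U" "b \<in> U" "\<forall>i\<in>Xs \<times> UNIV. a i = b i"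
    then obtain \<mu> \<nu> where m: "\<mu> \<in> NF Xs" "\<nu> \<in> NF Xs" "a = expo \<mu>" "b = expo \<nu>"
      using T_NF unfolding U_def by blast
    show "a = b"
    proof
      fix i
      show "a i = b i" using ab(3) expo_outside[OF m(1), of i] expo_outside[OF m(2), of i] m(3,4)
        by (cases "i \<in> Xs \<times> UNIV") auto
    qed
  qed
  then obtain M where M: "M \<subseteq> U" "finite M" "\<And>a. a \<in> U \<Longrightarrow> \<exists>b\<in>M. \<forall>i\<in>Xs \<times> UNIV. b i \<le> a i" by blast
  obtain T' where T': "T' \<subseteq> T - range Gen" "finite T'" "M = expo ` T'"
    using finite_subset_image[OF M(2) M(1)[unfolded U_def]] by blast
  define S where "S = s ` (T' \<union> (T \<inter> Gen ` Xs))"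
  have SJ: "S \<subseteq> J" using s T'(1) by (auto simp: S_def)
  have fS: "finite S" using T'(2) fin by (simp add: S_def)
  have idS: "alg_ideal (BC Xs) (gen_ideal (BC Xs) S)" and S_id: "S \<subseteq> gen_ideal (BC Xs) S"
    using gen_ideal_ideal[OF BC_algebra, of S Xs] SJ sub(2) by auto
  have idSJ: "gen_ideal (BC Xs) S \<subseteq> J" unfolding gen_ideal_def using J SJ by blast
  have lead_ex: "\<exists>h\<in>normal_S_polys Xs R S. lead R f = lead R h" if f: "f \<in> J" "f \<noteq> 0" for f
  proof -
    have fT: "lead R f \<in> T" using f by (simp add: T_def)
    show ?thesis
    proof (cases "lead R f")
      case (Gen x)
      then have "x \<in> Xs" using fT T_NF by (auto simp: NF_def)
      then have "s (lead R f) \<in> S" using fT Gen by (auto simp: S_def)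
      then have "s (lead R f) \<in> normal_S_polys Xs R S" by (simp add: normal_S_polys_def)
      then show ?thesis using s[OF fT] by metis
    next
      case (Mon u v)
      then have "lead R f \<in> T - range Gen" using fT by auto
      then have "expo (lead R f) \<in> U" unfolding U_def by (rule imageI)
      from M(3)[OF this] obtain \<nu> where \<nu>: "\<nu> \<in> T'" "\<forall>i\<in>Xs \<times> UNIV. expo \<nu> i \<le> expo (lead R f) i"
        using T'(3) by blast
      then have \<nu>T: "\<nu> \<in> T" "\<nu> \<notin> range Gen" using T'(1) by auto
      then obtain p q where pq: "\<nu> = Mon p q" by (cases \<nu>) auto
      have NF: "Mon p q \<in> NF Xs" "Mon u v \<in> NF Xs" using \<nu>T(1) fT T_NF pq Mon by auto
      have dv: "p \<subseteq># u" "q \<subseteq># v" using \<nu>(2) expo_dvd[OF NF] pq Mon by simp_all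
      obtain zs ys where zy: "mset zs = u - p" "mset ys = v - q" by (metis ex_mset)
      then have zs: "set zs \<subseteq> Xs" "set ys \<subseteq> Xs"
        using NF_MonD[OF NF(2)] in_diffD by (metis set_mset_mset subset_eq)+
      let ?h = "poly_shift Xs zs ys (s \<nu>)"
      have sS: "s \<nu> \<in> S" using \<nu>(1) by (simp add: S_def)
      have "2 \<le> nf_length (lead R (s \<nu>))"
        using s[OF \<nu>T(1)] pq NF_MonD[OF NF(1)] nonempty_has_size[of p] nonempty_has_size[of q] by simp
      then have "?h \<in> normal_S_polys Xs R S"
        using sS zs unfolding normal_S_polys_def poly_shift_def by blast
      moreover have "lead R ?h = nf_shift zs ys \<nu>"
        using lead_poly_shift(1)[of "s \<nu>" zs ys] s[OF \<nu>T(1)] sub(2) zs by auto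
      moreover have "nf_shift zs ys \<nu> = lead R f"
        using dv zy by (simp add: pq Mon nf_shift_Mon)
      ultimately show ?thesis by metis
    qed
  qed
  have GS: "GS_basis Xs R S"
    unfolding GS_basis_def monic_set_def
  proof (intro conjI ballI impI)
    show "S \<subseteq> carrier (BC Xs)" using SJ sub(2) by auto
    fix f assume "f \<in> S"
    then obtain \<mu> where "f = s \<mu>" "\<mu> \<in> T" using T'(1) by (auto simp: S_def)
    then show "f \<noteq> 0" "Poly_Mapping.lookup f (lead R f) = 1" using s[of \<mu>] by auto
  next
    fix f assume "f \<in> gen_ideal (BC Xs) S" "f \<noteq> 0"
    then show "\<exists>h\<in>normal_S_polys Xs R S. lead R f = lead R h" using idSJ lead_ex by blast
  qed
  interpret gs_setting Xs R S using fin fS GS by unfold_locales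
  have "f \<in> gen_ideal (BC Xs) S" if f: "f \<in> J" for f
  proof -
    have "Poly_Mapping.keys f \<subseteq> {\<mu> \<in> NF Xs. nf_length \<mu> \<le> Max (nf_length ` Poly_Mapping.keys f)}"
      using f sub(2) by auto
    moreover from normal_form_exists obtain C :: nat where "\<forall>(f :: 'x nf \<Rightarrow>\<^sub>0 'k) m.
        Poly_Mapping.keys f \<subseteq> {\<mu> \<in> NF Xs. nf_length \<mu> \<le> m} \<longrightarrow>
        (\<exists>g. Poly_Mapping.keys g \<subseteq> {\<mu> \<in> irr. nf_length \<mu> \<le> C * m} \<and> f - g \<in> IdS)" ..
    ultimately obtain g where g: "Poly_Mapping.keys g \<subseteq> irr" "f - g \<in> IdS" by blast
    have "f - (f - g) \<in> J" by (rule pm.subspace_diff[OF sub(1) f]) (use g(2) idSJ in blast)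
    then have gJ: "g \<in> J" by simp
    have "g = 0"
    proof (rule ccontr)
      assume "g \<noteq> 0"
      then have "lead R g \<in> Poly_Mapping.keys g" using gJ sub(2) by (intro lead_maximal(1)) auto
      then show False using lead_ex[OF gJ \<open>g \<noteq> 0\<close>] g(1) by (auto simp: Irr_def)
    qed
    then show ?thesis using g(2) by simp
  qed
  then show ?thesis using fS GS idSJ by blast
qed

end

section \<open>Presentations of finitely generated algebras\<close>

lemma kernel_ideal:
  fixes A :: "('k::field, 'a) module" and B :: "('k, 'b) module"
  assumes A: "nonassoc_algebra A" and B: "nonassoc_algebra B" and hom: "alg_hom A B \<phi>"
  shows "alg_ideal A {x \<in> carrier A. \<phi> x = \<zero>\<^bsub>B\<^esub>}" "\<phi> \<zero>\<^bsub>A\<^esub> = \<zero>\<^bsub>B\<^esub>"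
proof -
  interpret A: nonassoc_algebra A by fact
  interpret B: nonassoc_algebra B by fact
  note h = hom[unfolded alg_hom_def]
  have cl: "\<phi> x \<in> carrier B" if "x \<in> carrier A" for x using h that by auto
  have "\<phi> (0 \<odot>\<^bsub>A\<^esub> \<zero>\<^bsub>A\<^esub>) = 0 \<odot>\<^bsub>B\<^esub> \<phi> \<zero>\<^bsub>A\<^esub>" using h A.M.zero_closed by blast
  then show z: "\<phi> \<zero>\<^bsub>A\<^esub> = \<zero>\<^bsub>B\<^esub>"
    using A.smult_l_null[of "\<zero>\<^bsub>A\<^esub>"] B.smult_l_null[OF cl[of "\<zero>\<^bsub>A\<^esub>"]] by simp
  have zl: "\<zero>\<^bsub>B\<^esub> \<otimes>\<^bsub>B\<^esub> x = \<zero>\<^bsub>B\<^esub>" "x \<otimes>\<^bsub>B\<^esub> \<zero>\<^bsub>B\<^esub> = \<zero>\<^bsub>B\<^esub>" if "x \<in> carrier B" for x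
    using that B.mult_smult_left[of "\<zero>\<^bsub>B\<^esub>" x 0] B.mult_smult_right[of x "\<zero>\<^bsub>B\<^esub>" 0]
      B.smult_l_null[of "\<zero>\<^bsub>B\<^esub>"] B.smult_l_null[of "\<zero>\<^bsub>B\<^esub> \<otimes>\<^bsub>B\<^esub> x"] B.smult_l_null[of "x \<otimes>\<^bsub>B\<^esub> \<zero>\<^bsub>B\<^esub>"]
    by (simp_all add: B.mult_closed)
  show "alg_ideal A {x \<in> carrier A. \<phi> x = \<zero>\<^bsub>B\<^esub>}"
    unfolding alg_ideal_def
  proof (intro conjI ballI)
    show "submodule {x \<in> carrier A. \<phi> x = \<zero>\<^bsub>B\<^esub>} scalars A"
    proof (rule A.submoduleI)
      fix a assume a: "a \<in> {x \<in> carrier A. \<phi> x = \<zero>\<^bsub>B\<^esub>}"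
      have "\<phi> (\<ominus>\<^bsub>A\<^esub> a \<oplus>\<^bsub>A\<^esub> a) = \<phi> (\<ominus>\<^bsub>A\<^esub> a) \<oplus>\<^bsub>B\<^esub> \<phi> a"
        using h a by (metis (no_types, lifting) A.M.a_inv_closed mem_Collect_eq)
      then show "\<ominus>\<^bsub>A\<^esub> a \<in> {x \<in> carrier A. \<phi> x = \<zero>\<^bsub>B\<^esub>}"
        using a z cl[of "\<ominus>\<^bsub>A\<^esub> a"] by (simp add: A.M.l_neg)
    next
      fix c :: 'k and x assume "c \<in> carrier scalars" "x \<in> {x \<in> carrier A. \<phi> x = \<zero>\<^bsub>B\<^esub>}"
      then show "c \<odot>\<^bsub>A\<^esub> x \<in> {x \<in> carrier A. \<phi> x = \<zero>\<^bsub>B\<^esub>}" using h by simp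
    qed (use h z in auto)
  next
    fix a x assume "a \<in> {x \<in> carrier A. \<phi> x = \<zero>\<^bsub>B\<^esub>}" "x \<in> carrier A"
    then show "x \<otimes>\<^bsub>A\<^esub> a \<in> {x \<in> carrier A. \<phi> x = \<zero>\<^bsub>B\<^esub>}" "a \<otimes>\<^bsub>A\<^esub> x \<in> {x \<in> carrier A. \<phi> x = \<zero>\<^bsub>B\<^esub>}"
      using h zl cl[of x] by (simp_all add: A.mult_closed)
  qed
qed

lemma finitely_generated_GKdim:
  fixes A :: "('k::field, 'a) module"
  assumes bic: "bicommutative_algebra A" and fg: "finitely_generated_alg A"
  shows "\<exists>d::nat. GKdim A = ereal (real d)"
proof -
  have A: "nonassoc_algebra A" using bic by (rule bicommutative_algebra.axioms(1))
  interpret A: nonassoc_algebra A by (rule A)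
  obtain G where G: "finite G" "G \<subseteq> carrier A"
    and gen: "\<Inter>{W. submodule W scalars A \<and> (\<forall>x\<in>W. \<forall>y\<in>W. x \<otimes>\<^bsub>A\<^esub> y \<in> W) \<and> G \<subseteq> W} = carrier A"
    using fg unfolding finitely_generated_alg_def by blast
  \<comment> \<open>Numbering the generators gives an alphabet of natural numbers, on which
    \<open>deglex\<close> is available whatever the carrier type of \<open>A\<close>.\<close>
  obtain h :: "nat \<Rightarrow> 'a" and n where h: "G = h ` {..<n}"
    using finite_imp_nat_seg_image_inj_on[OF G(1)] by (metis lessThan_def)
  let ?X = "{..<n}"
  have "h \<in> ?X \<rightarrow> carrier A" using h G(2) by auto
  then obtain \<phi> where hom: "alg_hom (BC ?X) A \<phi>" and \<phi>: "\<forall>x\<in>?X. \<phi> (Defs.gen x) = h x"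
    using BC_universal[OF bic] by blast
  note ker = kernel_ideal[OF BC_algebra A hom]
  have hm: "\<phi> f \<in> carrier A" "\<phi> f \<oplus>\<^bsub>A\<^esub> \<phi> g = \<phi> (f \<oplus>\<^bsub>BC ?X\<^esub> g)" "c \<odot>\<^bsub>A\<^esub> \<phi> f = \<phi> (c \<odot>\<^bsub>BC ?X\<^esub> f)"
      "\<phi> f \<otimes>\<^bsub>A\<^esub> \<phi> g = \<phi> (f \<otimes>\<^bsub>BC ?X\<^esub> g)" if "f \<in> carrier (BC ?X)" "g \<in> carrier (BC ?X)" for f g c
    using hom that unfolding alg_hom_def by auto
  interpret BC: nonassoc_algebra "BC ?X :: ('k, nat nf \<Rightarrow>\<^sub>0 'k) module" by (rule BC_algebra)
  \<comment> \<open>The image of \<open>\<phi>\<close> is a subalgebra that contains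
    \<open>G\<close>, so finite generation makes it the whole carrier.\<close>
  let ?W = "\<phi> ` carrier (BC ?X)"
  have "submodule ?W scalars A"
  proof (rule A.submoduleI)
    show "?W \<subseteq> carrier A" using hm(1) by blast
    show "\<zero>\<^bsub>A\<^esub> \<in> ?W" using ker(2) BC.M.zero_closed by (metis imageI)
    show "\<ominus>\<^bsub>A\<^esub> a \<in> ?W" if a: "a \<in> ?W" for a
    proof -
      obtain f where f: "f \<in> carrier (BC ?X)" "a = \<phi> f" using a by blast
      have f': "\<ominus>\<^bsub>BC ?X\<^esub> f \<in> carrier (BC ?X)" using f(1) by (rule BC.M.a_inv_closed)
      have "\<phi> (\<ominus>\<^bsub>BC ?X\<^esub> f) \<oplus>\<^bsub>A\<^esub> \<phi> f = \<zero>\<^bsub>A\<^esub>"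
        using hm(2)[OF f' f(1)] BC.M.l_neg[OF f(1)] ker(2) by simp
      then have "\<ominus>\<^bsub>A\<^esub> a = \<phi> (\<ominus>\<^bsub>BC ?X\<^esub> f)"
        using hm(1)[OF f' f'] hm(1)[OF f(1) f(1)] f(2) A.M.minus_equality by blast
      then show ?thesis using f' by blast
    qed
    show "a \<oplus>\<^bsub>A\<^esub> b \<in> ?W" if ab: "a \<in> ?W" "b \<in> ?W" for a b
    proof -
      obtain f g where fg: "f \<in> carrier (BC ?X)" "a = \<phi> f" "g \<in> carrier (BC ?X)" "b = \<phi> g" using ab by blast
      then show ?thesis using hm(2)[OF fg(1,3)] BC.M.a_closed[OF fg(1,3)] by (metis imageI)
    qed
    show "c \<odot>\<^bsub>A\<^esub> a \<in> ?W" if a: "a \<in> ?W" for c a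
    proof -
      obtain f where f: "f \<in> carrier (BC ?X)" "a = \<phi> f" using a by blast
      have "c \<odot>\<^bsub>BC ?X\<^esub> f \<in> carrier (BC ?X)" using BC.smult_closed[of c f] f(1) by (simp only: scalars_simps UNIV_I)
      then show ?thesis using hm(3)[OF f(1) f(1), of c] f(2) by blast
    qed
  qed
  moreover have "\<forall>x\<in>?W. \<forall>y\<in>?W. x \<otimes>\<^bsub>A\<^esub> y \<in> ?W"
  proof (intro ballI, elim imageE)
    fix x y f g assume "x = \<phi> f" "y = \<phi> g" and fg: "f \<in> carrier (BC ?X)" "g \<in> carrier (BC ?X)"
    then show "x \<otimes>\<^bsub>A\<^esub> y \<in> ?W" using hm(4)[OF fg] BC.mult_closed[OF fg] by (metis imageI)
  qed
  moreover have "G \<subseteq> ?W"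
  proof
    fix a assume "a \<in> G"
    then obtain x where x: "x \<in> ?X" "a = h x" using h by blast
    then have "(Defs.gen x :: nat nf \<Rightarrow>\<^sub>0 'k) \<in> carrier (BC ?X)" by (simp add: gen_def NF_def)
    then show "a \<in> ?W" using \<phi> x by (metis imageI)
  qed
  ultimately have "carrier A \<subseteq> ?W" unfolding gen[symmetric] by blast
  then have surj: "?W = carrier A" using hm(1) by blast
  have ord: "nf_order ?X (deglex ?X)" by (rule nf_order.intro[OF monomial_order_deglex])
  obtain S where S: "finite S" "GS_basis ?X (deglex ?X) S"
    "gen_ideal (BC ?X) S = {f \<in> carrier (BC ?X). \<phi> f = \<zero>\<^bsub>A\<^esub>}"
    using nf_order.finite_GS_basis_exists[OF ord _ ker(1)] by blast
  have "gs_setting ?X (deglex ?X) S"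
    using ord S(1,2) by (intro gs_setting.intro gs_setting_axioms.intro) simp_all
  from gs_setting.GKdim_presentation[OF this A hom surj] show ?thesis using S(3) by blast
qed

theorem theorem4p2:
  fixes Xs :: "'x set" and R :: "'x nf rel" and S :: "('x nf \<Rightarrow>\<^sub>0 'k::field) set"
    and A :: "('k, 'a) module"
  shows "(finite Xs \<and> Xs \<noteq> {} \<and> monomial_order Xs R \<and> finite S \<and> GS_basis Xs R S \<longrightarrow>
      GKdim (quot_alg (BC Xs) (gen_ideal (BC Xs) S)) =
        ereal (real (Sdeg Xs R S
          {Mon u v | u v. Mon u v \<in> Irr Xs R S - Gen ` Xs \<and>
             (\<forall>x\<in>Xs. count u x \<in> {0, 1, N_of Xs R S + 1} \<and> count v x \<in> {0, 1, N_of Xs R S + 1})})))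
    \<and> (bicommutative_algebra A \<and> finitely_generated_alg A \<longrightarrow>
      (\<exists>d::nat. GKdim A = ereal (real d)))"
proof (intro conjI impI)
  assume *: "finite Xs \<and> Xs \<noteq> {} \<and> monomial_order Xs R \<and> finite S \<and> GS_basis Xs R S"
  then interpret gs_setting Xs R S by unfold_locales auto
  note proj = quot_alg_proj[OF BC_algebra ideal_IdS]
  \<comment> \<open>The algebra axioms are transported along the projection; the zero coset is the
    image of 0 because 0 lies in the ideal.\<close>
  have "nonassoc_algebra (quot_alg (BC Xs) IdS)"
    using proj(3) pm.subspace_0[OF IdS_subspace]
    by (intro nonassoc_algebra_hom_image[OF BC_algebra proj(1,2)]) simp
  from GKdim_presentation[OF this proj(1,2)] proj(3)
  have "GKdim (quot_alg (BC Xs) IdS) = ereal (real d)" by blast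
  then show "GKdim (quot_alg (BC Xs) (gen_ideal (BC Xs) S)) =
        ereal (real (Sdeg Xs R S
          {Mon u v | u v. Mon u v \<in> Irr Xs R S - Gen ` Xs \<and>
             (\<forall>x\<in>Xs. count u x \<in> {0, 1, N_of Xs R S + 1} \<and> count v x \<in> {0, 1, N_of Xs R S + 1})}))"
    by (simp only: test_mons_def)
qed (use finitely_generated_GKdim in blast)

end
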